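(* There is a one-to-one correspondence between Veronese webs on the plane $\mathbb{R}^2$, considered up to Möbius transformations of the projective parameter $(s:t)\in\mathbb{R}P^1$, and torsion-free linear connections on $\mathbb{R}^2$ whose Ricci tensor is skew-symmetric. Explicitly, the assignment $\{\mathcal{F}_{(s:t)}\}\mapsto\nabla^{\mathcal{F}}$, sending a Veronese web on $\mathbb{R}^2$ to its associated connection, induces a bijection between the set of Veronese webs on $\mathbb{R}^2$ modulo Möbius transformations of the parameter and the set of torsion-free linear connections on $\mathbb{R}^2$ with skew-symmetric Ricci tensor.
   Context: Everything is smooth. A Veronese web on a surface $M$ (here $M=\mathbb{R}^2$) is a family $\{\mathcal{F}_{(s:t)}\}_{(s:t)\in\mathbb{R}P^1}$ of one-dimensional foliations of $M$ such that every point of $M$ has a neighbourhood $U$ with pointwise linearly independent one-forms $\omega_0,\omega_1$ on $U$ satisfying $T\mathcal{F}_{(s:t)}|_U=\ker(s\omega_0+t\omega_1)$ for all $(s:t)\in\mathbb{R}P^1$. One writes $\mathcal{F}_t=\mathcal{F}_{(1:t)}$ for $t\in\mathbb{R}$ and $\mathcal{F}_\infty=\mathcal{F}_{(0:1)}$. Two Veronese webs $\{\mathcal{F}_{(s:t)}\}$ and $\{\mathcal{F}'_{(s:t)}\}$ differ by a Möbius transformation of the parameter if there is $A\in PGL(2,\mathbb{R})$ with $\mathcal{F}'_{p}=\mathcal{F}_{A(p)}$ for all $p\in\mathbb{R}P^1$. The connection $\nabla^{\mathcal{F}}$ associated to a Veronese web is defined as follows. Fix $t_0\in\mathbb{R}\setminus\{0\}$.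 Near any point there are local coordinates $(x,y)$ and a function $w=w(x,y)$ with $w_x,w_y$ nowhere zero such that $T\mathcal{F}_0=\ker dx$, $T\mathcal{F}_\infty=\ker dy$, $T\mathcal{F}_{t_0}=\ker dw$, and then $T\mathcal{F}_t=\ker(t_0w_x\,dx+t\,w_y\,dy)$ for all $t\in\mathbb{R}$. In such coordinates $$\nabla^{\mathcal{F}}_{\partial_x}\partial_x=\frac{w_yw_{xx}-w_xw_{xy}}{w_xw_y}\,\partial_x,\quad \nabla^{\mathcal{F}}_{\partial_y}\partial_y=\frac{w_xw_{yy}-w_yw_{xy}}{w_xw_y}\,\partial_y,\quad \nabla^{\mathcal{F}}_{\partial_x}\partial_y=\nabla^{\mathcal{F}}_{\partial_y}\partial_x=0.$$ This does not depend on the choices of $t_0$, $(x,y)$ and $w$, so it defines a global connection. The Ricci tensor of a linear connection $\nabla$ with curvature $R$ is $Ric(Y,Z)=\mathrm{tr}\,(X\mapsto R(X,Y)Z)$; the zero tensor counts as skew-symmetric. *)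

theory Defs
  imports "HOL-Analysis.Analysis"
begin

subsection \<open>Smooth maps\<close>

text \<open>Both notions are meant for open \<open>S\<close>. As the domain is finite-dimensional,
  \<open>C\<^sup>n\<^sup>+\<^sup>1\<close> means: differentiable, with all directional derivatives \<open>C\<^sup>n\<close>.\<close>

primrec Ck_on :: "nat \<Rightarrow> 'a set \<Rightarrow> ('a::euclidean_space \<Rightarrow> 'b::real_normed_vector) \<Rightarrow> bool" where
  "Ck_on 0 S f \<longleftrightarrow> continuous_on S f"
| "Ck_on (Suc n) S f \<longleftrightarrow>
     (\<forall>x\<in>S. f differentiable (at x)) \<and> (\<forall>v. Ck_on n S (\<lambda>x. frechet_derivative f (at x) v))"

definition smooth_on :: "'a set \<Rightarrow> ('a::euclidean_space \<Rightarrow> 'b::real_normed_vector) \<Rightarrow> bool" where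
  "smooth_on S f \<longleftrightarrow> (\<forall>n. Ck_on n S f)"

definition ker_d :: "('a::real_normed_vector \<Rightarrow> real) \<Rightarrow> 'a \<Rightarrow> 'a set" where
  "ker_d f q = {v. frechet_derivative f (at q) v = 0}"

definition pd :: "2 \<Rightarrow> (real^2 \<Rightarrow> real) \<Rightarrow> real^2 \<Rightarrow> real" where
  "pd i f z = frechet_derivative f (at z) (axis i 1)"

subsection \<open>The real projective line and its projective transformations\<close>

typedef rp1 = "{L :: (real^2) set. subspace L \<and> dim L = 1}"
  morphisms line_of rp1_of_line
proof
  show "span {axis 1 1 :: real^2} \<in> {L. subspace L \<and> dim L = 1}"
    by (simp add: axis_eq_0_iff dim_eq_card_independent)
qed

text \<open>The point \<open>(s : t)\<close>, for \<open>(s, t) \<noteq> (0, 0)\<close>.\<close>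

definition hpoint :: "real \<Rightarrow> real \<Rightarrow> rp1" where
  "hpoint s t = rp1_of_line (span {vector [s, t]})"

text \<open>The action of an invertible matrix on lines; it depends only on the class of the
  matrix in \<open>PGL(2, \<real>)\<close>, and every class arises.\<close>

definition moebius :: "real^2^2 \<Rightarrow> rp1 \<Rightarrow> rp1" where
  "moebius A P = rp1_of_line ((\<lambda>v. A *v v) ` line_of P)"

subsection \<open>Foliations and Veronese webs on the plane\<close>

text \<open>A foliation is identified with its tangent line field \<open>T\<close>, i.e. it is an integrable
  subbundle of the tangent bundle of rank one: near every point there is a submersion whose
  level sets are tangent to \<open>T\<close>.\<close>

type_synonym line_field = "real^2 \<Rightarrow> (real^2) set"

definition foliation :: "line_field \<Rightarrow> bool" where
  "foliation T \<longleftrightarrow>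
     (\<forall>p. \<exists>U f. open U \<and> p \<in> U \<and> smooth_on U f \<and>
        (\<forall>q\<in>U. frechet_derivative f (at q) \<noteq> (\<lambda>_. 0) \<and> T q = ker_d f q))"

definition indep_one_forms_on ::
    "(real^2) set \<Rightarrow> (real^2 \<Rightarrow> (real^2) \<Rightarrow>\<^sub>L real) \<Rightarrow> (real^2 \<Rightarrow> (real^2) \<Rightarrow>\<^sub>L real) \<Rightarrow> bool" where
  "indep_one_forms_on U \<omega>0 \<omega>1 \<longleftrightarrow>
     smooth_on U \<omega>0 \<and> smooth_on U \<omega>1 \<and>
     (\<forall>q\<in>U. \<forall>a b. a *\<^sub>R \<omega>0 q + b *\<^sub>R \<omega>1 q = 0 \<longrightarrow> a = 0 \<and> b = 0)"

definition veronese_webs :: "(rp1 \<Rightarrow> line_field) set" where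
  "veronese_webs = {F. (\<forall>P. foliation (F P)) \<and>
     (\<forall>p. \<exists>U \<omega>0 \<omega>1. open U \<and> p \<in> U \<and> indep_one_forms_on U \<omega>0 \<omega>1 \<and>
        (\<forall>s t. (s, t) \<noteq> (0, 0) \<longrightarrow>
           (\<forall>q\<in>U. F (hpoint s t) q = {v. blinfun_apply (s *\<^sub>R \<omega>0 q + t *\<^sub>R \<omega>1 q) v = 0})))}"

definition web_moebius :: "((rp1 \<Rightarrow> line_field) \<times> (rp1 \<Rightarrow> line_field)) set" where
  "web_moebius = {(F, F'). F \<in> veronese_webs \<and> F' \<in> veronese_webs \<and>
     (\<exists>A. invertible A \<and> (\<forall>P. F' P = F (moebius A P)))}"

subsection \<open>Linear connections on the plane\<close>

type_synonym vector_field = "real^2 \<Rightarrow> real^2"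

type_synonym connection = "vector_field \<Rightarrow> vector_field \<Rightarrow> vector_field"

text \<open>A connection is an operator on global smooth vector fields. The last clause only fixes
  the irrelevant values on non-smooth arguments, so that equality of connections is equality
  of HOL functions.\<close>

definition linear_connection :: "connection \<Rightarrow> bool" where
  "linear_connection D \<longleftrightarrow>
     (\<forall>X Y. smooth_on UNIV X \<longrightarrow> smooth_on UNIV Y \<longrightarrow> smooth_on UNIV (D X Y)) \<and>
     (\<forall>X X' Y. smooth_on UNIV X \<longrightarrow> smooth_on UNIV X' \<longrightarrow> smooth_on UNIV Y \<longrightarrow>
        D (\<lambda>p. X p + X' p) Y = (\<lambda>p. D X Y p + D X' Y p)) \<and>
     (\<forall>f X Y. smooth_on UNIV f \<longrightarrow> smooth_on UNIV X \<longrightarrow> smooth_on UNIV Y \<longrightarrow>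
        D (\<lambda>p. f p *\<^sub>R X p) Y = (\<lambda>p. f p *\<^sub>R D X Y p)) \<and>
     (\<forall>X Y Y'. smooth_on UNIV X \<longrightarrow> smooth_on UNIV Y \<longrightarrow> smooth_on UNIV Y' \<longrightarrow>
        D X (\<lambda>p. Y p + Y' p) = (\<lambda>p. D X Y p + D X Y' p)) \<and>
     (\<forall>f X Y. smooth_on UNIV f \<longrightarrow> smooth_on UNIV X \<longrightarrow> smooth_on UNIV Y \<longrightarrow>
        D X (\<lambda>p. f p *\<^sub>R Y p) =
          (\<lambda>p. frechet_derivative f (at p) (X p) *\<^sub>R Y p + f p *\<^sub>R D X Y p)) \<and>
     (\<forall>X Y. \<not> (smooth_on UNIV X \<and> smooth_on UNIV Y) \<longrightarrow> D X Y = undefined)"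

definition lie_bracket :: "vector_field \<Rightarrow> vector_field \<Rightarrow> vector_field" where
  "lie_bracket X Y p =
     frechet_derivative Y (at p) (X p) - frechet_derivative X (at p) (Y p)"

definition torsion_free :: "connection \<Rightarrow> bool" where
  "torsion_free D \<longleftrightarrow>
     (\<forall>X Y. smooth_on UNIV X \<longrightarrow> smooth_on UNIV Y \<longrightarrow>
        (\<forall>p. D X Y p - D Y X p = lie_bracket X Y p))"

definition curvature ::
    "connection \<Rightarrow> vector_field \<Rightarrow> vector_field \<Rightarrow> vector_field \<Rightarrow> vector_field" where
  "curvature D X Y Z p = D X (D Y Z) p - D Y (D X Z) p - D (lie_bracket X Y) Z p"

text \<open>As the curvature is tensorial in its first argument, a tangent vector \<open>u\<close> at \<open>p\<close> may be
  extended to a constant vector field.\<close>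

definition ricci :: "connection \<Rightarrow> vector_field \<Rightarrow> vector_field \<Rightarrow> real^2 \<Rightarrow> real" where
  "ricci D Y Z p = trace (matrix (\<lambda>u. curvature D (\<lambda>_. u) Y Z p))"

definition ricci_skew :: "connection \<Rightarrow> bool" where
  "ricci_skew D \<longleftrightarrow>
     (\<forall>Y Z. smooth_on UNIV Y \<longrightarrow> smooth_on UNIV Z \<longrightarrow>
        (\<forall>p. ricci D Y Z p = - ricci D Z Y p))"

text \<open>\<open>\<nabla>\<^sub>X Y = Z\<close> on an open set \<open>U\<close> on which \<open>X\<close> and \<open>Y\<close> are smooth. Local fields are
  differentiated, as usual, by means of global fields with the same germ; such fields exist at
  every point of \<open>U\<close>, and the value does not depend on their choice.\<close>

definition cov_deriv_on ::
    "connection \<Rightarrow> (real^2) set \<Rightarrow> vector_field \<Rightarrow> vector_field \<Rightarrow> vector_field \<Rightarrow> bool" where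
  "cov_deriv_on D U X Y Z \<longleftrightarrow>
     (\<forall>p\<in>U. \<forall>X' Y'. smooth_on UNIV X' \<longrightarrow> smooth_on UNIV Y' \<longrightarrow>
        (\<forall>\<^sub>F q in nhds p. X' q = X q \<and> Y' q = Y q) \<longrightarrow> D X' Y' p = Z p)"

subsection \<open>The connection associated to a Veronese web\<close>

definition chart :: "(real^2) set \<Rightarrow> (real^2 \<Rightarrow> real^2) \<Rightarrow> bool" where
  "chart U \<phi> \<longleftrightarrow> open U \<and> inj_on \<phi> U \<and> smooth_on U \<phi> \<and>
     open (\<phi> ` U) \<and> smooth_on (\<phi> ` U) (the_inv_into U \<phi>)"

definition coord_field :: "(real^2) set \<Rightarrow> (real^2 \<Rightarrow> real^2) \<Rightarrow> 2 \<Rightarrow> vector_field" where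
  "coord_field U \<phi> i q = frechet_derivative (the_inv_into U \<phi>) (at (\<phi> q)) (axis i 1)"

text \<open>The chart is \<open>\<phi> = (x, y)\<close>, and \<open>w\<close> is given as a function of the coordinates, so that
  the function on the surface is \<open>w \<circ> \<phi>\<close>.\<close>

definition adapted_coords ::
    "(rp1 \<Rightarrow> line_field) \<Rightarrow> real \<Rightarrow> (real^2) set \<Rightarrow> (real^2 \<Rightarrow> real^2) \<Rightarrow> (real^2 \<Rightarrow> real) \<Rightarrow> bool"
  where
  "adapted_coords F t0 U \<phi> w \<longleftrightarrow>
     chart U \<phi> \<and> smooth_on (\<phi> ` U) w \<and>
     (\<forall>z\<in>\<phi> ` U. pd 1 w z \<noteq> 0 \<and> pd 2 w z \<noteq> 0) \<and>
     (\<forall>q\<in>U. F (hpoint 1 0) q = ker_d (\<lambda>r. \<phi> r $ 1) q \<and>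
             F (hpoint 0 1) q = ker_d (\<lambda>r. \<phi> r $ 2) q \<and>
             F (hpoint 1 t0) q = ker_d (\<lambda>r. w (\<phi> r)) q)"

definition christoffel_x :: "(real^2 \<Rightarrow> real) \<Rightarrow> real^2 \<Rightarrow> real" where
  "christoffel_x w z =
     (pd 2 w z * pd 1 (pd 1 w) z - pd 1 w z * pd 2 (pd 1 w) z) / (pd 1 w z * pd 2 w z)"

definition christoffel_y :: "(real^2 \<Rightarrow> real) \<Rightarrow> real^2 \<Rightarrow> real" where
  "christoffel_y w z =
     (pd 1 w z * pd 2 (pd 2 w) z - pd 2 w z * pd 2 (pd 1 w) z) / (pd 1 w z * pd 2 w z)"

definition is_web_connection :: "(rp1 \<Rightarrow> line_field) \<Rightarrow> connection \<Rightarrow> bool" where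
  "is_web_connection F D \<longleftrightarrow> linear_connection D \<and>
     (\<forall>t0 U \<phi> w. t0 \<noteq> 0 \<longrightarrow> adapted_coords F t0 U \<phi> w \<longrightarrow>
        (let X = coord_field U \<phi> 1; Y = coord_field U \<phi> 2 in
           cov_deriv_on D U X X (\<lambda>q. christoffel_x w (\<phi> q) *\<^sub>R X q) \<and>
           cov_deriv_on D U Y Y (\<lambda>q. christoffel_y w (\<phi> q) *\<^sub>R Y q) \<and>
           cov_deriv_on D U X Y (\<lambda>_. 0) \<and>
           cov_deriv_on D U Y X (\<lambda>_. 0)))"

definition web_connection :: "(rp1 \<Rightarrow> line_field) \<Rightarrow> connection" where
  "web_connection F = (THE D. is_web_connection F D)"

subsection \<open>Moebius equivalence of webs\<close>

lemma rp1_image: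
  assumes "invertible A"
  shows "(\<lambda>v. A *v v) ` line_of P \<in> {L. subspace L \<and> dim L = 1}"
proof -
  have "inj ((*v) A)"
    using assms by (simp add: inj_matrix_vector_mult)
  then have "dim ((*v) A ` line_of P) = dim (line_of P)"
    by (intro dim_image_eq) (auto simp: inj_on_def inj_def)
  then show ?thesis
    using line_of[of P] by (auto intro!: linear_subspace_image)
qed

lemma moebius_one: "moebius (mat 1) P = P"
  by (simp add: moebius_def line_of_inverse)

lemma moebius_mult:
  assumes "invertible B"
  shows "moebius A (moebius B P) = moebius (A ** B) P"
  using rp1_image[OF assms, of P]
  by (simp add: moebius_def rp1_of_line_inverse image_image matrix_vector_mul_assoc)

lemma equiv_web_moebius: "equiv veronese_webs web_moebius"
proof (rule equivI)
  show "web_moebius \<subseteq> veronese_webs \<times> veronese_webs"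
    by (auto simp: web_moebius_def)
  show "refl_on veronese_webs web_moebius"
    by (auto simp: web_moebius_def refl_on_def moebius_one invertible_def intro!: exI[of _ "mat 1"])
  show "sym web_moebius"
  proof (rule symI)
    fix F F' assume "(F, F') \<in> web_moebius"
    then obtain A where F: "F \<in> veronese_webs" "F' \<in> veronese_webs"
      and A: "invertible A" and eq: "\<And>P. F' P = F (moebius A P)"
      by (auto simp: web_moebius_def)
    obtain B where B: "A ** B = mat 1" "B ** A = mat 1"
      using A by (auto simp: invertible_def)
    then have iB: "invertible B" by (auto simp: invertible_def)
    have "F P = F' (moebius B P)" for P
      by (simp add: eq moebius_mult iB B moebius_one)
    with F iB show "(F', F) \<in> web_moebius" by (auto simp: web_moebius_def)
  qed
  show "trans web_moebius"
  proof (rule transI)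
    fix F G H assume "(F, G) \<in> web_moebius" "(G, H) \<in> web_moebius"
    then obtain A B where F: "F \<in> veronese_webs" "H \<in> veronese_webs"
      and AB: "invertible A" "invertible B"
      and eq: "\<And>P. G P = F (moebius A P)" "\<And>P. H P = G (moebius B P)"
      by (auto simp: web_moebius_def)
    have "H P = F (moebius (A ** B) P)" for P
      by (simp add: eq moebius_mult AB)
    with F AB show "(F, H) \<in> web_moebius"
      by (auto simp: web_moebius_def intro!: exI[of _ "A ** B"] invertible_mult)
  qed
qed

end

theory Submission
  imports Defs
begin

text \<open>Every torsion-free connection with Christoffel symbols \<open>C\<close> determines the notion of a parallel
  line field \<open>ker \<alpha>\<close>: along the kernel, \<open>d\<alpha> = \<alpha> \<circ> C\<close>. The connection of a web is the only torsion-free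
  one for which all the foliations of the web are parallel; differentiating the parallel coframe
  shows that its curvature is a multiple of the identity, which for torsion-free connections of a
  surface says that the Ricci tensor is skew. Conversely, if the curvature is a multiple of the
  identity, the connection on the cotangent bundle becomes flat after its trace has been removed;
  a global parallel coframe \<open>\<omega>\<^sub>0, \<omega>\<^sub>1\<close> of it spans the web. Finally, a parallel line field is
  determined by its value at one point, so a web with the given connection is determined by a
  projective parametrization of the lines in one tangent plane.\<close>

subsection \<open>Functions of class \<open>C\<^sup>n\<close>\<close>

text \<open>\<open>is_web_connection\<close> tests a connection in every adapted coordinate system
  at once, so the existence of a web connection contains its independence of all choices.
  Parallelism of line fields is the coordinate-free substitute: it determines the Christoffel
  symbols at each point, because two symmetric candidates differ by \<sigma>(v) z, and \<sigma>(v) z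
  = \<sigma>(z) v forces \<sigma> = 0 in dimension two. This pointwise uniqueness glues local
  solutions into a global one. In the converse direction it suffices to find parallel forms up to a
  common factor; subtracting half the trace chooses that factor so that the curvature cancels
  exactly, and rays from the origin give a global solution. Since a foliation is defined by local
  submersions, the resulting line fields must still be integrated, which takes a smooth flow and a
  smooth local inverse; for both, a formula for the first derivative is fed back into an induction
  on the order. Two analytic facts recur: the symmetry of second derivatives (brackets of coordinate
  fields, both curvature computations) and a Gronwall estimate (dependence on data, propagation of
  coincidence).\<close>

lemma Ck_on_subset: "Ck_on n S f \<Longrightarrow> T \<subseteq> S \<Longrightarrow> Ck_on n T f"
  by (induction n arbitrary: f) (auto intro: continuous_on_subset)

text \<open>Both functions have the same derivative predicate at \<open>x\<close>, so the choice
  operator behind \<open>frechet_derivative\<close> yields the same value, differentiable or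
  not.\<close>

lemma frechet_derivative_cong_open:
  assumes "open S" "x \<in> S" "\<And>y. y \<in> S \<Longrightarrow> f y = g y"
  shows "frechet_derivative f (at x) = frechet_derivative g (at x)"
proof -
  have "(f has_derivative D) (at x) = (g has_derivative D) (at x)" for D
    using has_derivative_transform_within_open[OF _ assms(1,2)] assms(3) by metis
  then show ?thesis by (simp add: frechet_derivative_def)
qed

lemma Ck_on_cong:
  assumes "open S" "\<And>x. x \<in> S \<Longrightarrow> f x = g x" "Ck_on n S f"
  shows "Ck_on n S g"
  using assms(2,3)
proof (induction n arbitrary: f g)
  case 0
  then show ?case by (metis Ck_on.simps(1) continuous_on_eq)
next
  case (Suc n)
  show ?case
    unfolding Ck_on.simps
  proof (intro conjI ballI allI)
    fix x assume "x \<in> S"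
    then obtain D where "(f has_derivative D) (at x)"
      using Suc.prems unfolding Ck_on.simps differentiable_def by blast
    then have "(g has_derivative D) (at x)"
      by (rule has_derivative_transform_within_open[OF _ assms(1) \<open>x \<in> S\<close>]) (use Suc.prems in auto)
    then show "g differentiable (at x)" by (auto simp: differentiable_def)
  next
    fix v
    have "frechet_derivative f (at x) v = frechet_derivative g (at x) v" if "x \<in> S" for x
      using frechet_derivative_cong_open[OF assms(1) that, of f g] Suc.prems(1) by simp
    then show "Ck_on n S (\<lambda>x. frechet_derivative g (at x) v)"
      by (rule Suc.IH) (use Suc.prems(2) in auto)
  qed
qed

text \<open>Entry point of the inductions on the order: an explicit formula for the derivative can
  be analysed by the induction hypothesis, and \<open>frechet_derivative\<close> is identified with
  it by uniqueness.\<close>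

lemma Ck_on_SucI:
  assumes "open S" "\<And>x. x \<in> S \<Longrightarrow> (f has_derivative f' x) (at x)"
    "\<And>v. Ck_on n S (\<lambda>x. f' x v)"
  shows "Ck_on (Suc n) S f"
  unfolding Ck_on.simps
proof (intro conjI ballI allI)
  show "f differentiable at x" if "x \<in> S" for x
    using assms(2) that by (auto simp: differentiable_def)
  show "Ck_on n S (\<lambda>x. frechet_derivative f (at x) v)" for v
    by (rule Ck_on_cong[OF assms(1) _ assms(3)[of v]])
      (use frechet_derivative_at assms(2) in metis)
qed

lemma Ck_on_SucD:
  assumes "Ck_on (Suc n) S f"
  shows "\<And>x. x \<in> S \<Longrightarrow> (f has_derivative frechet_derivative f (at x)) (at x)"
    and "\<And>v. Ck_on n S (\<lambda>x. frechet_derivative f (at x) v)"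
  using assms by (auto simp: frechet_derivative_works)

lemma Ck_on_Suc_imp: "Ck_on (Suc n) S f \<Longrightarrow> Ck_on n S f"
proof (induction n arbitrary: f)
  case 0
  then show ?case
    by (simp add: continuous_at_imp_continuous_on differentiable_imp_continuous_within)
qed simp

lemma Ck_on_continuous_on: "Ck_on n S f \<Longrightarrow> continuous_on S f"
  by (induction n) (auto dest: Ck_on_Suc_imp simp del: Ck_on.simps(2))

lemma Ck_on_const: "Ck_on n S (\<lambda>x. c)"
proof (induction n arbitrary: c)
  case (Suc n)
  then show ?case by simp
qed simp

lemma Ck_on_bounded_linear:
  assumes h: "bounded_linear h" and "open S" "Ck_on n S f"
  shows "Ck_on n S (\<lambda>x. h (f x))"
  using assms(3)
proof (induction n arbitrary: f)
  case 0
  then show ?case by (simp add: bounded_linear.continuous_on[OF h])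
next
  case (Suc n)
  show ?case
    by (rule Ck_on_SucI[OF assms(2) bounded_linear.has_derivative[OF h Ck_on_SucD(1)[OF Suc.prems]]])
      (auto intro: Suc.IH Ck_on_SucD(2)[OF Suc.prems])
qed

lemma Ck_on_ident: "open S \<Longrightarrow> Ck_on n S (\<lambda>x. x)"
proof (induction n)
  case (Suc n)
  show ?case
    by (rule Ck_on_SucI[OF Suc.prems has_derivative_ident]) (simp add: Ck_on_const)
qed (simp add: continuous_on_id)

lemma Ck_on_add:
  assumes "open S" "Ck_on n S f" "Ck_on n S g"
  shows "Ck_on n S (\<lambda>x. f x + g x)"
  using assms(2,3)
proof (induction n arbitrary: f g)
  case (Suc n)
  show ?case
    by (rule Ck_on_SucI[OF assms(1) has_derivative_add[OF Ck_on_SucD(1)[OF Suc.prems(1)] Ck_on_SucD(1)[OF Suc.prems(2)]]])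
      (auto intro: Suc.IH Ck_on_SucD(2)[OF Suc.prems(1)] Ck_on_SucD(2)[OF Suc.prems(2)])
qed (simp add: continuous_on_add)

text \<open>By the product rule the derivative is again a sum of two terms built with
  \<open>h\<close>, so a single induction covers products, scalar multiples, inner products and the
  application of operators.\<close>

lemma Ck_on_bilinear:
  assumes h: "bounded_bilinear h" and "open S" "Ck_on n S f" "Ck_on n S g"
  shows "Ck_on n S (\<lambda>x. h (f x) (g x))"
  using assms(3,4)
proof (induction n arbitrary: f g)
  case 0
  then show ?case by (simp add: bounded_bilinear.continuous_on[OF h])
next
  case (Suc n)
  show ?case
    by (rule Ck_on_SucI[OF assms(2) bounded_bilinear.FDERIV[OF h Ck_on_SucD(1)[OF Suc.prems(1)] Ck_on_SucD(1)[OF Suc.prems(2)]]])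
      (auto intro!: Suc.IH Ck_on_add assms(2) Ck_on_SucD(2)[OF Suc.prems(1)] Ck_on_SucD(2)[OF Suc.prems(2)]
        Ck_on_Suc_imp[OF Suc.prems(1)] Ck_on_Suc_imp[OF Suc.prems(2)])
qed

lemmas Ck_on_mult = Ck_on_bilinear[OF bounded_bilinear_mult]
  and Ck_on_scaleR = Ck_on_bilinear[OF bounded_bilinear_scaleR]
  and Ck_on_inner = Ck_on_bilinear[OF bounded_bilinear_inner]
  and Ck_on_minus = Ck_on_bounded_linear[OF bounded_linear_minus[OF bounded_linear_ident]]
  and Ck_on_vec_nth = Ck_on_bounded_linear[OF bounded_linear_vec_nth]
  and Ck_on_fst = Ck_on_bounded_linear[OF bounded_linear_fst]
  and Ck_on_snd = Ck_on_bounded_linear[OF bounded_linear_snd]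

lemma Ck_on_diff:
  "open S \<Longrightarrow> Ck_on n S f \<Longrightarrow> Ck_on n S g \<Longrightarrow> Ck_on n S (\<lambda>x. f x - g x)"
  using Ck_on_add[of S n f "\<lambda>x. - g x"] Ck_on_minus[of S n g] by simp

lemma Ck_on_sum:
  "open S \<Longrightarrow> (\<And>i. i \<in> I \<Longrightarrow> Ck_on n S (f i)) \<Longrightarrow> Ck_on n S (\<lambda>x. \<Sum>i\<in>I. f i x)"
  by (induction I rule: infinite_finite_induct) (auto intro!: Ck_on_const Ck_on_add)

lemma Ck_on_vec:
  fixes f :: "'a::euclidean_space \<Rightarrow> real^'n"
  assumes "open S" "\<And>i. Ck_on n S (\<lambda>x. f x $ i)"
  shows "Ck_on n S f"
proof (rule Ck_on_cong[OF assms(1)])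
  show "(\<Sum>i\<in>UNIV. f x $ i *\<^sub>R axis i 1) = f x" for x
    using basis_expansion[of "f x"] by (simp add: scalar_mult_eq_scaleR)
qed (intro Ck_on_sum Ck_on_scaleR Ck_on_const assms)

lemma Ck_on_Pair:
  assumes "open S" "Ck_on n S f" "Ck_on n S g"
  shows "Ck_on n S (\<lambda>x. (f x, g x))"
  using Ck_on_add[OF assms(1) Ck_on_bounded_linear[OF bounded_linear_Pair[OF bounded_linear_ident bounded_linear_zero] assms(1,2)]
      Ck_on_bounded_linear[OF bounded_linear_Pair[OF bounded_linear_zero bounded_linear_ident] assms(1,3)]]
  by simp

text \<open>\<open>Ck_on\<close> controls derivatives in constant directions only. Expanding along
  \<open>Basis\<close> reaches directions that vary with the point, as in the chain rule and in
  derivatives along vector fields.\<close>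

lemma frechet_derivative_linear_sum:
  assumes "(f has_derivative D) (at x)"
  shows "D v = (\<Sum>i\<in>Basis. (v \<bullet> i) *\<^sub>R D i)"
proof -
  have "D v = D (\<Sum>i\<in>Basis. (v \<bullet> i) *\<^sub>R i)"
    by (simp add: euclidean_representation)
  also have "\<dots> = (\<Sum>i\<in>Basis. (v \<bullet> i) *\<^sub>R D i)"
    using has_derivative_linear[OF assms] by (simp add: linear_sum linear_scale)
  finally show ?thesis .
qed

lemma Ck_on_compose:
  fixes f :: "'b::euclidean_space \<Rightarrow> 'c::real_normed_vector" and g :: "'a::euclidean_space \<Rightarrow> 'b"
  assumes "open S" "open T" "Ck_on n T f" "Ck_on n S g" "g ` S \<subseteq> T"
  shows "Ck_on n S (\<lambda>x. f (g x))"
  using assms(3,4)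
proof (induction n arbitrary: f)
  case 0
  then show ?case using assms(5) by (auto intro: continuous_on_compose2)
next
  case (Suc n)
  have g: "(g has_derivative frechet_derivative g (at x)) (at x)" if "x \<in> S" for x
    using Ck_on_SucD(1)[OF Suc.prems(2)] that by blast
  have f: "(f has_derivative frechet_derivative f (at (g x))) (at (g x))" if "x \<in> S" for x
    using Ck_on_SucD(1)[OF Suc.prems(1)] that assms(5) by blast
  let ?D = "\<lambda>x v. \<Sum>i\<in>Basis. (frechet_derivative g (at x) v \<bullet> i) *\<^sub>R frechet_derivative f (at (g x)) i"
  show ?case
  proof (rule Ck_on_SucI[OF assms(1), where f' = ?D])
    fix x assume x: "x \<in> S"
    have "frechet_derivative f (at (g x)) w = (\<Sum>i\<in>Basis. (w \<bullet> i) *\<^sub>R frechet_derivative f (at (g x)) i)" for w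
      by (rule frechet_derivative_linear_sum[OF f[OF x]])
    then have "?D x = frechet_derivative f (at (g x)) \<circ> frechet_derivative g (at x)"
      unfolding o_def by (intro ext) (rule sym)
    with diff_chain_at[OF g[OF x] f[OF x]] show "((\<lambda>x. f (g x)) has_derivative ?D x) (at x)"
      by (simp add: o_def)
  next
    fix v
    show "Ck_on n S (\<lambda>x. ?D x v)"
      by (intro Ck_on_sum Ck_on_scaleR Ck_on_inner assms(1) Ck_on_SucD(2)[OF Suc.prems(2)] Ck_on_const
          Suc.IH[OF Ck_on_SucD(2)[OF Suc.prems(1)] Ck_on_Suc_imp[OF Suc.prems(2)]])
  qed
qed

lemma Ck_on_exp: "Ck_on n UNIV (exp :: real \<Rightarrow> real)"
proof (induction n)
  case 0
  then show ?case by (simp add: continuous_on_exp continuous_on_id)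
next
  case (Suc n)
  have "(exp has_derivative (\<lambda>h. h * exp x)) (at x)" for x :: real
    using DERIV_exp[of x] by (simp add: has_field_derivative_def mult_commute_abs)
  then show ?case
    by (rule Ck_on_SucI[OF open_UNIV]) (rule Ck_on_mult[OF open_UNIV Ck_on_const Suc])
qed

lemma Ck_on_inverse_real: "Ck_on n (- {0}) (inverse :: real \<Rightarrow> real)"
proof (induction n)
  case 0
  then show ?case by (auto intro!: continuous_intros)
next
  case (Suc n)
  have "(inverse has_derivative (\<lambda>h. - (inverse x * h * inverse x))) (at x)" if "x \<in> - {0}" for x :: real
    using has_derivative_inverse'[of x UNIV] that by simp
  moreover have "open (- {0 :: real})" by (simp add: open_Compl)
  ultimately show ?case
    by (intro Ck_on_SucI[where f' = "\<lambda>x h. - (inverse x * h * inverse x)"] Ck_on_minus Ck_on_mult Ck_on_const Suc)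
qed

lemma Ck_on_local:
  assumes "\<And>x. x \<in> S \<Longrightarrow> \<exists>T. open T \<and> x \<in> T \<and> Ck_on n T f"
  shows "Ck_on n S f"
  using assms
proof (induction n arbitrary: f)
  case 0
  have "isCont f x" if "x \<in> S" for x
    using 0[OF that] by (auto simp: continuous_on_eq_continuous_at)
  then show ?case by (simp add: continuous_at_imp_continuous_on)
next
  case (Suc n)
  have "f differentiable at x" if "x \<in> S" for x
    using Suc.prems[OF that] by auto
  moreover have "Ck_on n S (\<lambda>x. frechet_derivative f (at x) v)" for v
  proof (rule Suc.IH)
    fix x assume "x \<in> S"
    from Suc.prems[OF this] show "\<exists>T. open T \<and> x \<in> T \<and> Ck_on n T (\<lambda>x. frechet_derivative f (at x) v)" by auto
  qed
  ultimately show ?case by simp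
qed

subsection \<open>Smooth functions\<close>

lemma smooth_on_Ck: "smooth_on S f \<Longrightarrow> Ck_on n S f"
  by (simp add: smooth_on_def)

lemma smooth_on_subset: "smooth_on S f \<Longrightarrow> T \<subseteq> S \<Longrightarrow> smooth_on T f"
  by (auto simp: smooth_on_def intro: Ck_on_subset)

lemma smooth_on_cong:
  "open S \<Longrightarrow> (\<And>x. x \<in> S \<Longrightarrow> f x = g x) \<Longrightarrow> smooth_on S f \<Longrightarrow> smooth_on S g"
  unfolding smooth_on_def using Ck_on_cong by blast

lemma smooth_on_local:
  "(\<And>x. x \<in> S \<Longrightarrow> \<exists>T. open T \<and> x \<in> T \<and> smooth_on T f) \<Longrightarrow> smooth_on S f"
  unfolding smooth_on_def by (intro allI Ck_on_local) blast

lemma smooth_on_const: "smooth_on S (\<lambda>x. c)"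
  and smooth_on_ident: "open S \<Longrightarrow> smooth_on S (\<lambda>x. x)"
  and smooth_on_add: "open S \<Longrightarrow> smooth_on S f \<Longrightarrow> smooth_on S g \<Longrightarrow> smooth_on S (\<lambda>x. f x + g x)"
  and smooth_on_diff: "open S \<Longrightarrow> smooth_on S f \<Longrightarrow> smooth_on S g \<Longrightarrow> smooth_on S (\<lambda>x. f x - g x)"
  and smooth_on_minus: "open S \<Longrightarrow> smooth_on S f \<Longrightarrow> smooth_on S (\<lambda>x. - f x)"
  and smooth_on_Pair: "open S \<Longrightarrow> smooth_on S f \<Longrightarrow> smooth_on S h \<Longrightarrow> smooth_on S (\<lambda>x. (f x, h x))"
  and smooth_on_scaleR: "open S \<Longrightarrow> smooth_on S a \<Longrightarrow> smooth_on S f \<Longrightarrow> smooth_on S (\<lambda>x. a x *\<^sub>R f x)"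
  for f g :: "'a::euclidean_space \<Rightarrow> 'b::real_normed_vector" and h :: "'a \<Rightarrow> 'c::real_normed_vector"
  by (simp_all add: smooth_on_def Ck_on_const Ck_on_ident Ck_on_add Ck_on_diff Ck_on_minus Ck_on_Pair Ck_on_scaleR)

lemma smooth_on_mult: "open S \<Longrightarrow> smooth_on S f \<Longrightarrow> smooth_on S g \<Longrightarrow> smooth_on S (\<lambda>x. f x * g x)"
  for f g :: "'a::euclidean_space \<Rightarrow> 'b::real_normed_algebra"
  by (simp add: smooth_on_def Ck_on_mult)

lemma smooth_on_bounded_linear:
  "bounded_linear h \<Longrightarrow> open S \<Longrightarrow> smooth_on S f \<Longrightarrow> smooth_on S (\<lambda>x. h (f x))"
  by (simp add: smooth_on_def Ck_on_bounded_linear)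

lemma smooth_on_sum:
  "open S \<Longrightarrow> (\<And>i. i \<in> I \<Longrightarrow> smooth_on S (f i)) \<Longrightarrow> smooth_on S (\<lambda>x. \<Sum>i\<in>I. f i x)"
  by (simp add: smooth_on_def Ck_on_sum)

lemma smooth_on_vec_nth: "open S \<Longrightarrow> smooth_on S f \<Longrightarrow> smooth_on S (\<lambda>x. f x $ i)"
  for f :: "'a::euclidean_space \<Rightarrow> real^'n"
  by (simp add: smooth_on_def Ck_on_vec_nth)

lemma smooth_on_vec:
  fixes f :: "'a::euclidean_space \<Rightarrow> real^'n"
  shows "open S \<Longrightarrow> (\<And>i. smooth_on S (\<lambda>x. f x $ i)) \<Longrightarrow> smooth_on S f"
  by (simp add: smooth_on_def Ck_on_vec)

lemma smooth_on_compose: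
  fixes f :: "'b::euclidean_space \<Rightarrow> 'c::real_normed_vector" and g :: "'a::euclidean_space \<Rightarrow> 'b"
  shows "open S \<Longrightarrow> open T \<Longrightarrow> smooth_on T f \<Longrightarrow> smooth_on S g \<Longrightarrow> g ` S \<subseteq> T \<Longrightarrow> smooth_on S (\<lambda>x. f (g x))"
  by (simp add: smooth_on_def Ck_on_compose)

lemma Ck_on_divide:
  fixes f g :: "'a::euclidean_space \<Rightarrow> real"
  assumes "open S" "Ck_on n S f" "Ck_on n S g" "\<And>x. x \<in> S \<Longrightarrow> g x \<noteq> 0"
  shows "Ck_on n S (\<lambda>x. f x / g x)"
  unfolding divide_inverse
  by (intro Ck_on_mult assms(1,2) Ck_on_compose[where T = "-{0}", OF _ _ Ck_on_inverse_real assms(3)])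
    (use assms(4) in auto)

lemma smooth_on_divide:
  fixes f g :: "'a::euclidean_space \<Rightarrow> real"
  shows "open S \<Longrightarrow> smooth_on S f \<Longrightarrow> smooth_on S g \<Longrightarrow> (\<And>x. x \<in> S \<Longrightarrow> g x \<noteq> 0) \<Longrightarrow> smooth_on S (\<lambda>x. f x / g x)"
  by (simp add: smooth_on_def Ck_on_divide)

lemma
  assumes "smooth_on S f"
  shows smooth_on_has_derivative: "\<And>x. x \<in> S \<Longrightarrow> (f has_derivative frechet_derivative f (at x)) (at x)"
    and smooth_on_frechet_derivative: "\<And>v. smooth_on S (\<lambda>x. frechet_derivative f (at x) v)"
    and smooth_on_differentiable: "\<And>x. x \<in> S \<Longrightarrow> f differentiable at x"
    and smooth_on_continuous_on: "continuous_on S f"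
proof -
  have *: "Ck_on (Suc n) S f" for n using assms by (simp only: smooth_on_def)
  show "\<And>x. x \<in> S \<Longrightarrow> (f has_derivative frechet_derivative f (at x)) (at x)"
    using Ck_on_SucD(1)[OF *] .
  show "\<And>v. smooth_on S (\<lambda>x. frechet_derivative f (at x) v)"
    unfolding smooth_on_def using Ck_on_SucD(2)[OF *] by blast
  show "\<And>x. x \<in> S \<Longrightarrow> f differentiable at x" using *[of 0] by simp
  show "continuous_on S f" using assms by (metis Ck_on.simps(1) smooth_on_def)
qed

lemma smooth_on_frechet_derivative_field:
  assumes "open S" "smooth_on S f" "smooth_on S X"
  shows "smooth_on S (\<lambda>x. frechet_derivative f (at x) (X x))"
proof (rule smooth_on_cong[OF assms(1)])
  show "(\<Sum>i\<in>Basis. (X x \<bullet> i) *\<^sub>R frechet_derivative f (at x) i) = frechet_derivative f (at x) (X x)" if "x \<in> S" for x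
    using frechet_derivative_linear_sum[OF smooth_on_has_derivative[OF assms(2) that]] by metis
  show "smooth_on S (\<lambda>x. \<Sum>i\<in>Basis. (X x \<bullet> i) *\<^sub>R frechet_derivative f (at x) i)"
    by (intro smooth_on_sum smooth_on_scaleR smooth_on_bounded_linear[OF bounded_linear_inner_left]
        smooth_on_frechet_derivative assms)
qed

lemma has_derivative_on_line:
  assumes "(f has_derivative D) (at (y + r *\<^sub>R v))"
  shows "((\<lambda>r. f (y + r *\<^sub>R v)) has_vector_derivative D v) (at r)"
proof -
  have "((\<lambda>r. y + r *\<^sub>R v) has_derivative (\<lambda>h. h *\<^sub>R v)) (at r)"
    by (auto intro!: derivative_eq_intros)
  from has_derivative_compose[OF this assms] show ?thesis
    by (simp add: has_vector_derivative_def linear_scale[OF has_derivative_linear[OF assms]])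
qed

text \<open>The mean value theorem is applied twice: to the increment in direction \<open>w\<close>
  as a function of the displacement along \<open>v\<close>, and then to the
  \<open>v\<close>-derivative along \<open>w\<close>.\<close>

lemma mixed_second_difference:
  fixes f :: "'a::euclidean_space \<Rightarrow> real"
  assumes "open S" "Ck_on 2 S f" "0 < t" "\<And>r s. 0 \<le> r \<Longrightarrow> r \<le> t \<Longrightarrow> 0 \<le> s \<Longrightarrow> s \<le> t \<Longrightarrow> x + r *\<^sub>R v + s *\<^sub>R w \<in> S"
  shows "\<exists>r s. 0 < r \<and> r < t \<and> 0 < s \<and> s < t \<and>
    f (x + t *\<^sub>R v + t *\<^sub>R w) - f (x + t *\<^sub>R v) - f (x + t *\<^sub>R w) + f x =
    t * t * frechet_derivative (\<lambda>x. frechet_derivative f (at x) v) (at (x + r *\<^sub>R v + s *\<^sub>R w)) w"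
proof -
  have C: "Ck_on (Suc (Suc 0)) S f" using assms(2) by (simp add: numeral_2_eq_2)
  note df = Ck_on_SucD(1)[OF C] and ddf = Ck_on_SucD(1)[OF Ck_on_SucD(2)[OF C]]
  let ?F = "\<lambda>r. f (x + r *\<^sub>R v + t *\<^sub>R w) - f (x + r *\<^sub>R v)"
  let ?d = "\<lambda>y. frechet_derivative f (at y) v"
  have "((\<lambda>r. f (y + r *\<^sub>R v)) has_real_derivative ?d (y + r *\<^sub>R v)) (at r)" if "y + r *\<^sub>R v \<in> S" for y r
    using has_derivative_on_line[OF df[OF that]] by (simp add: has_real_derivative_iff_has_vector_derivative)
  from this[where y = "x + t *\<^sub>R w"] this[where y = x]
  have "(?F has_real_derivative (?d (x + r *\<^sub>R v + t *\<^sub>R w) - ?d (x + r *\<^sub>R v))) (at r)" if "0 \<le> r" "r \<le> t" for r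
    using assms(4)[of r t] assms(4)[of r 0] that assms(3) by (auto simp: algebra_simps intro!: DERIV_diff)
  from MVT2[OF assms(3) this]
  obtain r where r: "0 < r" "r < t" "?F t - ?F 0 = t * (?d (x + r *\<^sub>R v + t *\<^sub>R w) - ?d (x + r *\<^sub>R v))" by auto
  have "((\<lambda>s. ?d (x + r *\<^sub>R v + s *\<^sub>R w)) has_real_derivative
      frechet_derivative ?d (at (x + r *\<^sub>R v + s *\<^sub>R w)) w) (at s)" if "0 \<le> s" "s \<le> t" for s
  proof -
    have in_S: "x + r *\<^sub>R v + s *\<^sub>R w \<in> S" using assms(4) r that by simp
    show ?thesis
      using has_derivative_on_line[OF ddf[OF in_S, of v]]
      by (simp add: has_real_derivative_iff_has_vector_derivative)
  qed
  from MVT2[OF assms(3) this]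
  obtain s where s: "0 < s" "s < t" "?d (x + r *\<^sub>R v + t *\<^sub>R w) - ?d (x + r *\<^sub>R v)
    = t * frechet_derivative ?d (at (x + r *\<^sub>R v + s *\<^sub>R w)) w" by auto
  show ?thesis
    using r s by (intro exI[of _ r] exI[of _ s]) (simp add: algebra_simps)
qed

lemma mixed_second_difference_limit:
  fixes f :: "'a::euclidean_space \<Rightarrow> real"
  assumes "open S" "Ck_on 2 S f" "x \<in> S"
  shows "((\<lambda>t. (f (x + t *\<^sub>R v + t *\<^sub>R w) - f (x + t *\<^sub>R v) - f (x + t *\<^sub>R w) + f x) / (t * t)) \<longlongrightarrow>
    frechet_derivative (\<lambda>x. frechet_derivative f (at x) v) (at x) w) (at_right 0)"
proof (rule tendstoI)
  fix e :: real assume "e > 0"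
  let ?g = "\<lambda>y. frechet_derivative (\<lambda>x. frechet_derivative f (at x) v) (at y) w"
  have "continuous_on S ?g" using assms(2) by (simp add: numeral_2_eq_2)
  then have "isCont ?g x" using assms(1,3) by (simp add: continuous_on_eq_continuous_at)
  then obtain d where d: "d > 0" "\<And>y. dist y x < d \<Longrightarrow> dist (?g y) (?g x) < e"
    using \<open>e > 0\<close> unfolding continuous_at_eps_delta by blast
  obtain d' where d': "d' > 0" "ball x d' \<subseteq> S" using assms(1,3) openE by blast
  \<comment> \<open>The summand 1 keeps \<open>N\<close> positive when both directions vanish, and
    it makes the estimate by \<open>t * N\<close> strict.\<close>
  define N where "N = norm v + norm w + 1"
  have N: "N > 0" by (simp add: N_def add_nonneg_pos)
  have near: "dist (x + r *\<^sub>R v + s *\<^sub>R w) x < min d d'"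
    if "0 \<le> r" "r \<le> t" "0 \<le> s" "s \<le> t" "0 < t" "t < min d d' / N" for r s t
  proof -
    have "dist (x + r *\<^sub>R v + s *\<^sub>R w) x \<le> r * norm v + s * norm w"
      using norm_triangle_ineq[of "r *\<^sub>R v" "s *\<^sub>R w"] that by (simp add: dist_norm add.assoc)
    also have "\<dots> \<le> t * norm v + t * norm w"
      using that by (intro add_mono mult_right_mono) auto
    also have "\<dots> < t * N" using that by (simp add: N_def algebra_simps)
    also have "\<dots> < min d d'" using that N by (simp add: pos_less_divide_eq)
    finally show ?thesis .
  qed
  have "\<forall>\<^sub>F t in at_right 0. 0 < t \<and> t < min d d' / N"
    by (rule eventually_conj[OF eventually_at_right_less order_tendstoD(2)[OF tendsto_ident_at]])
      (use N d d' in simp)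
  then show "\<forall>\<^sub>F t in at_right 0. dist ((f (x + t *\<^sub>R v + t *\<^sub>R w) - f (x + t *\<^sub>R v) - f (x + t *\<^sub>R w) + f x) / (t * t)) (?g x) < e"
  proof eventually_elim
    case (elim t)
    have "x + r *\<^sub>R v + s *\<^sub>R w \<in> S" if "0 \<le> r" "r \<le> t" "0 \<le> s" "s \<le> t" for r s
    proof -
      have "x + r *\<^sub>R v + s *\<^sub>R w \<in> ball x d'"
        using near[OF that] elim by (simp add: dist_commute)
      with d'(2) show ?thesis by blast
    qed
    with mixed_second_difference[OF assms(1,2), of t x v w]
    obtain r s where rs: "0 < r" "r < t" "0 < s" "s < t" and eq:
      "f (x + t *\<^sub>R v + t *\<^sub>R w) - f (x + t *\<^sub>R v) - f (x + t *\<^sub>R w) + f x = t * t * ?g (x + r *\<^sub>R v + s *\<^sub>R w)"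
      using elim by blast
    have "dist (?g (x + r *\<^sub>R v + s *\<^sub>R w)) (?g x) < e"
      by (rule d(2)) (use near[of r t s] rs elim in auto)
    then show ?case unfolding eq using elim by simp
  qed
qed

text \<open>The second difference is symmetric in \<open>v\<close> and \<open>w\<close>, whereas its
  limit was computed by differentiating first along \<open>v\<close>; exchanging the roles gives the
  other order.\<close>

lemma second_derivative_symmetric:
  fixes f :: "'a::euclidean_space \<Rightarrow> real"
  assumes "open S" "Ck_on 2 S f" "x \<in> S"
  shows "frechet_derivative (\<lambda>x. frechet_derivative f (at x) v) (at x) w =
    frechet_derivative (\<lambda>x. frechet_derivative f (at x) w) (at x) v"
proof (rule tendsto_unique[OF _ mixed_second_difference_limit[OF assms, of v w]])
  show "((\<lambda>t. (f (x + t *\<^sub>R v + t *\<^sub>R w) - f (x + t *\<^sub>R v) - f (x + t *\<^sub>R w) + f x) / (t * t)) \<longlongrightarrow>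
    frechet_derivative (\<lambda>x. frechet_derivative f (at x) w) (at x) v) (at_right 0)"
    using mixed_second_difference_limit[OF assms, of w v] by (simp add: algebra_simps)
qed simp

subsection \<open>Cutoff functions\<close>

text \<open>The classical flat function exp(-1/t), extended by 0, together with its multiples by
  powers of 1/t. The derivative of each member is a linear combination of members, so one induction
  over all \<open>k\<close> proves smoothness.\<close>

definition flat_exp :: "nat \<Rightarrow> real \<Rightarrow> real" where
  "flat_exp k t = (if t \<le> 0 then 0 else inverse t ^ k * exp (- inverse t))"

lemma flat_exp_tendsto_0: "(flat_exp k \<longlongrightarrow> 0) (at 0)"
proof -
  have "((\<lambda>t. inverse t ^ k / exp (inverse t)) \<longlongrightarrow> (0::real)) (at_right 0)"
    by (rule filterlim_compose[OF tendsto_power_div_exp_0 filterlim_inverse_at_top_right])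
  then have "(flat_exp k \<longlongrightarrow> 0) (at_right 0)"
    by (rule Lim_transform_eventually)
      (auto simp: flat_exp_def eventually_at_filter exp_minus field_simps)
  moreover have "(flat_exp k \<longlongrightarrow> 0) (at_left 0)"
    by (rule Lim_transform_eventually[OF tendsto_const]) (auto simp: flat_exp_def eventually_at_filter)
  ultimately show ?thesis by (simp add: filterlim_split_at)
qed

lemma flat_exp_has_derivative:
  "(flat_exp k has_real_derivative (flat_exp (k + 2) t - real k * flat_exp (k + 1) t)) (at t)"
proof -
  consider "t < 0" | "t = 0" | "t > 0" by linarith
  then show ?thesis
  proof cases
    case 1
    have "((\<lambda>_. 0) has_real_derivative 0) (at t)" by simp
    then have "(flat_exp k has_real_derivative 0) (at t)"
      by (rule has_field_derivative_transform_within_open[of _ _ _ "{..<0}"]) (use 1 in \<open>auto simp: flat_exp_def\<close>)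
    with 1 show ?thesis by (simp add: flat_exp_def)
  next
    case 2
    \<comment> \<open>At the origin the difference quotient of the member \<open>k\<close> is
      exactly the member \<open>k + 1\<close>.\<close>
    have "(flat_exp (Suc k) \<longlongrightarrow> 0) (at 0)" by (rule flat_exp_tendsto_0)
    then have "((\<lambda>h. flat_exp k h / h) \<longlongrightarrow> 0) (at 0)"
      by (rule Lim_transform_eventually) (auto simp: flat_exp_def eventually_at_filter field_simps)
    then show ?thesis by (simp add: 2 has_field_derivative_iff flat_exp_def)
  next
    case 3
    have "((\<lambda>t. inverse t ^ k * exp (- inverse t)) has_real_derivative
        (flat_exp (k + 2) t - real k * flat_exp (k + 1) t)) (at t)"
    proof (cases k)
      case (Suc m)
      have "((\<lambda>t. inverse t ^ Suc m) has_real_derivative - (real (Suc m) * inverse t ^ (m + 2))) (at t)"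
        using DERIV_power[OF DERIV_inverse[of t], of "Suc m"] 3 by (simp add: algebra_simps power2_eq_square)
      moreover have "((\<lambda>t. exp (- inverse t)) has_real_derivative exp (- inverse t) * inverse t ^ 2) (at t)"
        using 3 by (auto intro!: derivative_eq_intros simp: power2_eq_square)
      ultimately show ?thesis
        unfolding Suc by (rule DERIV_mult'[THEN DERIV_cong])
          (use 3 in \<open>simp add: flat_exp_def algebra_simps power_add power2_eq_square\<close>)
    qed (use 3 in \<open>auto intro!: derivative_eq_intros simp: flat_exp_def power2_eq_square\<close>)
    then show ?thesis
      by (rule has_field_derivative_transform_within_open[of _ _ _ "{0<..}"]) (use 3 in \<open>auto simp: flat_exp_def\<close>)
  qed
qed

lemma smooth_on_flat_exp: "smooth_on UNIV (flat_exp k)"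
proof -
  have "Ck_on n UNIV (flat_exp k)" for n
  proof (induction n arbitrary: k)
    case 0
    have "isCont (flat_exp k) t" for t
      using flat_exp_has_derivative DERIV_isCont by blast
    then show ?case by (simp add: continuous_at_imp_continuous_on)
  next
    case (Suc n)
    show ?case
      by (rule Ck_on_SucI[OF open_UNIV flat_exp_has_derivative[unfolded has_field_derivative_def]])
        (intro Ck_on_mult Ck_on_diff Ck_on_const Suc open_UNIV)
  qed
  then show ?thesis by (simp add: smooth_on_def)
qed

text \<open>The quotient u / (u + v), where \<open>u\<close> lives inside radius \<open>r\<close>
  and \<open>v\<close> outside radius \<open>r / 2\<close>; these regions cover the space, so the
  denominator never vanishes. The squared distance \<open>d\<close> is used because it is smooth
  also at \<open>p\<close>.\<close>

lemma smooth_cutoff: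
  fixes p :: "'a::euclidean_space"
  assumes "0 < r"
  shows "\<exists>\<rho> :: 'a \<Rightarrow> real. smooth_on UNIV \<rho> \<and> (\<forall>q. dist p q \<le> r / 2 \<longrightarrow> \<rho> q = 1) \<and> (\<forall>q. r \<le> dist p q \<longrightarrow> \<rho> q = 0)"
proof -
  define d where "d q = (q - p) \<bullet> (q - p)" for q
  have d: "d q = (dist p q)\<^sup>2" for q
    by (simp only: d_def dist_commute[of p q] dist_norm[of q p] power2_norm_eq_inner)
  define u v where "u q = flat_exp 0 (r\<^sup>2 - d q)" and "v q = flat_exp 0 (d q - (r / 2)\<^sup>2)" for q
  have pos: "u q + v q \<noteq> 0" for q
  proof -
    have "(r / 2)\<^sup>2 < r\<^sup>2" using assms by (simp add: power2_eq_square)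
    then have "0 < r\<^sup>2 - d q \<or> 0 < d q - (r / 2)\<^sup>2" by linarith
    then show ?thesis by (auto simp: u_def v_def flat_exp_def add_pos_nonneg add_nonneg_pos less_imp_neq[THEN not_sym])
  qed
  have sm_d: "smooth_on UNIV d"
    unfolding d_def smooth_on_def by (intro allI Ck_on_inner Ck_on_diff Ck_on_ident Ck_on_const open_UNIV)
  have "smooth_on UNIV u" "smooth_on UNIV v"
    unfolding u_def v_def
    by (intro smooth_on_compose[where T = UNIV, OF _ _ smooth_on_flat_exp] smooth_on_diff sm_d smooth_on_const; simp)+
  then have "smooth_on UNIV (\<lambda>q. u q / (u q + v q))"
    using pos by (intro smooth_on_divide smooth_on_add) auto
  moreover have "u q / (u q + v q) = 1" if "dist p q \<le> r / 2" for q
  proof -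
    have "d q \<le> (r / 2)\<^sup>2" unfolding d using that by (intro power_mono) auto
    then show ?thesis using pos[of q] by (simp add: v_def flat_exp_def)
  qed
  moreover have "u q / (u q + v q) = 0" if "r \<le> dist p q" for q
  proof -
    have "r\<^sup>2 \<le> d q" unfolding d using that assms by (intro power_mono) auto
    then show ?thesis by (simp add: u_def flat_exp_def)
  qed
  ultimately show ?thesis by blast
qed

text \<open>\<open>cov_deriv_on\<close> speaks about global fields with a given germ. This provides
  them, so that the condition has content when connections are compared. The extension is smooth
  since \<open>U\<close> and the complement of a smaller closed ball cover the space.\<close>

lemma smooth_germ_extension:
  fixes X :: "'a::euclidean_space \<Rightarrow> 'b::real_normed_vector"
  assumes "open U" "p \<in> U" "smooth_on U X"
  shows "\<exists>X'. smooth_on UNIV X' \<and> (\<forall>\<^sub>F q in nhds p. X' q = X q)"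
proof -
  obtain e where e: "0 < e" "ball p e \<subseteq> U" using assms openE by blast
  obtain \<rho> :: "'a \<Rightarrow> real" where \<rho>: "smooth_on UNIV \<rho>" "\<And>q. dist p q \<le> e / 2 / 2 \<Longrightarrow> \<rho> q = 1"
    "\<And>q. e / 2 \<le> dist p q \<Longrightarrow> \<rho> q = 0"
    using smooth_cutoff[of "e / 2" p] e by auto
  let ?X = "\<lambda>q. if q \<in> U then \<rho> q *\<^sub>R X q else 0"
  have "smooth_on U ?X"
    by (rule smooth_on_cong[OF assms(1), of "\<lambda>q. \<rho> q *\<^sub>R X q"])
      (auto intro!: smooth_on_scaleR assms smooth_on_subset[OF \<rho>(1)])
  moreover have "smooth_on (- cball p (e / 2)) ?X"
    by (rule smooth_on_cong[OF _ _ smooth_on_const[of _ 0]]) (auto simp: \<rho>(3))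
  moreover have "q \<in> U \<or> q \<in> - cball p (e / 2)" for q
  proof -
    have "cball p (e / 2) \<subseteq> ball p e" using e(1) by auto
    with e(2) show ?thesis by blast
  qed
  moreover have "open (- cball p (e / 2))" by (simp add: open_Compl)
  ultimately have "smooth_on UNIV ?X"
    using assms(1) by (intro smooth_on_local) blast
  moreover have "\<forall>\<^sub>F q in nhds p. ?X q = X q"
    unfolding eventually_nhds
    by (rule exI[of _ "ball p (e / 2 / 2)"]) (use e \<rho>(2) in \<open>auto simp: subset_iff\<close>)
  ultimately show ?thesis by blast
qed

subsection \<open>Integrals depending on a parameter\<close>

text \<open>Differentiation under the integral sign, iterated. It is meant for the derivative of a
  flow in the initial value, which is the exponential of such an integral; the direction
  \<open>(v, 0)\<close> leaves the integration variable fixed.\<close>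

lemma Ck_on_integral_param:
  fixes f :: "'a::euclidean_space \<times> real \<Rightarrow> real"
  assumes "open S" "open W" "S \<times> {0..1} \<subseteq> W" "Ck_on n W f"
  shows "Ck_on n S (\<lambda>x. integral {0..1} (\<lambda>s. f (x, s)))"
  using assms(4)
proof (induction n arbitrary: f)
  case 0
  have "continuous_on (S \<times> cbox 0 1) (\<lambda>(x, s). f (x, s))"
    using 0 assms(3) by (auto intro: continuous_on_subset)
  then have "continuous_on S (\<lambda>x. integral (cbox 0 1) (\<lambda>s. f (x, s)))"
    by (rule integral_continuous_on_param)
  then show ?case by simp
next
  case (Suc n)
  let ?D = "\<lambda>x s v. frechet_derivative f (at (x, s)) (v, 0)"
  have df: "(f has_derivative frechet_derivative f (at (x, s))) (at (x, s))" if "x \<in> S" "s \<in> {0..1}" for x s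
    using assms(3) that by (intro Ck_on_SucD(1)[OF Suc.prems]) blast
  have bl: "bounded_linear (?D x s)" if "x \<in> S" "s \<in> {0..1}" for x s
    using has_derivative_bounded_linear[OF df[OF that]]
    by (rule bounded_linear_compose) (intro bounded_linear_Pair bounded_linear_ident bounded_linear_zero)
  have cont: "continuous_on (S \<times> {0..1}) (\<lambda>(x, s). ?D x s v)" for v
    using continuous_on_subset[OF Ck_on_continuous_on[OF Ck_on_SucD(2)[OF Suc.prems, of "(v, 0)"]] assms(3)]
    by (simp add: split_beta')
  show ?case
  proof (rule Ck_on_SucI[OF assms(1), where f' = "\<lambda>x v. integral {0..1} (\<lambda>s. ?D x s v)"])
    fix x0 assume "x0 \<in> S"
    then obtain e where e: "0 < e" "ball x0 e \<subseteq> S" using assms(1) openE by blast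
    have "((\<lambda>x. integral (cbox 0 1) (\<lambda>s. f (x, s))) has_derivative
        integral (cbox 0 1) (\<lambda>s. Blinfun (?D x0 s))) (at x0 within ball x0 e)"
    proof (rule leibniz_rule)
      fix x s assume x: "x \<in> ball x0 e" and s: "s \<in> cbox (0::real) 1"
      then have xs: "x \<in> S" "s \<in> {0..1}" using e by auto
      have "((\<lambda>x. f (x, s)) has_derivative ?D x s) (at x)"
        by (rule has_derivative_compose[of "\<lambda>x. (x, s)" "\<lambda>v. (v, 0)", OF _ df[OF xs]])
          (auto intro!: derivative_eq_intros)
      then show "((\<lambda>x. f (x, s)) has_derivative blinfun_apply (Blinfun (?D x s))) (at x within ball x0 e)"
        by (simp add: bounded_linear_Blinfun_apply[OF bl[OF xs]] has_derivative_at_withinI)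
    next
      fix x assume "x \<in> ball x0 e"
      then have "{x} \<times> {0..1} \<subseteq> W" using assms(3) e by blast
      then have "continuous_on ({x} \<times> {0..1}) f"
        using Ck_on_SucD(1)[OF Suc.prems]
        by (meson continuous_at_imp_continuous_on has_derivative_continuous subset_iff)
      then have "continuous_on {0..1} (\<lambda>s. f (x, s))"
        by (rule continuous_on_compose2) (auto intro!: continuous_intros)
      then show "(\<lambda>s. f (x, s)) integrable_on cbox 0 1"
        using integrable_continuous_interval by auto
    next
      show "continuous_on (ball x0 e \<times> cbox 0 1) (\<lambda>(x, s). Blinfun (?D x s))"
      proof (rule continuous_on_blinfun_componentwise)
        fix i :: 'a
        have "continuous_on (ball x0 e \<times> cbox 0 1) (\<lambda>(x, s). ?D x s i)"
          by (rule continuous_on_subset[OF cont]) (use e in auto)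
        then show "continuous_on (ball x0 e \<times> cbox 0 1) (\<lambda>z. blinfun_apply (case z of (x, s) \<Rightarrow> Blinfun (?D x s)) i)"
          by (rule continuous_on_eq) (use e bl in \<open>auto simp: bounded_linear_Blinfun_apply subset_iff\<close>)
      qed
    qed (use e in auto)
    then have *: "((\<lambda>x. integral {0..1} (\<lambda>s. f (x, s))) has_derivative
        integral {0..1} (\<lambda>s. Blinfun (?D x0 s))) (at x0)"
      using e by (simp add: at_within_open[of _ "ball x0 e"])
    have "continuous_on {0..1} (\<lambda>s. Blinfun (?D x0 s))"
    proof (rule continuous_on_blinfun_componentwise)
      fix i :: 'a
      have "continuous_on {0..1} (\<lambda>s. ?D x0 s i)"
      proof -
        have "continuous_on ((\<lambda>s. (x0, s)) ` {0..1}) (\<lambda>(x, s). ?D x s i)"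
          by (rule continuous_on_subset[OF cont]) (use \<open>x0 \<in> S\<close> in auto)
        then have "continuous_on {0..1} ((\<lambda>(x, s). ?D x s i) \<circ> (\<lambda>s. (x0, s)))"
          by (rule continuous_on_compose[rotated]) (intro continuous_intros)
        then show ?thesis by (simp add: o_def)
      qed
      then show "continuous_on {0..1} (\<lambda>s. blinfun_apply (Blinfun (?D x0 s)) i)"
        by (rule continuous_on_eq) (use \<open>x0 \<in> S\<close> bl in \<open>auto simp: bounded_linear_Blinfun_apply\<close>)
    qed
    then have int: "(\<lambda>s. Blinfun (?D x0 s)) integrable_on {0..1}" by (rule integrable_continuous_interval)
    have "blinfun_apply (integral {0..1} (\<lambda>s. Blinfun (?D x0 s))) v = integral {0..1} (\<lambda>s. ?D x0 s v)" for v
      unfolding blinfun_apply_integral[OF int]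
      by (rule integral_cong) (use \<open>x0 \<in> S\<close> bl in \<open>auto simp: bounded_linear_Blinfun_apply\<close>)
    then have "blinfun_apply (integral {0..1} (\<lambda>s. Blinfun (?D x0 s))) = (\<lambda>v. integral {0..1} (\<lambda>s. ?D x0 s v))"
      by blast
    with * show "((\<lambda>x. integral {0..1} (\<lambda>s. f (x, s))) has_derivative
        (\<lambda>v. integral {0..1} (\<lambda>s. ?D x0 s v))) (at x0)" by simp
  next
    fix v
    show "Ck_on n S (\<lambda>x. integral {0..1} (\<lambda>s. ?D x s v))"
      by (rule Suc.IH[OF Ck_on_SucD(2)[OF Suc.prems]])
  qed
qed

subsection \<open>The inverse function theorem in the plane\<close>

lemma linear_vec2:
  fixes D :: "real^2 \<Rightarrow> 'b::real_vector"
  assumes "linear D"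
  shows "D v = v $ 1 *\<^sub>R D (axis 1 1) + v $ 2 *\<^sub>R D (axis 2 1)"
proof -
  have "D v = D (v $ 1 *\<^sub>R axis 1 1 + v $ 2 *\<^sub>R axis 2 1)"
    by (rule arg_cong[of _ _ D]) (simp add: vec_eq_iff forall_2 axis_def)
  also have "\<dots> = v $ 1 *\<^sub>R D (axis 1 1) + v $ 2 *\<^sub>R D (axis 2 1)"
    using assms by (simp add: linear_add linear_scale)
  finally show ?thesis .
qed

text \<open>The inverse of the matrix with columns \<open>a\<close> and \<open>b\<close> applied to
  \<open>v\<close>, as an explicit rational expression, so that its smooth dependence on the entries
  is visible.\<close>

definition cramer2 :: "real^2 \<Rightarrow> real^2 \<Rightarrow> real^2 \<Rightarrow> real^2" where
  "cramer2 a b v = vector [(v $ 1 * b $ 2 - v $ 2 * b $ 1) / (a $ 1 * b $ 2 - a $ 2 * b $ 1),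
     (v $ 2 * a $ 1 - v $ 1 * a $ 2) / (a $ 1 * b $ 2 - a $ 2 * b $ 1)]"

lemma cramer2:
  fixes D :: "real^2 \<Rightarrow> real^2"
  assumes "linear D" "bij D"
  shows "D (axis 1 1) $ 1 * D (axis 2 1) $ 2 - D (axis 1 1) $ 2 * D (axis 2 1) $ 1 \<noteq> 0" (is "?d \<noteq> 0")
    and "inv D v = cramer2 (D (axis 1 1)) (D (axis 2 1)) v"
proof -
  note D = linear_vec2[OF assms(1)]
  have eq: "D (inv D v) = v" for v using assms(2) by (simp add: bij_is_surj surj_f_inv_f)
  obtain p q where p: "D p = axis 1 1" and q: "D q = axis 2 1" using eq by metis
  have "?d * (p $ 1 * q $ 2 - p $ 2 * q $ 1) = D p $ 1 * D q $ 2 - D p $ 2 * D q $ 1"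
    unfolding D[of p] D[of q] by (simp add: algebra_simps)
  also have "\<dots> = 1" by (simp add: p q axis_def)
  finally show d: "?d \<noteq> 0" by auto
  define w where "w = inv D v"
  have "v $ i = w $ 1 * D (axis 1 1) $ i + w $ 2 * D (axis 2 1) $ i" for i
    using arg_cong[OF eq[of v], of "\<lambda>u. u $ i"] D[of "inv D v"] by (simp add: w_def)
  then have "cramer2 (D (axis 1 1)) (D (axis 2 1)) v = w"
    using d by (simp add: cramer2_def vec_eq_iff forall_2 field_simps)
  then show "inv D v = cramer2 (D (axis 1 1)) (D (axis 2 1)) v" by (simp add: w_def)
qed

text \<open>The inverse function theorem gives a differentiable inverse \<open>g\<close> with
  derivative \<open>G (g y)\<close>, where \<open>G\<close> is smooth by Cramer's rule. If
  \<open>g\<close> is of class \<open>n\<close>, so is this derivative, hence \<open>g\<close> is of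
  class \<open>n + 1\<close>.\<close>

lemma smooth_local_inverse:
  fixes f :: "real^2 \<Rightarrow> real^2"
  assumes "open U" "x0 \<in> U" "smooth_on U f" "inj (frechet_derivative f (at x0))"
  shows "\<exists>U'. x0 \<in> U' \<and> U' \<subseteq> U \<and> chart U' f \<and> (\<forall>x\<in>U'. bij (frechet_derivative f (at x)))"
proof -
  let ?D = "\<lambda>x. frechet_derivative f (at x)"
  have df: "(f has_derivative ?D x) (at x)" if "x \<in> U" for x
    using smooth_on_has_derivative[OF assms(3) that] .
  have bl: "blinfun_apply (Blinfun (?D x)) = ?D x" if "x \<in> U" for x
    by (rule bounded_linear_Blinfun_apply[OF has_derivative_bounded_linear[OF df[OF that]]])
  have cont: "continuous_on U (\<lambda>x. Blinfun (?D x))"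
  proof (rule continuous_on_blinfun_componentwise)
    fix i :: "real^2"
    show "continuous_on U (\<lambda>x. blinfun_apply (Blinfun (?D x)) i)"
      by (rule continuous_on_eq[OF smooth_on_continuous_on[OF smooth_on_frechet_derivative[OF assms(3)]]])
        (simp add: bl)
  qed
  obtain g0 where g0: "linear g0" "g0 \<circ> ?D x0 = id"
    using linear_injective_left_inverse[OF has_derivative_linear[OF df[OF assms(2)]] assms(4)] by blast
  have *: "Blinfun g0 o\<^sub>L Blinfun (?D x0) = id_blinfun"
    using g0 bl[OF assms(2)]
    by (intro blinfun_eqI) (simp add: bounded_linear_Blinfun_apply linear_conv_bounded_linear fun_eq_iff)
  have derf: "(f has_derivative blinfun_apply (Blinfun (?D x))) (at x)" if "x \<in> U" for x
    using df[OF that] bl[OF that] by simp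
  have "\<exists>U' V g g'. open U' \<and> U' \<subseteq> U \<and> x0 \<in> U' \<and> open V \<and> homeomorphism U' V f g \<and>
      (\<forall>y\<in>V. (g has_derivative g' y) (at y) \<and> g' y = inv (blinfun_apply (Blinfun (?D (g y)))) \<and>
        bij (blinfun_apply (Blinfun (?D (g y)))))"
    by (rule inverse_function_theorem[OF assms(1) derf cont assms(2) *], assumption) (intro exI conjI ballI; simp)
  then obtain U' V g g' where U': "open U'" "U' \<subseteq> U" "x0 \<in> U'" "open V" and hom: "homeomorphism U' V f g"
    and g: "\<And>y. y \<in> V \<Longrightarrow> (g has_derivative g' y) (at y)"
      "\<And>y. y \<in> V \<Longrightarrow> g' y = inv (blinfun_apply (Blinfun (?D (g y))))"
      "\<And>y. y \<in> V \<Longrightarrow> bij (blinfun_apply (Blinfun (?D (g y))))"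
    by blast
  have gV: "g y \<in> U'" if "y \<in> V" for y using hom that by (auto simp: homeomorphism_def)
  have V: "f ` U' = V" using hom by (auto simp: homeomorphism_def)
  have inj: "inj_on f U'" using hom by (intro inj_on_inverseI) (rule homeomorphism_apply1)
  have the_inv: "the_inv_into U' f y = g y" if "y \<in> V" for y
    using the_inv_into_f_f[OF inj gV[OF that]] homeomorphism_apply2[OF hom that] by simp
  have bij: "bij (?D (g y))" if "y \<in> V" for y
    using g(3)[OF that] unfolding bl[OF subsetD[OF U'(2) gV[OF that]]] .
  have lin: "linear (?D (g y))" if "y \<in> V" for y
    by (rule has_derivative_linear[OF df[OF subsetD[OF U'(2) gV[OF that]]]])
  define G where "G x v = cramer2 (?D x (axis 1 1)) (?D x (axis 2 1)) v" for x v
  have g': "(g has_derivative G (g y)) (at y)" if "y \<in> V" for y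
  proof -
    have "g' y = G (g y)"
      unfolding g(2)[OF that] bl[OF subsetD[OF U'(2) gV[OF that]]] G_def
      using cramer2(2)[OF lin[OF that] bij[OF that]] by blast
    then show ?thesis using g(1)[OF that] by simp
  qed
  have bijU: "bij (?D x)" if "x \<in> U'" for x
    using bij[of "f x"] homeomorphism_apply1[OF hom that] V that by auto
  have smG: "smooth_on U' (\<lambda>x. G x v)" for v
  proof (rule smooth_on_vec[OF U'(1)])
    fix i :: 2
    have D: "smooth_on U' (\<lambda>x. ?D x w $ j)" for w j
      by (intro smooth_on_vec_nth smooth_on_subset[OF smooth_on_frechet_derivative[OF assms(3)]] U')
    have nz: "?D x (axis 1 1) $ 1 * ?D x (axis 2 1) $ 2 - ?D x (axis 1 1) $ 2 * ?D x (axis 2 1) $ 1 \<noteq> 0" if "x \<in> U'" for x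
      by (rule cramer2(1)[OF has_derivative_linear[OF df[OF subsetD[OF U'(2) that]]] bijU[OF that]])
    consider "i = 1" | "i = 2" using exhaust_2 by blast
    then show "smooth_on U' (\<lambda>x. G x v $ i)"
      unfolding G_def cramer2_def
      by cases (simp only: vector_2, intro smooth_on_divide smooth_on_diff smooth_on_mult smooth_on_const D U' nz; assumption)+
  qed
  have "Ck_on n V g" for n
  proof (induction n)
    case 0
    show ?case using hom by (simp add: homeomorphism_def)
  next
    case (Suc n)
    show ?case
    proof (rule Ck_on_SucI[OF U'(4) g'])
      show "Ck_on n V (\<lambda>y. G (g y) v)" for v
        by (rule Ck_on_compose[OF U'(4,1) smooth_on_Ck[OF smG] Suc]) (use gV in blast)
    qed
  qed
  then have "smooth_on V g" unfolding smooth_on_def by blast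
  then have "smooth_on V (the_inv_into U' f)"
    by (rule smooth_on_cong[OF U'(4) the_inv[symmetric], rotated])
  then have "chart U' f"
    unfolding chart_def V using U'(1,4) inj smooth_on_subset[OF assms(3) U'(2)] by blast
  then show ?thesis using U'(3,2) bijU by blast
qed

subsection \<open>Taylor estimates on compact convex sets\<close>

lemma continuous_on_compact_norm_bound:
  fixes f :: "'a::topological_space \<Rightarrow> 'b::real_normed_vector"
  assumes "continuous_on S f" "compact T" "T \<subseteq> S"
  shows "\<exists>M\<ge>0. \<forall>z\<in>T. norm (f z) \<le> M"
proof -
  have "bounded (f ` T)"
    by (rule compact_imp_bounded[OF compact_continuous_image[OF continuous_on_subset[OF assms(1,3)] assms(2)]])
  then obtain b where "\<forall>x\<in>f ` T. norm x \<le> b" unfolding bounded_iff by (rule exE)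
  then show ?thesis by (intro exI[of _ "max b 0"]) auto
qed

lemma Ck_on_1_bounded_derivative:
  fixes f :: "'a::euclidean_space \<Rightarrow> 'b::real_normed_vector"
  assumes "Ck_on (Suc 0) S f" "compact T" "T \<subseteq> S"
  shows "\<exists>L\<ge>0. \<forall>y\<in>T. \<forall>v. norm (frechet_derivative f (at y) v) \<le> L * norm v"
proof -
  have "\<exists>b\<ge>0. \<forall>y\<in>T. norm (frechet_derivative f (at y) i) \<le> b" for i
    by (rule continuous_on_compact_norm_bound[OF Ck_on_continuous_on[OF Ck_on_SucD(2)[OF assms(1)]] assms(2,3)])
  then obtain b where b: "\<And>i. b i \<ge> 0" "\<And>i y. y \<in> T \<Longrightarrow> norm (frechet_derivative f (at y) i) \<le> b i"
    by metis
  have "norm (frechet_derivative f (at y) v) \<le> (\<Sum>i\<in>Basis. b i) * norm v" if "y \<in> T" for y v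
  proof -
    have df: "(f has_derivative frechet_derivative f (at y)) (at y)"
      using Ck_on_SucD(1)[OF assms(1)] that assms(3) by blast
    have "norm (frechet_derivative f (at y) v) \<le> (\<Sum>i\<in>Basis. norm ((v \<bullet> i) *\<^sub>R frechet_derivative f (at y) i))"
      unfolding frechet_derivative_linear_sum[OF df, of v] by (rule norm_sum)
    also have "\<dots> \<le> (\<Sum>i\<in>Basis. norm v * b i)"
      by (intro sum_mono) (auto intro!: mult_mono b that Basis_le_norm)
    finally show ?thesis by (simp add: sum_distrib_left mult.commute)
  qed
  then show ?thesis using b(1) by (intro exI[of _ "\<Sum>i\<in>Basis. b i"]) (auto intro!: sum_nonneg)
qed

lemma Ck_on_1_lipschitz:
  fixes f :: "'a::euclidean_space \<Rightarrow> 'b::real_normed_vector"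
  assumes "Ck_on (Suc 0) S f" "compact T" "convex T" "T \<subseteq> S"
  shows "\<exists>L\<ge>0. \<forall>y\<in>T. \<forall>z\<in>T. norm (f z - f y) \<le> L * norm (z - y)"
proof -
  obtain L where L: "L \<ge> 0" "\<And>y v. y \<in> T \<Longrightarrow> norm (frechet_derivative f (at y) v) \<le> L * norm v"
    using Ck_on_1_bounded_derivative[OF assms(1,2,4)] by blast
  have "norm (f z - f y) \<le> L * norm (z - y)" if "y \<in> T" "z \<in> T" for y z
  proof (rule differentiable_bound[OF assms(3) _ _ that(2,1)])
    fix x assume "x \<in> T"
    then show "(f has_derivative frechet_derivative f (at x)) (at x within T)"
      using Ck_on_SucD(1)[OF assms(1)] assms(4) has_derivative_at_withinI by blast
    show "onorm (frechet_derivative f (at x)) \<le> L"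
      by (rule onorm_bound[OF L(1) L(2)[OF \<open>x \<in> T\<close>]])
  qed
  with L(1) show ?thesis by blast
qed

text \<open>After subtracting its linear part at \<open>y\<close>, the function has a derivative of
  size at most \<open>C * norm (z - y)\<close> on the segment, and the mean value inequality adds
  the second factor. The constant is uniform in the base point.\<close>

lemma Ck_on_2_taylor:
  fixes f :: "'a::euclidean_space \<Rightarrow> 'b::real_normed_vector"
  assumes "Ck_on (Suc (Suc 0)) S f" "compact T" "convex T" "T \<subseteq> S"
  shows "\<exists>C\<ge>0. \<forall>y\<in>T. \<forall>z\<in>T. norm (f z - f y - frechet_derivative f (at y) (z - y)) \<le> C * (norm (z - y))\<^sup>2"
proof -
  let ?D = "\<lambda>y. frechet_derivative f (at y)"
  have df: "(f has_derivative ?D x) (at x)" if "x \<in> T" for x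
    using Ck_on_SucD(1)[OF assms(1)] that assms(4) by blast
  have "\<forall>i. \<exists>L\<ge>0. \<forall>y\<in>T. \<forall>z\<in>T. norm (?D z i - ?D y i) \<le> L * norm (z - y)"
    using Ck_on_1_lipschitz[OF Ck_on_SucD(2)[OF assms(1)] assms(2-4)] by blast
  then obtain b where b: "\<And>i. b i \<ge> 0" "\<And>i y z. y \<in> T \<Longrightarrow> z \<in> T \<Longrightarrow> norm (?D z i - ?D y i) \<le> b i * norm (z - y)"
    by metis
  define C where "C = (\<Sum>i\<in>Basis. b i)"
  have C: "C \<ge> 0" unfolding C_def by (intro sum_nonneg b)
  have DC: "norm (?D z v - ?D y v) \<le> C * norm (z - y) * norm v" if "y \<in> T" "z \<in> T" for y z v
  proof -
    have "?D z v - ?D y v = (\<Sum>i\<in>Basis. (v \<bullet> i) *\<^sub>R (?D z i - ?D y i))"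
      unfolding frechet_derivative_linear_sum[OF df[OF that(1)], of v] frechet_derivative_linear_sum[OF df[OF that(2)], of v]
      by (simp add: sum_subtractf scaleR_diff_right)
    also have "norm \<dots> \<le> (\<Sum>i\<in>Basis. norm ((v \<bullet> i) *\<^sub>R (?D z i - ?D y i)))"
      by (rule norm_sum)
    also have "\<dots> \<le> (\<Sum>i\<in>Basis. norm v * (b i * norm (z - y)))"
      by (intro sum_mono) (auto intro!: mult_mono b that Basis_le_norm)
    also have "\<dots> = C * norm (z - y) * norm v"
      by (simp add: C_def sum_distrib_left sum_distrib_right mult.commute mult.left_commute)
    finally show ?thesis .
  qed
  have "norm (f z - f y - ?D y (z - y)) \<le> C * (norm (z - y))\<^sup>2" if "y \<in> T" "z \<in> T" for y z
  proof -
    have sub: "closed_segment y z \<subseteq> T" by (rule closed_segment_subset[OF that assms(3)])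
    have lin: "bounded_linear (?D y)" by (rule has_derivative_bounded_linear[OF df[OF that(1)]])
    have "norm ((f z - ?D y z) - (f y - ?D y y)) \<le> (C * norm (z - y)) * norm (z - y)"
    proof (rule differentiable_bound[where S = "closed_segment y z" and f' = "\<lambda>x v. ?D x v - ?D y v"])
      fix x assume x: "x \<in> closed_segment y z"
      then have "x \<in> T" using sub by blast
      show "((\<lambda>x. f x - ?D y x) has_derivative (\<lambda>v. ?D x v - ?D y v)) (at x within closed_segment y z)"
        by (intro has_derivative_diff has_derivative_at_withinI[OF df[OF \<open>x \<in> T\<close>]]
            bounded_linear.has_derivative[OF lin has_derivative_ident])
      show "onorm (\<lambda>v. ?D x v - ?D y v) \<le> C * norm (z - y)"
      proof (rule onorm_bound)
        show "norm (?D x v - ?D y v) \<le> C * norm (z - y) * norm v" for v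
          by (rule order_trans[OF DC[OF that(1) \<open>x \<in> T\<close>]])
            (intro mult_right_mono mult_left_mono C segment_bound1[OF x] norm_ge_zero)
      qed (use C in simp)
    qed auto
    moreover have "f z - f y - ?D y (z - y) = (f z - ?D y z) - (f y - ?D y y)"
      unfolding linear_diff[OF bounded_linear.linear[OF lin]] by simp
    ultimately show ?thesis by (simp only: power2_eq_square mult.assoc)
  qed
  with C show ?thesis by blast
qed

text \<open>Gronwall estimates produce bounds of exactly this kind; this converts them into
  differentiability of solutions with respect to their data.\<close>

lemma has_derivative_quadratic_remainder:
  assumes "bounded_linear D" "0 < \<delta>"
    "\<And>y. norm (y - x) < \<delta> \<Longrightarrow> norm (f y - f x - D (y - x)) \<le> C * (norm (y - x))\<^sup>2"
  shows "(f has_derivative D) (at x)"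
proof (rule has_derivativeI[OF assms(1)])
  have "((\<lambda>y. C * norm (y - x)) \<longlongrightarrow> C * norm (x - x)) (at x)"
    by (intro tendsto_intros)
  then have "((\<lambda>y. C * norm (y - x)) \<longlongrightarrow> 0) (at x)" by simp
  moreover have "\<forall>\<^sub>F y in at x. norm (((f y - f x) - D (y - x)) /\<^sub>R norm (y - x)) \<le> C * norm (y - x)"
    unfolding eventually_at dist_norm
  proof (intro exI[of _ \<delta>] conjI ballI impI assms(2))
    fix y assume "y \<noteq> x \<and> norm (y - x) < \<delta>"
    then have "norm (f y - f x - D (y - x)) \<le> (C * norm (y - x)) * norm (y - x)" "norm (y - x) > 0"
      using assms(3)[of y] by (auto simp: power2_eq_square mult.assoc)
    then show "norm (((f y - f x) - D (y - x)) /\<^sub>R norm (y - x)) \<le> C * norm (y - x)"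
      by (simp add: pos_divide_le_eq divide_inverse_commute[symmetric])
  qed
  ultimately show "((\<lambda>y. ((f y - f x) - D (y - x)) /\<^sub>R norm (y - x)) \<longlongrightarrow> 0) (at x)"
    by (rule Lim_null_comparison[rotated])
qed

subsection \<open>Ordinary differential equations\<close>

text \<open>The squared norm is used because it stays differentiable where \<open>u\<close>
  vanishes. In the exponent, \<open>2 * K\<close> comes from the linear term and the 1 from
  estimating 2 \<epsilon> |u| by |u|^2 + \<epsilon>^2.\<close>

lemma gronwall:
  fixes u :: "real \<Rightarrow> 'a::real_inner"
  assumes "0 \<le> T" "0 \<le> K" "0 \<le> \<epsilon>"
    and u: "\<And>t. 0 \<le> t \<Longrightarrow> t \<le> T \<Longrightarrow> (u has_vector_derivative u' t) (at t)"
    and le: "\<And>t. 0 \<le> t \<Longrightarrow> t \<le> T \<Longrightarrow> norm (u' t) \<le> K * norm (u t) + \<epsilon>"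
  shows "(norm (u T))\<^sup>2 \<le> ((norm (u 0))\<^sup>2 + \<epsilon>\<^sup>2 * T) * exp ((2 * K + 1) * T)"
proof -
  define c where "c = 2 * K + 1"
  \<comment> \<open>The exponential weight absorbs the growth of the squared norm and the linear
    term absorbs the inhomogeneity, which makes \<open>\<psi>\<close> nonincreasing.\<close>
  define \<psi> where "\<psi> t = (u t \<bullet> u t) * exp (- c * t) - \<epsilon>\<^sup>2 * t" for t
  define \<psi>' where "\<psi>' t = (2 * (u t \<bullet> u' t) - c * (u t \<bullet> u t)) * exp (- c * t) - \<epsilon>\<^sup>2" for t
  have der: "(\<psi> has_real_derivative \<psi>' t) (at t)" if "0 \<le> t" "t \<le> T" for t
  proof -
    have "((\<lambda>t. u t \<bullet> u t) has_real_derivative (2 * (u t \<bullet> u' t))) (at t)"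
      using has_derivative_inner[OF u[OF that, unfolded has_vector_derivative_def] u[OF that, unfolded has_vector_derivative_def]]
      by (simp add: has_field_derivative_def inner_commute algebra_simps mult_commute_abs)
    moreover have "((\<lambda>t. exp (- c * t)) has_real_derivative exp (- c * t) * (- c)) (at t)"
      by (auto intro!: derivative_eq_intros)
    ultimately have "((\<lambda>t. (u t \<bullet> u t) * exp (- c * t)) has_real_derivative
      (u t \<bullet> u t) * (exp (- c * t) * (- c)) + 2 * (u t \<bullet> u' t) * exp (- c * t)) (at t)"
      by (rule DERIV_mult')
    moreover have "((\<lambda>t. \<epsilon>\<^sup>2 * t) has_real_derivative \<epsilon>\<^sup>2) (at t)"
      by (auto intro!: derivative_eq_intros)
    ultimately show ?thesis
      unfolding \<psi>_def[abs_def] \<psi>'_def by (auto dest: DERIV_diff simp: algebra_simps)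
  qed
  have neg: "\<psi>' t \<le> 0" if "0 \<le> t" "t \<le> T" for t
  proof -
    have "2 * (u t \<bullet> u' t) \<le> 2 * (norm (u t) * norm (u' t))" using norm_cauchy_schwarz by simp
    also have "\<dots> \<le> 2 * (norm (u t) * (K * norm (u t) + \<epsilon>))"
      using le[OF that] by (intro mult_left_mono) auto
    also have "\<dots> \<le> c * (norm (u t))\<^sup>2 + \<epsilon>\<^sup>2"
      using sum_squares_bound[of "norm (u t)" \<epsilon>] by (simp add: c_def algebra_simps power2_eq_square)
    finally have "2 * (u t \<bullet> u' t) - c * (u t \<bullet> u t) \<le> \<epsilon>\<^sup>2" by (simp add: power2_norm_eq_inner)
    then have "(2 * (u t \<bullet> u' t) - c * (u t \<bullet> u t)) * exp (- c * t) \<le> \<epsilon>\<^sup>2 * exp (- c * t)"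
      by (intro mult_right_mono) auto
    also have "0 \<le> c * t" using that assms(2) by (simp add: c_def)
    then have "\<epsilon>\<^sup>2 * exp (- c * t) \<le> \<epsilon>\<^sup>2 * 1"
      by (intro mult_left_mono) auto
    finally show ?thesis by (simp add: \<psi>'_def)
  qed
  have "\<psi> T \<le> \<psi> 0"
    by (rule DERIV_nonpos_imp_nonincreasing[OF assms(1)]) (use der neg in blast)
  then have "(u T \<bullet> u T) * exp (- c * T) \<le> u 0 \<bullet> u 0 + \<epsilon>\<^sup>2 * T" by (simp add: \<psi>_def)
  then have "(u T \<bullet> u T) * exp (- c * T) * exp (c * T) \<le> (u 0 \<bullet> u 0 + \<epsilon>\<^sup>2 * T) * exp (c * T)"
    by (intro mult_right_mono) auto
  moreover have "exp (- c * T) * exp (c * T) = 1" by (simp flip: exp_add)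
  ultimately have "u T \<bullet> u T \<le> (u 0 \<bullet> u 0 + \<epsilon>\<^sup>2 * T) * exp (c * T)"
    by (simp only: mult.assoc mult_1_right)
  then show ?thesis by (simp add: power2_norm_eq_inner c_def)
qed

lemma continuous_antiderivative:
  fixes g :: "real \<Rightarrow> 'a::euclidean_space"
  assumes "continuous_on UNIV g"
  shows "\<exists>G. G 0 = 0 \<and> (\<forall>t. (G has_vector_derivative g t) (at t))"
proof -
  obtain F where F: "\<And>t. (F has_vector_derivative g t) (at t)"
    using einterval_antiderivative[of "-\<infinity>" \<infinity> g] assms by (auto simp: continuous_on_eq_continuous_at)
  show ?thesis
    by (rule exI[of _ "\<lambda>t. F t - F 0"]) (auto intro!: derivative_eq_intros F)
qed

text \<open>Integrating the weight exp(L |t|) gains the factor 1 / L. In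
  \<open>picard_global\<close> this factor becomes the contraction constant.\<close>

lemma exponential_growth_antiderivative:
  fixes G :: "real \<Rightarrow> 'a::real_normed_vector"
  assumes "0 < L" "\<And>t. (G has_vector_derivative g t) (at t)" "\<And>t. norm (g t) \<le> M * exp (L * \<bar>t\<bar>)" "0 \<le> M" "G 0 = 0"
  shows "norm (G t) \<le> M / L * exp (L * \<bar>t\<bar>)"
proof -
  \<comment> \<open>Only the forward half-line is treated here; negative times follow by applying
    this to the reflected function.\<close>
  have *: "norm (H t) \<le> M / L * exp (L * t)"
    if "0 \<le> t" "\<And>t. (H has_vector_derivative h t) (at t)" "\<And>t. 0 \<le> t \<Longrightarrow> norm (h t) \<le> M * exp (L * t)" "H 0 = 0"
    for H :: "real \<Rightarrow> 'a" and h t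
  proof (cases "t = 0")
    case False
    have phi: "((\<lambda>t. M / L * exp (L * t)) has_vector_derivative M * exp (L * x)) (at x)" for x
      using assms(1)
      by (auto intro!: derivative_eq_intros simp flip: has_real_derivative_iff_has_vector_derivative)
    have "norm (H t - H 0) \<le> M / L * exp (L * t) - M / L * exp (L * 0)"
    proof (rule differentiable_bound_general[where f' = h and \<phi>' = "\<lambda>t. M * exp (L * t)"])
      show "continuous_on {0..t} H"
        by (intro continuous_at_imp_continuous_on ballI has_vector_derivative_continuous[OF that(2)])
      show "continuous_on {0..t} (\<lambda>t. M / L * exp (L * t))"
        by (intro continuous_at_imp_continuous_on ballI has_vector_derivative_continuous[OF phi])
      show "0 < t" using that(1) False by simp
      show "norm (h x) \<le> M * exp (L * x)" if "0 < x" for x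
        using \<open>\<And>t. 0 \<le> t \<Longrightarrow> norm (h t) \<le> M * exp (L * t)\<close>[of x] that by simp
    qed (rule that(2) phi)+
    moreover have "0 \<le> M / L" using assms by simp
    ultimately show ?thesis using that(4) by simp
  qed (use that assms in simp)
  show ?thesis
  proof (cases "0 \<le> t")
    case True
    have "norm (g t) \<le> M * exp (L * t)" if "0 \<le> t" for t using assms(3)[of t] that by simp
    then have "norm (G t) \<le> M / L * exp (L * t)" by (rule *[OF True assms(2) _ assms(5)])
    with True show ?thesis by simp
  next
    case False
    have "((\<lambda>t. G (- t)) has_vector_derivative - g (- t)) (at t)" for t
    proof -
      have "(uminus has_vector_derivative (-1::real)) (at t)"
        by (auto intro!: derivative_eq_intros simp flip: has_real_derivative_iff_has_vector_derivative)
      from vector_diff_chain_at[OF this assms(2)] show ?thesis by (simp add: o_def)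
    qed
    moreover have "norm (- g (- t)) \<le> M * exp (L * t)" if "0 \<le> t" for t
      using assms(3)[of "- t"] that by simp
    ultimately have "norm (G (- (- t))) \<le> M / L * exp (L * - t)"
      using False assms(5) by (intro *[where H = "\<lambda>t. G (- t)"]) auto
    with False show ?thesis by simp
  qed
qed

text \<open>The fixed point is taken in the space of bounded continuous functions after the
  substitution \<open>u t = exp (L \<bar>t\<bar>) v t\<close>; the weight makes the integral operator a contraction
  on the whole line.\<close>

lemma picard_global:
  fixes f :: "real \<Rightarrow> 'a::euclidean_space \<Rightarrow> 'a"
  assumes cont: "continuous_on UNIV (\<lambda>(t, y). f t y)"
    and lip: "\<And>t y z. norm (f t y - f t z) \<le> K * norm (y - z)"
    and bnd: "\<And>t. norm (f t 0) \<le> C"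
  shows "\<exists>u. u 0 = u0 \<and> (\<forall>t. (u has_vector_derivative f t (u t)) (at t))"
proof -
  have "0 \<le> C" using order_trans[OF norm_ge_zero bnd] .
  define K' where "K' = max K 0"
  \<comment> \<open>The contraction constant will be \<open>K' / L\<close>: this choice makes it
    less than 1 and keeps \<open>L\<close> positive even if \<open>K'\<close> is 0.\<close>
  define L where "L = K' + 1"
  have K': "0 \<le> K'" and L: "0 < L" by (auto simp: K'_def L_def)
  have lip': "norm (f t y - f t z) \<le> K' * norm (y - z)" for t y z
    by (rule order_trans[OF lip]) (auto simp: K'_def intro!: mult_right_mono)
  define g where "g v t = f t (exp (L * \<bar>t\<bar>) *\<^sub>R apply_bcontfun v t)" for v t
  have g_cont: "continuous_on UNIV (g v)" for v
  proof -
    have "continuous_on UNIV (\<lambda>t. (t, exp (L * \<bar>t\<bar>) *\<^sub>R apply_bcontfun v t))"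
      by (intro continuous_intros) simp
    from continuous_on_compose2[OF cont this] show ?thesis by (simp add: g_def[abs_def])
  qed
  then have "\<forall>v. \<exists>G. G 0 = 0 \<and> (\<forall>t. (G has_vector_derivative g v t) (at t))"
    using continuous_antiderivative by blast
  then obtain I where I: "\<And>v. I v 0 = 0" "\<And>v t. (I v has_vector_derivative g v t) (at t)"
    by metis
  \<comment> \<open>The integral operator transported to the weighted unknown:
    \<open>u0 + I v t\<close> is the next iterate, and the factor in front removes its
    growth.\<close>
  define T where "T v t = exp (- (L * \<bar>t\<bar>)) *\<^sub>R (u0 + I v t)" for v t
  have T_bcontfun: "T v \<in> bcontfun" for v
  proof -
    have "continuous_on UNIV (I v)"
      by (intro continuous_at_imp_continuous_on ballI has_vector_derivative_continuous[OF I(2)])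
    then have cont_T: "continuous_on UNIV (T v)"
      unfolding T_def by (intro continuous_intros) auto
    obtain B where B: "\<And>t. norm (apply_bcontfun v t) \<le> B" "0 \<le> B"
      using norm_bounded[of v] norm_ge_zero by blast
    let ?M = "C + K' * B"
    have "norm (g v t) \<le> ?M * exp (L * \<bar>t\<bar>)" for t
    proof -
      have "norm (g v t) \<le> norm (f t 0) + norm (g v t - f t 0)"
        using norm_triangle_ineq[of "f t 0" "g v t - f t 0"] by simp
      also have "\<dots> \<le> C + K' * (exp (L * \<bar>t\<bar>) * B)"
      proof (rule add_mono[OF bnd])
        have "norm (g v t - f t 0) \<le> K' * norm (exp (L * \<bar>t\<bar>) *\<^sub>R apply_bcontfun v t)"
          unfolding g_def using lip'[of t "exp (L * \<bar>t\<bar>) *\<^sub>R apply_bcontfun v t" 0] by simp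
        also have "\<dots> \<le> K' * (exp (L * \<bar>t\<bar>) * B)"
          using B(1)[of t] K' by (intro mult_left_mono) auto
        finally show "norm (g v t - f t 0) \<le> K' * (exp (L * \<bar>t\<bar>) * B)" .
      qed
      also have "\<dots> \<le> C * exp (L * \<bar>t\<bar>) + K' * (exp (L * \<bar>t\<bar>) * B)"
        using mult_left_mono[of 1 "exp (L * \<bar>t\<bar>)" C] \<open>0 \<le> C\<close> L by simp
      finally show ?thesis by (simp add: algebra_simps)
    qed
    from exponential_growth_antiderivative[OF L I(2) this] \<open>0 \<le> C\<close> K' B(2) I(1)
    have Ib: "norm (I v t) \<le> ?M / L * exp (L * \<bar>t\<bar>)" for t by simp
    have "norm (T v t) \<le> norm u0 + ?M / L" for t
    proof -
      have e: "exp (- (L * \<bar>t\<bar>)) * exp (L * \<bar>t\<bar>) = 1" by (simp add: exp_minus)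
      have "norm (T v t) \<le> exp (- (L * \<bar>t\<bar>)) * (norm u0 + ?M / L * exp (L * \<bar>t\<bar>))"
        unfolding T_def norm_scaleR by (intro mult_mono order_trans[OF norm_triangle_ineq] add_left_mono Ib) auto
      also have "\<dots> = exp (- (L * \<bar>t\<bar>)) * norm u0 + ?M / L"
        using e by (simp only: distrib_left mult.left_commute[of "exp (- (L * \<bar>t\<bar>))"] mult_1_right)
      also have "\<dots> \<le> norm u0 + ?M / L"
        using mult_right_mono[of "exp (- (L * \<bar>t\<bar>))" 1 "norm u0"] L by simp
      finally show ?thesis .
    qed
    with cont_T show ?thesis by (rule bcontfun_normI)
  qed
  have "dist (Bcontfun (T v)) (Bcontfun (T w)) \<le> K' / L * dist v w" for v w
  proof (rule dist_bound)
    fix t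
    have D: "((\<lambda>t. I v t - I w t) has_vector_derivative (g v t - g w t)) (at t)" for t
      by (intro has_vector_derivative_diff I)
    have "norm (g v t - g w t) \<le> (K' * dist v w) * exp (L * \<bar>t\<bar>)" for t
    proof -
      have "norm (g v t - g w t) \<le> K' * (exp (L * \<bar>t\<bar>) * dist (apply_bcontfun v t) (apply_bcontfun w t))"
        unfolding g_def by (rule order_trans[OF lip']) (simp add: dist_norm flip: scaleR_diff_right)
      also have "\<dots> \<le> K' * (exp (L * \<bar>t\<bar>) * dist v w)"
        by (intro mult_left_mono dist_bounded K') auto
      finally show ?thesis by (simp only: mult_ac)
    qed
    from exponential_growth_antiderivative[OF L D this] K' I(1)
    have "norm (I v t - I w t) \<le> (K' * dist v w) / L * exp (L * \<bar>t\<bar>)" by simp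
    then have "norm (T v t - T w t) \<le> exp (- (L * \<bar>t\<bar>)) * ((K' * dist v w) / L * exp (L * \<bar>t\<bar>))"
      unfolding T_def by (simp add: mult_left_mono flip: scaleR_diff_right del: times_divide_eq_left)
    also have "\<dots> = K' / L * dist v w" by (simp add: exp_minus)
    finally show "dist (apply_bcontfun (Bcontfun (T v)) t) (apply_bcontfun (Bcontfun (T w)) t) \<le> K' / L * dist v w"
      by (simp add: Bcontfun_inverse[OF T_bcontfun] dist_norm)
  qed
  moreover have "K' / L < 1" using K' by (simp add: L_def)
  moreover have "0 \<le> K' / L" using K' L by simp
  ultimately have "\<exists>!v. Bcontfun (T v) = v" by (intro banach_fix_type) auto
  then obtain v where v: "Bcontfun (T v) = v" by blast
  have vT: "apply_bcontfun v t = T v t" for t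
    using Bcontfun_inverse[OF T_bcontfun[of v]] v by simp
  have "g v t = f t (u0 + I v t)" for t
    by (simp add: g_def vT T_def exp_minus)
  then have "((\<lambda>t. u0 + I v t) has_vector_derivative f t (u0 + I v t)) (at t)" for t
    using I(2)[of v t] by (auto intro!: derivative_eq_intros)
  then show ?thesis using I(1) by (intro exI[of _ "\<lambda>t. u0 + I v t"]) auto
qed

subsection \<open>Flat linear systems\<close>

text \<open>The solution \<open>w\<close> is obtained by solving the system along each ray from the origin. For
  neighbouring end points \<open>x\<close> and \<open>x + h\<close>, flatness makes
  \<open>U (x + h) t - U x t - t N (t x) h (U x t)\<close> satisfy a linear equation up to an error
  \<open>O (\<bar>h\<bar>\<^sup>2)\<close>, so that \<open>w\<close> has the derivative \<open>N x \<sqdot> (w x)\<close>.\<close>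

lemma flat_linear_system_estimate:
  fixes N :: "'a::euclidean_space \<Rightarrow> 'a \<Rightarrow>\<^sub>L ('b::euclidean_space \<Rightarrow>\<^sub>L 'b)"
  assumes smooth: "smooth_on UNIV N"
    and flat: "\<And>x h k. frechet_derivative N (at x) h k + (N x k o\<^sub>L N x h) = frechet_derivative N (at x) k h + (N x h o\<^sub>L N x k)"
    and U0: "\<And>x. U x 0 = w0"
    and U: "\<And>x t. 0 \<le> t \<Longrightarrow> t \<le> 1 \<Longrightarrow> (U x has_vector_derivative N (t *\<^sub>R x) x (U x t)) (at t)"
  shows "\<exists>C. \<forall>h. norm h < 1 \<longrightarrow> norm (U (x + h) 1 - U x 1 - N x h (U x 1)) \<le> C * (norm h)\<^sup>2"
proof -
  define R where "R = norm x + 1"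
  let ?T = "cball (0::'a) R"
  let ?D = "\<lambda>y. frechet_derivative N (at y)"
  have C2: "Ck_on (Suc (Suc 0)) UNIV N" using smooth_on_Ck[OF smooth] .
  have R: "1 \<le> R" by (simp add: R_def)
  obtain M where M: "\<And>z. z \<in> ?T \<Longrightarrow> norm (N z) \<le> M"
    using continuous_on_compact_norm_bound[OF smooth_on_continuous_on[OF smooth] compact_cball subset_UNIV, of 0 R] by blast
  obtain L where L: "0 \<le> L" "\<And>y z. y \<in> ?T \<Longrightarrow> z \<in> ?T \<Longrightarrow> norm (N z - N y) \<le> L * norm (z - y)"
    using Ck_on_1_lipschitz[OF Ck_on_Suc_imp[OF C2] compact_cball convex_cball subset_UNIV, of 0 R] by blast
  obtain C where C: "0 \<le> C" "\<And>y z. y \<in> ?T \<Longrightarrow> z \<in> ?T \<Longrightarrow> norm (N z - N y - ?D y (z - y)) \<le> C * (norm (z - y))\<^sup>2"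
    using Ck_on_2_taylor[OF C2 compact_cball convex_cball subset_UNIV, of 0 R] by blast
  obtain D where D: "0 \<le> D" "\<And>y v. y \<in> ?T \<Longrightarrow> norm (?D y v) \<le> D * norm v"
    using Ck_on_1_bounded_derivative[OF Ck_on_Suc_imp[OF C2] compact_cball subset_UNIV, of 0 R] by blast
  obtain B where B: "\<And>t. 0 \<le> t \<Longrightarrow> t \<le> 1 \<Longrightarrow> norm (U x t) \<le> B"
  proof -
    have "continuous_on {0..1} (U x)"
      by (intro continuous_at_imp_continuous_on ballI has_vector_derivative_continuous[OF U]) auto
    from continuous_on_compact_norm_bound[OF this compact_Icc order_refl]
    obtain B where "\<forall>z\<in>{0..1}. norm (U x z) \<le> B" by blast
    then show ?thesis by (intro that[of B]) simp
  qed
  have M0: "0 \<le> M" using M[of 0] R norm_ge_zero[of "N 0"] by (simp del: norm_ge_zero)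
  have B0: "0 \<le> B" using order_trans[OF norm_ge_zero B[of 0]] by simp
  have DN: "(N has_derivative ?D y) (at y)" for y using smooth_on_has_derivative[OF smooth] by simp
  \<comment> \<open>The three summands bound the remainders \<open>Q1\<close>, \<open>Q2\<close> and
    \<open>Q3\<close> below, each in units of the square of \<open>norm h\<close>.\<close>
  define Cq where "Cq = C * R * B + D * B + (L * R + M) * (M * B)"
  have Cq0: "0 \<le> Cq"
    unfolding Cq_def using C(1) D(1) L(1) R M0 B0 by (intro add_nonneg_nonneg mult_nonneg_nonneg) auto
  have "norm (U (x + h) 1 - U x 1 - N x h (U x 1)) \<le> (Cq * sqrt (exp (2 * (M * R) + 1))) * (norm h)\<^sup>2"
    if h: "norm h < 1" for h
  proof -
    let ?x = "x + h"
    have xR: "norm ?x \<le> R" using norm_triangle_ineq[of x h] h by (simp add: R_def)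
    have inT: "t *\<^sub>R y \<in> ?T" if "0 \<le> t" "t \<le> 1" "norm y \<le> R" for t y
      using mult_mono[of t 1 "norm y" R] that by simp
    have T1: "t *\<^sub>R x \<in> ?T" "t *\<^sub>R ?x \<in> ?T" if "0 \<le> t" "t \<le> 1" for t
      using inT[OF that] xR by (auto simp: R_def)
    define E where "E t = U ?x t - U x t - t *\<^sub>R N (t *\<^sub>R x) h (U x t)" for t
    define E' where "E' t = N (t *\<^sub>R ?x) ?x (U ?x t) - N (t *\<^sub>R x) x (U x t)
      - (t *\<^sub>R (N (t *\<^sub>R x) h (N (t *\<^sub>R x) x (U x t)) + ?D (t *\<^sub>R x) x h (U x t)) + N (t *\<^sub>R x) h (U x t))" for t
    have dE: "(E has_vector_derivative E' t) (at t)" if t: "0 \<le> t" "t \<le> 1" for t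
    proof -
      have "((\<lambda>t. N (0 + t *\<^sub>R x)) has_vector_derivative ?D (0 + t *\<^sub>R x) x) (at t)"
        by (rule has_derivative_on_line[OF DN])
      then have "((\<lambda>t. N (t *\<^sub>R x) h) has_vector_derivative ?D (t *\<^sub>R x) x h) (at t)"
        using bounded_linear.has_vector_derivative[OF blinfun.bounded_linear_left] by simp
      from bounded_bilinear.has_vector_derivative[OF bounded_bilinear_blinfun_apply this U[OF t]]
      have "((\<lambda>t. N (t *\<^sub>R x) h (U x t)) has_vector_derivative
          N (t *\<^sub>R x) h (N (t *\<^sub>R x) x (U x t)) + ?D (t *\<^sub>R x) x h (U x t)) (at t)" .
      from has_vector_derivative_scaleR[OF DERIV_ident this]
      have "((\<lambda>t. t *\<^sub>R N (t *\<^sub>R x) h (U x t)) has_vector_derivative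
          t *\<^sub>R (N (t *\<^sub>R x) h (N (t *\<^sub>R x) x (U x t)) + ?D (t *\<^sub>R x) x h (U x t)) + 1 *\<^sub>R N (t *\<^sub>R x) h (U x t)) (at t)" .
      from has_vector_derivative_diff[OF has_vector_derivative_diff[OF U[OF t, of ?x] U[OF t, of x]] this]
      show ?thesis unfolding E_def[abs_def] E'_def by simp
    qed
    have bE: "norm (E' t) \<le> (M * R) * norm (E t) + Cq * (norm h)\<^sup>2" if t: "0 \<le> t" "t \<le> 1" for t
    proof -
      let ?y = "t *\<^sub>R x" and ?z = "t *\<^sub>R ?x" and ?u = "U x t"
      have zy: "?z - ?y = t *\<^sub>R h" by (simp add: algebra_simps)
      have nzy: "norm (?z - ?y) \<le> norm h" unfolding zy using t by (simp add: mult_left_le_one_le)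
      \<comment> \<open>Flatness replaces the derivative of \<open>N\<close> along \<open>x\<close>
        applied to \<open>h\<close> by the one along \<open>h\<close> applied to \<open>x\<close>,
        which Taylor's formula compares with \<open>N ?z - N ?y\<close>. What then remains besides
        \<open>N ?z ?x (E t)\<close> is quadratic in \<open>h\<close>: the Taylor remainder
        \<open>Q1\<close>, the second-order term \<open>Q2\<close>, and \<open>Q3\<close>, a product
        of two factors of order \<open>h\<close>.\<close>
      define Q1 where "Q1 = (N ?z - N ?y - ?D ?y (?z - ?y)) ?x ?u"
      define Q2 where "Q2 = t *\<^sub>R ?D ?y h h ?u"
      define Q3 where "Q3 = t *\<^sub>R ((N ?z - N ?y) ?x + N ?y h) (N ?y h ?u)"
      have flat': "?D ?y x h ?u + N ?y h (N ?y x ?u) = ?D ?y h x ?u + N ?y x (N ?y h ?u)"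
        using arg_cong[OF flat[of ?y x h], of "\<lambda>b. b ?u"] by (simp add: blinfun.add_left)
      have lin: "?D ?y (?z - ?y) = t *\<^sub>R ?D ?y h"
        unfolding zy by (rule linear_scale[OF has_derivative_linear[OF DN]])
      have t_flat: "t *\<^sub>R (N ?y h (N ?y x ?u) + ?D ?y x h ?u) = t *\<^sub>R (?D ?y h x ?u + N ?y x (N ?y h ?u))"
        using flat' by (simp add: add.commute)
      have eq: "E' t = N ?z ?x (E t) + (Q1 + Q2 + Q3)"
        unfolding E'_def E_def Q1_def Q2_def Q3_def lin t_flat
        by (simp add: blinfun.bilinear_simps algebra_simps)
      have "norm (N ?z ?x (E t)) \<le> (M * R) * norm (E t)"
      proof -
        have "norm (N ?z ?x (E t)) \<le> norm (N ?z ?x) * norm (E t)" by (rule norm_blinfun)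
        also have "\<dots> \<le> (M * R) * norm (E t)"
          by (intro mult_right_mono order_trans[OF norm_blinfun] mult_mono M T1 t xR M0) auto
        finally show ?thesis .
      qed
      moreover have "norm Q1 \<le> C * R * B * (norm h)\<^sup>2"
      proof -
        have "norm Q1 \<le> norm (N ?z - N ?y - ?D ?y (?z - ?y)) * norm ?x * norm ?u"
          unfolding Q1_def by (rule order_trans[OF norm_blinfun]) (intro mult_right_mono norm_blinfun norm_ge_zero)
        also have "\<dots> \<le> (C * (norm h)\<^sup>2) * R * B"
          using C(1) R t
          by (intro mult_mono order_trans[OF C(2)] T1 B xR mult_left_mono power_mono nzy) auto
        finally show ?thesis by (simp add: mult_ac)
      qed
      moreover have "norm Q2 \<le> D * B * (norm h)\<^sup>2"
      proof -
        have "norm Q2 \<le> 1 * (norm (?D ?y h) * norm h * norm ?u)"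
          unfolding Q2_def norm_scaleR using t
          by (intro mult_mono order_trans[OF norm_blinfun] mult_right_mono norm_blinfun) auto
        also have "\<dots> \<le> 1 * ((D * norm h) * norm h * B)"
          using D(1) t by (intro mult_left_mono mult_mono D(2) T1 B) auto
        finally show ?thesis by (simp add: mult_ac power2_eq_square)
      qed
      moreover have "norm Q3 \<le> (L * R + M) * (M * B) * (norm h)\<^sup>2"
      proof -
        have "norm ((N ?z - N ?y) ?x + N ?y h) \<le> (L * norm h) * R + M * norm h"
        proof (rule order_trans[OF norm_triangle_ineq add_mono])
          show "norm ((N ?z - N ?y) ?x) \<le> (L * norm h) * R"
            by (rule order_trans[OF norm_blinfun])
              (intro mult_mono order_trans[OF L(2)] T1 t mult_left_mono nzy L(1) xR mult_nonneg_nonneg norm_ge_zero)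
          show "norm (N ?y h) \<le> M * norm h"
            by (rule order_trans[OF norm_blinfun]) (intro mult_right_mono M T1 t norm_ge_zero)
        qed
        moreover have "norm (N ?y h ?u) \<le> M * norm h * B"
        proof -
          have "norm (N ?y h ?u) \<le> norm (N ?y h) * norm ?u" by (rule norm_blinfun)
          also have "\<dots> \<le> (M * norm h) * B"
            by (intro mult_mono order_trans[OF norm_blinfun mult_right_mono[OF M]] T1 t B mult_nonneg_nonneg norm_ge_zero M0)
          finally show ?thesis .
        qed
        ultimately have "norm ((N ?z - N ?y) ?x + N ?y h) * norm (N ?y h ?u)
            \<le> ((L * norm h) * R + M * norm h) * (M * norm h * B)"
          using L(1) R M0 by (intro mult_mono) auto
        from order_trans[OF norm_blinfun this]
        have "norm (((N ?z - N ?y) ?x + N ?y h) (N ?y h ?u)) \<le> ((L * norm h) * R + M * norm h) * (M * norm h * B)" .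
        moreover have "norm Q3 \<le> norm (((N ?z - N ?y) ?x + N ?y h) (N ?y h ?u))"
          unfolding Q3_def norm_scaleR using t by (simp only: real_norm_def mult_left_le_one_le abs_ge_zero norm_ge_zero abs_of_nonneg)
        ultimately have "norm Q3 \<le> ((L * norm h) * R + M * norm h) * (M * norm h * B)" by linarith
        then show ?thesis by (simp add: algebra_simps power2_eq_square)
      qed
      ultimately have "norm (E' t) \<le> (M * R) * norm (E t) + (C * R * B * (norm h)\<^sup>2 + D * B * (norm h)\<^sup>2
          + (L * R + M) * (M * B) * (norm h)\<^sup>2)"
        unfolding eq by (intro order_trans[OF norm_triangle_ineq add_mono] order_trans[OF norm_triangle_ineq] add_mono)
      then show ?thesis by (simp only: Cq_def distrib_right)
    qed
    have "(norm (E 1))\<^sup>2 \<le> ((norm (E 0))\<^sup>2 + (Cq * (norm h)\<^sup>2)\<^sup>2 * 1) * exp ((2 * (M * R) + 1) * 1)"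
      using dE bE R M0 Cq0 by (intro gronwall[where u' = E']) auto
    moreover have "E 0 = 0" by (simp add: E_def U0)
    ultimately have "(norm (E 1))\<^sup>2 \<le> (Cq * (norm h)\<^sup>2)\<^sup>2 * (sqrt (exp (2 * (M * R) + 1)))\<^sup>2" by simp
    then have "(norm (E 1))\<^sup>2 \<le> (Cq * (norm h)\<^sup>2 * sqrt (exp (2 * (M * R) + 1)))\<^sup>2"
      by (simp only: power_mult_distrib)
    then have "norm (E 1) \<le> Cq * (norm h)\<^sup>2 * sqrt (exp (2 * (M * R) + 1))"
      by (rule power2_le_imp_le) (use Cq0 in simp)
    then show ?thesis by (simp add: E_def mult_ac)
  qed
  then show ?thesis by blast
qed

lemma flat_linear_system:
  fixes N :: "'a::euclidean_space \<Rightarrow> 'a \<Rightarrow>\<^sub>L ('b::euclidean_space \<Rightarrow>\<^sub>L 'b)"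
  assumes smooth: "smooth_on UNIV N"
    and flat: "\<And>x h k. frechet_derivative N (at x) h k + (N x k o\<^sub>L N x h) = frechet_derivative N (at x) k h + (N x h o\<^sub>L N x k)"
  shows "\<exists>w. smooth_on UNIV w \<and> w 0 = w0 \<and> (\<forall>x. (w has_derivative (\<lambda>h. N x h (w x))) (at x))"
proof -
  \<comment> \<open>Clamping time to [0,1] keeps the base point in the compact ball of radius
    \<open>norm x\<close>. There \<open>N\<close> is bounded, so \<open>picard_global\<close>
    applies with a uniform Lipschitz constant; on [0,1] nothing changes.\<close>
  define cl where "cl t = max 0 (min 1 t)" for t :: real
  have N_cont: "continuous_on UNIV N" by (rule smooth_on_continuous_on[OF smooth])
  have cl_cont: "continuous_on UNIV (\<lambda>z. cl (fst z))" for z :: "real \<times> 'b"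
    unfolding cl_def by (intro continuous_intros)
  have "\<exists>u. u 0 = w0 \<and> (\<forall>t. (u has_vector_derivative N (cl t *\<^sub>R x) x (u t)) (at t))" for x
  proof -
    obtain M where M: "\<And>z. z \<in> cball 0 (norm x) \<Longrightarrow> norm (N z) \<le> M"
      using continuous_on_compact_norm_bound[OF N_cont compact_cball subset_UNIV, of 0 "norm x"] by blast
    show ?thesis
    proof (rule picard_global[where K = "M * norm x" and C = 0])
      have "continuous_on UNIV (\<lambda>z::real \<times> 'b. N (cl (fst z) *\<^sub>R x))"
        by (rule continuous_on_compose2[OF N_cont]) (auto intro!: continuous_intros cl_cont)
      then have "continuous_on UNIV (\<lambda>z::real \<times> 'b. N (cl (fst z) *\<^sub>R x) x (snd z))"
        by (intro continuous_intros)
      then show "continuous_on UNIV (\<lambda>(t, y). N (cl t *\<^sub>R x) x y)"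
        by (simp add: case_prod_beta')
      fix t y z
      have "cl t *\<^sub>R x \<in> cball 0 (norm x)" by (auto simp: cl_def mult_left_le_one_le)
      then have "norm (N (cl t *\<^sub>R x) x) \<le> M * norm x"
        by (intro order_trans[OF norm_blinfun] mult_right_mono M) auto
      then show "norm (N (cl t *\<^sub>R x) x y - N (cl t *\<^sub>R x) x z) \<le> M * norm x * norm (y - z)"
        unfolding blinfun.diff_right[symmetric] by (rule order_trans[OF norm_blinfun mult_right_mono[OF _ norm_ge_zero]])
    qed (simp add: blinfun.zero_right)
  qed
  then obtain U where U0: "\<And>x. U x 0 = w0" and U: "\<And>x t. (U x has_vector_derivative N (cl t *\<^sub>R x) x (U x t)) (at t)"
    by metis
  define w where "w x = U x 1" for x
  have U': "(U x has_vector_derivative N (t *\<^sub>R x) x (U x t)) (at t)" if "0 \<le> t" "t \<le> 1" for x t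
    using U[of x t] that by (simp add: cl_def)
  have dw: "(w has_derivative (\<lambda>h. N x h (w x))) (at x)" for x
  proof -
    obtain C where C: "\<And>h. norm h < 1 \<Longrightarrow> norm (U (x + h) 1 - U x 1 - N x h (U x 1)) \<le> C * (norm h)\<^sup>2"
      using flat_linear_system_estimate[OF smooth flat, of U w0, OF U0 U'] by blast
    show ?thesis
    proof (rule has_derivative_quadratic_remainder[where \<delta> = 1])
      show "bounded_linear (\<lambda>h. N x h (w x))"
        by (intro bounded_linear_compose[OF blinfun.bounded_linear_left blinfun.bounded_linear_right])
      show "norm (w y - w x - N x (y - x) (w x)) \<le> C * (norm (y - x))\<^sup>2" if "norm (y - x) < 1" for y
        using C[OF that] by (simp add: w_def)
    qed simp
  qed
  \<comment> \<open>The equation expresses the derivative of \<open>w\<close> through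
    \<open>N\<close> and \<open>w\<close> itself, so each order of smoothness yields the
    next.\<close>
  have "Ck_on n UNIV w" for n
  proof (induction n)
    case 0
    show ?case
      unfolding Ck_on.simps by (intro continuous_at_imp_continuous_on ballI has_derivative_continuous[OF dw])
  next
    case (Suc n)
    show ?case
    proof (rule Ck_on_SucI[OF open_UNIV dw])
      fix v
      have "Ck_on n UNIV (\<lambda>x. N x v)"
        using Ck_on_bounded_linear[OF blinfun.bounded_linear_left open_UNIV smooth_on_Ck[OF smooth]] .
      then show "Ck_on n UNIV (\<lambda>x. N x v (w x))"
        by (rule Ck_on_bilinear[OF bounded_bilinear_blinfun_apply open_UNIV _ Suc])
    qed
  qed
  then have "smooth_on UNIV w" unfolding smooth_on_def by blast
  \<comment> \<open>The ray to the origin is a single point, so the system along it is trivial and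
    its solution constant.\<close>
  moreover have "w 0 = w0"
  proof -
    have "(U 0 has_vector_derivative 0) (at t within UNIV)" for t
      using U[of 0 t] by (simp add: blinfun.zero_right blinfun.zero_left)
    from has_vector_derivative_zero_constant[OF convex_UNIV this]
    show ?thesis unfolding w_def using U0[of 0] by (metis UNIV_I)
  qed
  ultimately show ?thesis using dw by blast
qed

subsection \<open>First integrals of one-forms in the plane\<close>

text \<open>Negative times are reduced to positive ones by the substitution t -> \<sigma> t, with
  \<sigma> the sign of \<open>\<tau>\<close>.\<close>

lemma gronwall_abs:
  fixes u :: "real \<Rightarrow> 'a::real_inner"
  assumes "0 \<le> K" "0 \<le> \<epsilon>"
    and u: "\<And>t. \<bar>t\<bar> \<le> \<bar>\<tau>\<bar> \<Longrightarrow> (u has_vector_derivative u' t) (at t)"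
    and le: "\<And>t. \<bar>t\<bar> \<le> \<bar>\<tau>\<bar> \<Longrightarrow> norm (u' t) \<le> K * norm (u t) + \<epsilon>"
  shows "(norm (u \<tau>))\<^sup>2 \<le> ((norm (u 0))\<^sup>2 + \<epsilon>\<^sup>2 * \<bar>\<tau>\<bar>) * exp ((2 * K + 1) * \<bar>\<tau>\<bar>)"
proof -
  define \<sigma> :: real where "\<sigma> = (if 0 \<le> \<tau> then 1 else -1)"
  have \<sigma>: "\<sigma> * \<bar>\<tau>\<bar> = \<tau>" "\<bar>\<sigma>\<bar> = 1" by (auto simp: \<sigma>_def)
  have "((\<lambda>t. u (\<sigma> * t)) has_vector_derivative \<sigma> *\<^sub>R u' (\<sigma> * t)) (at t)" if "0 \<le> t" "t \<le> \<bar>\<tau>\<bar>" for t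
  proof -
    have "((\<lambda>t. \<sigma> * t) has_vector_derivative \<sigma>) (at t)"
      by (auto intro!: derivative_eq_intros simp flip: has_real_derivative_iff_has_vector_derivative)
    from vector_diff_chain_at[OF this u[of "\<sigma> * t"]] show ?thesis
      using that \<sigma>(2) by (simp add: o_def abs_mult)
  qed
  moreover have "norm (\<sigma> *\<^sub>R u' (\<sigma> * t)) \<le> K * norm (u (\<sigma> * t)) + \<epsilon>" if "0 \<le> t" "t \<le> \<bar>\<tau>\<bar>" for t
    using le[of "\<sigma> * t"] that \<sigma>(2) by (simp add: abs_mult)
  ultimately have "(norm (u (\<sigma> * \<bar>\<tau>\<bar>)))\<^sup>2 \<le> ((norm (u (\<sigma> * 0)))\<^sup>2 + \<epsilon>\<^sup>2 * \<bar>\<tau>\<bar>) * exp ((2 * K + 1) * \<bar>\<tau>\<bar>)"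
    using assms(1,2) by (intro gronwall[where u = "\<lambda>t. u (\<sigma> * t)" and u' = "\<lambda>t. \<sigma> *\<^sub>R u' (\<sigma> * t)"]) auto
  then show ?thesis by (simp add: \<sigma>)
qed

text \<open>\<open>F (t, \<eta>)\<close> is the solution of y' = a(t, y) with initial value
  \<open>\<eta>\<close>. Its derivative in \<open>\<eta>\<close> solves the linearised equation,
  which in one dimension is integrated by an exponential. The integral is scaled to [0,1], so that
  time enters as a parameter and the formula can be differentiated again.\<close>

lemma scalar_flow:
  fixes a :: "real \<times> real \<Rightarrow> real"
  assumes S: "open S" "(0, 0) \<in> S" and a: "smooth_on S a"
  shows "\<exists>\<epsilon> \<rho> :: real. \<exists>F. 0 < \<epsilon> \<and> 0 < \<rho> \<and> (\<forall>\<eta>. F (0, \<eta>) = \<eta>) \<and>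
    (\<forall>t \<eta>. \<bar>t\<bar> < \<epsilon> \<longrightarrow> \<bar>\<eta>\<bar> < \<rho> \<longrightarrow> (t, F (t, \<eta>)) \<in> S \<and>
      (F has_derivative (\<lambda>h. fst h * a (t, F (t, \<eta>)) +
        snd h * exp (t * integral {0..1} (\<lambda>s. frechet_derivative a (at (t * s, F (t * s, \<eta>))) (0, 1))))) (at (t, \<eta>)))"
proof -
  have C2: "Ck_on (Suc (Suc 0)) S a" by (rule smooth_on_Ck[OF a])
  obtain r where r: "0 < r" "{-r..r} \<times> {-r..r} \<subseteq> S"
  proof -
    obtain e where e: "0 < e" "ball (0, 0) e \<subseteq> S" using S openE by blast
    have "z \<in> S" if "z \<in> {-(e/3)..e/3} \<times> {-(e/3)..e/3}" for z
    proof -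
      have "norm z \<le> \<bar>fst z\<bar> + \<bar>snd z\<bar>" using norm_Pair_le[of "fst z" "snd z"] by simp
      also have "\<dots> < e" using that e(1) by (auto simp: abs_if)
      finally have "z \<in> ball (0, 0) e" by (simp flip: zero_prod_def)
      with e(2) show ?thesis by blast
    qed
    moreover have "0 < e / 3" using e(1) by simp
    ultimately show ?thesis using that[of "e / 3"] by blast
  qed
  define T where "T = {-r..r} \<times> {-r..r}"
  have T: "compact T" "convex T" "T \<subseteq> S"
    using r unfolding T_def by (auto intro: compact_Times convex_Times)
  obtain M where M: "0 \<le> M" "\<And>z. z \<in> T \<Longrightarrow> \<bar>a z\<bar> \<le> M"
    using continuous_on_compact_norm_bound[OF smooth_on_continuous_on[OF a] T(1,3)] by (auto simp: real_norm_def)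
  obtain L where L: "0 \<le> L" "\<And>y z. y \<in> T \<Longrightarrow> z \<in> T \<Longrightarrow> norm (a z - a y) \<le> L * norm (z - y)"
    using Ck_on_1_lipschitz[OF Ck_on_Suc_imp[OF C2] T] by blast
  obtain C where C: "0 \<le> C" "\<And>y z. y \<in> T \<Longrightarrow> z \<in> T \<Longrightarrow> norm (a z - a y - frechet_derivative a (at y) (z - y)) \<le> C * (norm (z - y))\<^sup>2"
    using Ck_on_2_taylor[OF C2 T] by blast
  obtain D where D: "0 \<le> D" "\<And>y v. y \<in> T \<Longrightarrow> norm (frechet_derivative a (at y) v) \<le> D * norm v"
    using Ck_on_1_bounded_derivative[OF Ck_on_Suc_imp[OF C2] T(1,3)] by blast
  have Da: "(a has_derivative frechet_derivative a (at z)) (at z)" if "z \<in> T" for z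
    using smooth_on_has_derivative[OF a] T(3) that by blast
  \<comment> \<open>Clamping both variables to the square \<open>T\<close> turns \<open>a\<close>
    into the globally Lipschitz, bounded right-hand side \<open>b\<close> that
    \<open>picard_global\<close> requires.\<close>
  define cl where "cl s = max (-r) (min r s)" for s
  have cl: "cl s \<in> {-r..r}" for s using r by (auto simp: cl_def)
  have cl_id: "cl s = s" if "\<bar>s\<bar> \<le> r" for s using that by (auto simp: cl_def)
  have cl_cont: "continuous_on UNIV (\<lambda>z. cl (f z))" if "continuous_on UNIV f" for f :: "'c::topological_space \<Rightarrow> real"
    unfolding cl_def by (intro continuous_intros that)
  have cl_lip: "\<bar>cl s - cl s'\<bar> \<le> \<bar>s - s'\<bar>" for s s' by (auto simp: cl_def)
  have clT: "(cl s, cl y) \<in> T" for s y using cl by (simp add: T_def)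
  define b where "b t y = a (cl t, cl y)" for t y
  have b_cont: "continuous_on UNIV (\<lambda>z. b (f z) (g z))" if "continuous_on UNIV f" "continuous_on UNIV g"
    for f g :: "'c::topological_space \<Rightarrow> real"
    unfolding b_def
    by (rule continuous_on_compose2[OF smooth_on_continuous_on[OF a]])
      (use clT T(3) in \<open>auto intro!: continuous_on_Pair cl_cont that\<close>)
  have b_bound: "\<bar>b t y\<bar> \<le> M" for t y unfolding b_def by (rule M(2)[OF clT])
  have b_lip: "\<bar>b t y - b t z\<bar> \<le> L * \<bar>y - z\<bar>" for t y z
  proof -
    have "\<bar>b t y - b t z\<bar> \<le> L * norm ((cl t, cl y) - (cl t, cl z))"
      unfolding b_def using L(2)[OF clT clT, of t y t z] by simp
    also have "\<dots> \<le> L * \<bar>y - z\<bar>"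
      using cl_lip[of y z] L(1) by (intro mult_left_mono) (auto simp: norm_Pair)
    finally show ?thesis .
  qed
  have "\<exists>u. u 0 = \<eta> \<and> (\<forall>t. (u has_vector_derivative b t (u t)) (at t))" for \<eta>
  proof (rule picard_global[where K = L and C = M])
    show "continuous_on UNIV (\<lambda>(t, y). b t y)"
      unfolding case_prod_beta' by (intro b_cont continuous_intros)
  qed (use b_bound b_lip in auto)
  then obtain \<Phi> where \<Phi>0: "\<And>\<eta>. \<Phi> \<eta> 0 = \<eta>" and \<Phi>: "\<And>\<eta> t. (\<Phi> \<eta> has_vector_derivative b t (\<Phi> \<eta> t)) (at t)"
    by metis
  have \<Phi>_time: "\<bar>\<Phi> \<eta> t - \<Phi> \<eta> s\<bar> \<le> M * \<bar>t - s\<bar>" for \<eta> t s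
  proof -
    have "norm (\<Phi> \<eta> t - \<Phi> \<eta> s) \<le> M * norm (t - s)"
    proof (rule differentiable_bound[OF convex_UNIV])
      show "(\<Phi> \<eta> has_derivative (\<lambda>h. h *\<^sub>R b x (\<Phi> \<eta> x))) (at x within UNIV)" for x
        using \<Phi> by (simp add: has_vector_derivative_def)
      show "onorm (\<lambda>h. h *\<^sub>R b x (\<Phi> \<eta> x)) \<le> M" for x
      proof (rule onorm_bound[OF M(1)])
        show "norm (h *\<^sub>R b x (\<Phi> \<eta> x)) \<le> M * norm h" for h
          using mult_right_mono[OF b_bound[of x "\<Phi> \<eta> x"] abs_ge_zero[of h]] by (simp add: abs_mult mult.commute)
      qed
    qed auto
    then show ?thesis by simp
  qed
  have \<Phi>_lip: "(\<Phi> \<eta>' t - \<Phi> \<eta> t)\<^sup>2 \<le> (\<eta>' - \<eta>)\<^sup>2 * exp ((2 * L + 1) * \<bar>t\<bar>)" for \<eta> \<eta>' t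
  proof -
    have "(norm (\<Phi> \<eta>' t - \<Phi> \<eta> t))\<^sup>2 \<le> ((norm (\<Phi> \<eta>' 0 - \<Phi> \<eta> 0))\<^sup>2 + 0\<^sup>2 * \<bar>t\<bar>) * exp ((2 * L + 1) * \<bar>t\<bar>)"
    proof (rule gronwall_abs[where u = "\<lambda>t. \<Phi> \<eta>' t - \<Phi> \<eta> t" and u' = "\<lambda>t. b t (\<Phi> \<eta>' t) - b t (\<Phi> \<eta> t)"])
      show "((\<lambda>t. \<Phi> \<eta>' t - \<Phi> \<eta> t) has_vector_derivative b t (\<Phi> \<eta>' t) - b t (\<Phi> \<eta> t)) (at t)" for t
        by (intro has_vector_derivative_diff \<Phi>)
    qed (use b_lip L(1) in auto)
    then show ?thesis by (simp add: \<Phi>0)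
  qed
  have \<Phi>_cont: "continuous_on UNIV (\<lambda>(\<eta>, t). \<Phi> \<eta> t)"
  proof (intro continuous_at_imp_continuous_on ballI)
    fix z :: "real \<times> real"
    obtain \<eta> t where z: "z = (\<eta>, t)" by (cases z)
    let ?g = "\<lambda>y. M * \<bar>snd y - t\<bar> + \<bar>fst y - \<eta>\<bar> * sqrt (exp ((2 * L + 1) * \<bar>t\<bar>))"
    have "((\<lambda>y. ?g y) \<longlongrightarrow> M * \<bar>snd z - t\<bar> + \<bar>fst z - \<eta>\<bar> * sqrt (exp ((2 * L + 1) * \<bar>t\<bar>))) (at z)"
      by (intro tendsto_intros)
    then have lim: "(?g \<longlongrightarrow> 0) (at z)" by (simp add: z)
    have "norm ((case y of (\<eta>, t) \<Rightarrow> \<Phi> \<eta> t) - \<Phi> \<eta> t) \<le> ?g y" for y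
    proof -
      have "\<bar>\<Phi> (fst y) t - \<Phi> \<eta> t\<bar> \<le> \<bar>fst y - \<eta>\<bar> * sqrt (exp ((2 * L + 1) * \<bar>t\<bar>))"
        using real_sqrt_le_mono[OF \<Phi>_lip[of "fst y" t \<eta>]] by (simp add: real_sqrt_mult)
      then show ?thesis using \<Phi>_time[of "fst y" "snd y" t] by (simp add: split_beta)
    qed
    then have "((\<lambda>y. (case y of (\<eta>, t) \<Rightarrow> \<Phi> \<eta> t) - \<Phi> \<eta> t) \<longlongrightarrow> 0) (at z)"
      by (intro Lim_null_comparison[OF _ lim] always_eventually allI)
    then show "isCont (\<lambda>(\<eta>, t). \<Phi> \<eta> t) z"
      unfolding isCont_def using LIM_zero_iff by (fastforce simp: z)
  qed
  define \<rho> where "\<rho> = r / 2"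
  \<comment> \<open>A solution of speed at most \<open>M\<close> that starts within
    \<open>r / 2\<close> moves less than \<open>r / 2\<close> during this time, so it stays in the
    square where \<open>b\<close> and \<open>a\<close> agree. The summand 1 covers
    \<open>M = 0\<close> and gives \<epsilon> < r.\<close>
  define \<epsilon> where "\<epsilon> = r / 2 / (M + 1)"
  have \<rho>: "0 < \<rho>" and \<epsilon>: "0 < \<epsilon>" using r M(1) by (auto simp: \<rho>_def \<epsilon>_def)
  have "M + 1 \<noteq> 0" using M(1) by simp
  from iffD1[OF nonzero_eq_divide_eq[OF this] \<epsilon>_def] have "\<epsilon> * (M + 1) = r / 2" .
  then have "M * \<epsilon> + \<epsilon> = r / 2" by (simp add: distrib_left mult.commute)
  moreover have "0 \<le> M * \<epsilon>" using M(1) \<epsilon> by simp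
  ultimately have \<epsilon>r: "\<epsilon> < r" "M * \<epsilon> < r / 2" using \<epsilon> r(1) by linarith+
  have inr: "\<bar>\<Phi> \<eta> t\<bar> \<le> r" if "\<bar>t\<bar> < \<epsilon>" "\<bar>\<eta>\<bar> < \<rho>" for \<eta> t
  proof -
    have "M * \<bar>t\<bar> \<le> M * \<epsilon>" using that M(1) by (intro mult_left_mono) auto
    then show ?thesis using \<Phi>_time[of \<eta> t 0] that \<epsilon>r by (auto simp: \<Phi>0 \<rho>_def)
  qed
  have b_a: "b t (\<Phi> \<eta> t) = a (t, \<Phi> \<eta> t)" and inT: "(t, \<Phi> \<eta> t) \<in> T" if "\<bar>t\<bar> < \<epsilon>" "\<bar>\<eta>\<bar> < \<rho>" for \<eta> t
  proof -
    have *: "cl t = t" "cl (\<Phi> \<eta> t) = \<Phi> \<eta> t" using inr[OF that] that \<epsilon>r by (auto intro!: cl_id)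
    show "b t (\<Phi> \<eta> t) = a (t, \<Phi> \<eta> t)" by (simp add: b_def *)
    show "(t, \<Phi> \<eta> t) \<in> T" using clT[of t "\<Phi> \<eta> t"] by (simp add: *)
  qed
  \<comment> \<open>The coefficient of the linearised equation along the solution; its
    antiderivative \<open>A\<close> is the logarithm of the derivative in
    \<open>\<eta>\<close>.\<close>
  define c where "c \<eta> t = frechet_derivative a (at (cl t, cl (\<Phi> \<eta> t))) (0, 1)" for \<eta> t
  have c_cont: "continuous_on UNIV (c \<eta>)" for \<eta>
  proof -
    have "continuous_on UNIV (\<lambda>t. \<Phi> \<eta> t)"
      by (intro continuous_at_imp_continuous_on ballI has_vector_derivative_continuous[OF \<Phi>])
    then show ?thesis
      unfolding c_def
      by (intro continuous_on_compose2[OF smooth_on_continuous_on[OF smooth_on_frechet_derivative[OF a]]] continuous_on_Pair cl_cont continuous_on_id)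
        (use clT T(3) in auto)
  qed
  have "\<exists>A. A 0 = 0 \<and> (\<forall>t. (A has_vector_derivative c \<eta> t) (at t))" for \<eta>
    by (rule continuous_antiderivative[OF c_cont])
  then obtain A where A0: "\<And>\<eta>. A \<eta> 0 = 0" and A: "\<And>\<eta> t. (A \<eta> has_vector_derivative c \<eta> t) (at t)"
    by metis
  have A_int: "A \<eta> t = t * integral {0..1} (\<lambda>s. c \<eta> (t * s))" for \<eta> t
  proof -
    have "((\<lambda>s. A \<eta> (t * s)) has_vector_derivative t *\<^sub>R c \<eta> (t * s)) (at s within {0..1})" for s
    proof -
      have "((\<lambda>s. t * s) has_vector_derivative t) (at s)"
        by (auto intro!: derivative_eq_intros simp flip: has_real_derivative_iff_has_vector_derivative)
      from vector_diff_chain_at[OF this A] show ?thesis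
        by (simp add: o_def has_vector_derivative_at_within)
    qed
    from fundamental_theorem_of_calculus[OF zero_le_one this]
    have "integral {0..1} (\<lambda>s. t *\<^sub>R c \<eta> (t * s)) = A \<eta> (t * 1) - A \<eta> (t * 0)" by (rule integral_unique)
    then show ?thesis by (simp add: A0)
  qed
  have \<Phi>_eta: "((\<lambda>\<eta>. \<Phi> \<eta> t) has_derivative (\<lambda>h. h * exp (A \<eta> t))) (at \<eta>)" if t: "\<bar>t\<bar> < \<epsilon>" and \<eta>: "\<bar>\<eta>\<bar> < \<rho>" for \<eta> t
  proof (rule has_derivative_quadratic_remainder[where \<delta> = "\<rho> - \<bar>\<eta>\<bar>"])
    show "bounded_linear (\<lambda>h. h * exp (A \<eta> t))" by (rule bounded_linear_mult_left)
    show "0 < \<rho> - \<bar>\<eta>\<bar>" using \<eta> by simp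
    \<comment> \<open>\<open>K\<close> is the square root of the Gronwall factor including the
      duration; \<open>B\<close> times the square of \<eta>' - \<eta> bounds the Taylor error of
      \<open>a\<close> between the two trajectories.\<close>
    define K where "K = sqrt (\<bar>t\<bar> * exp ((2 * D + 1) * \<bar>t\<bar>))"
    define B where "B = C * exp ((2 * L + 1) * \<bar>t\<bar>)"
    show "norm (\<Phi> \<eta>' t - \<Phi> \<eta> t - (\<eta>' - \<eta>) * exp (A \<eta> t)) \<le> (B * K) * (norm (\<eta>' - \<eta>))\<^sup>2"
      if "norm (\<eta>' - \<eta>) < \<rho> - \<bar>\<eta>\<bar>" for \<eta>'
    proof -
      have \<eta>': "\<bar>\<eta>'\<bar> < \<rho>" using that by simp
      \<comment> \<open>The error of the linear approximation satisfies E' = c E plus a Taylor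
        remainder that is quadratic in \<eta>' - \<eta>; Gronwall makes \<open>E\<close> itself
        quadratic.\<close>
      define E where "E s = \<Phi> \<eta>' s - \<Phi> \<eta> s - (\<eta>' - \<eta>) * exp (A \<eta> s)" for s
      define E' where "E' s = b s (\<Phi> \<eta>' s) - b s (\<Phi> \<eta> s) - (\<eta>' - \<eta>) * (exp (A \<eta> s) * c \<eta> s)" for s
      have dE: "(E has_vector_derivative E' s) (at s)" for s
        unfolding E_def[abs_def] E'_def
        using \<Phi>[of \<eta>' s] \<Phi>[of \<eta> s] A[of \<eta> s] unfolding has_real_derivative_iff_has_vector_derivative[symmetric]
        by (auto intro!: derivative_eq_intros)
      have "norm (E' s) \<le> D * norm (E s) + B * (\<eta>' - \<eta>)\<^sup>2" if s: "\<bar>s\<bar> \<le> \<bar>t\<bar>" for s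
      proof -
        have s': "\<bar>s\<bar> < \<epsilon>" using s t by simp
        let ?y = "(s, \<Phi> \<eta> s)" and ?z = "(s, \<Phi> \<eta>' s)" and ?d = "\<Phi> \<eta>' s - \<Phi> \<eta> s"
        note y = inT[OF s' \<eta>] and z = inT[OF s' \<eta>']
        have cl_y: "c \<eta> s = frechet_derivative a (at ?y) (0, 1)"
          unfolding c_def using inr[OF s' \<eta>] s' \<epsilon>r by (simp add: cl_id)
        have "frechet_derivative a (at ?y) (?z - ?y) = frechet_derivative a (at ?y) (?d *\<^sub>R (0, 1))" by simp
        also have "\<dots> = ?d * c \<eta> s"
          unfolding linear_scale[OF has_derivative_linear[OF Da[OF y]]] cl_y by simp
        finally have eq: "E' s = c \<eta> s * E s + (a ?z - a ?y - frechet_derivative a (at ?y) (?z - ?y))"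
          unfolding E'_def E_def b_a[OF s' \<eta>] b_a[OF s' \<eta>'] by (simp add: algebra_simps)
        have "norm (c \<eta> s) \<le> D * norm ((0, 1) :: real \<times> real)" unfolding cl_y by (rule D(2)[OF y])
        then have cD: "\<bar>c \<eta> s\<bar> \<le> D" by (simp add: norm_Pair)
        have "norm (a ?z - a ?y - frechet_derivative a (at ?y) (?z - ?y)) \<le> C * (norm (?z - ?y))\<^sup>2"
          by (rule C(2)[OF y z])
        also have "\<dots> = C * ?d\<^sup>2" by (simp add: norm_Pair)
        also have "\<dots> \<le> C * ((\<eta>' - \<eta>)\<^sup>2 * exp ((2 * L + 1) * \<bar>s\<bar>))"
          by (rule mult_left_mono[OF \<Phi>_lip C(1)])
        also have "\<dots> \<le> C * ((\<eta>' - \<eta>)\<^sup>2 * exp ((2 * L + 1) * \<bar>t\<bar>))"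
          using s C(1) L(1) by (intro mult_left_mono) auto
        finally have "norm (a ?z - a ?y - frechet_derivative a (at ?y) (?z - ?y)) \<le> B * (\<eta>' - \<eta>)\<^sup>2"
          by (simp add: B_def mult_ac)
        moreover have "norm (c \<eta> s * E s) \<le> D * norm (E s)"
          using cD by (simp add: abs_mult mult_right_mono)
        ultimately show ?thesis unfolding eq by (intro order_trans[OF norm_triangle_ineq add_mono])
      qed
      moreover have "0 \<le> B" using C(1) by (simp add: B_def)
      ultimately have "(norm (E t))\<^sup>2 \<le> ((norm (E 0))\<^sup>2 + (B * (\<eta>' - \<eta>)\<^sup>2)\<^sup>2 * \<bar>t\<bar>) * exp ((2 * D + 1) * \<bar>t\<bar>)"
        using dE D(1) by (intro gronwall_abs[where u' = E']) auto
      moreover have "E 0 = 0" by (simp add: E_def \<Phi>0 A0)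
      ultimately have "(norm (E t))\<^sup>2 \<le> (B * (\<eta>' - \<eta>)\<^sup>2)\<^sup>2 * (\<bar>t\<bar> * exp ((2 * D + 1) * \<bar>t\<bar>))" by (simp add: mult.assoc)
      also have "\<dots> = (B * (\<eta>' - \<eta>)\<^sup>2 * K)\<^sup>2" by (simp add: K_def power_mult_distrib)
      finally have "norm (E t) \<le> B * (\<eta>' - \<eta>)\<^sup>2 * K"
        by (rule power2_le_imp_le) (use \<open>0 \<le> B\<close> in \<open>simp add: K_def\<close>)
      then show ?thesis by (simp add: E_def mult_ac)
    qed
  qed
  define F where "F z = \<Phi> (snd z) (fst z)" for z
  have F: "(F has_derivative (\<lambda>h. fst h * a (t, F (t, \<eta>)) +
      snd h * exp (t * integral {0..1} (\<lambda>s. frechet_derivative a (at (t * s, F (t * s, \<eta>))) (0, 1))))) (at (t, \<eta>))"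
    if t: "\<bar>t\<bar> < \<epsilon>" and \<eta>: "\<bar>\<eta>\<bar> < \<rho>" for t \<eta>
  proof -
    \<comment> \<open>The two partial derivatives combine into a total one because the one in time,
      \<open>b t (\<Phi> \<eta> t)\<close>, is jointly continuous.\<close>
    have "((\<lambda>(\<eta>, t). \<Phi> \<eta> t) has_derivative (\<lambda>(h\<eta>, ht). h\<eta> * exp (A \<eta> t) + blinfun_scaleR_left (b t (\<Phi> \<eta> t)) ht)) (at (\<eta>, t) within UNIV \<times> UNIV)"
    proof (rule has_derivative_partialsI)
      show "((\<lambda>\<eta>. \<Phi> \<eta> t) has_derivative (\<lambda>h. h * exp (A \<eta> t))) (at \<eta> within UNIV)"
        using \<Phi>_eta[OF t \<eta>] by simp
      show "((\<lambda>t. \<Phi> \<eta> t) has_derivative blinfun_apply (blinfun_scaleR_left (b t (\<Phi> \<eta> t)))) (at t within UNIV)" for \<eta> t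
        using \<Phi>[of \<eta> t] by (simp add: has_vector_derivative_def)
      have "continuous_on UNIV (\<lambda>z. blinfun_scaleR_left (b (snd z) (\<Phi> (fst z) (snd z))))"
        using \<Phi>_cont by (intro bounded_linear.continuous_on[OF bounded_linear_blinfun_scaleR_left] b_cont continuous_intros)
          (simp add: case_prod_beta')
      then show "continuous (at (\<eta>, t) within UNIV \<times> UNIV) (\<lambda>(\<eta>, t). blinfun_scaleR_left (b t (\<Phi> \<eta> t)))"
        by (simp add: continuous_on_eq_continuous_at case_prod_beta')
    qed auto
    then have *: "((\<lambda>(\<eta>, t). \<Phi> \<eta> t) has_derivative (\<lambda>h. fst h * exp (A \<eta> t) + snd h * b t (\<Phi> \<eta> t))) (at (\<eta>, t))"
      by (simp add: case_prod_beta')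
    have "((\<lambda>z. (snd z, fst z)) has_derivative (\<lambda>h. (snd h, fst h))) (at (t, \<eta>))"
      by (auto intro!: derivative_eq_intros)
    from has_derivative_compose[OF this, of "\<lambda>(\<eta>, t). \<Phi> \<eta> t" "\<lambda>h. fst h * exp (A \<eta> t) + snd h * b t (\<Phi> \<eta> t)"] *
    have "(F has_derivative (\<lambda>h. snd h * exp (A \<eta> t) + fst h * b t (\<Phi> \<eta> t))) (at (t, \<eta>))"
      by (simp add: F_def[abs_def])
    moreover have "integral {0..1} (\<lambda>s. c \<eta> (t * s)) =
        integral {0..1} (\<lambda>s. frechet_derivative a (at (t * s, F (t * s, \<eta>))) (0, 1))"
    proof (rule integral_cong)
      fix s :: real assume "s \<in> {0..1}"
      then have "\<bar>t\<bar> * \<bar>s\<bar> \<le> \<bar>t\<bar> * 1" by (intro mult_left_mono) auto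
      with t have "\<bar>t * s\<bar> < \<epsilon>" by (simp add: abs_mult)
      then show "c \<eta> (t * s) = frechet_derivative a (at (t * s, F (t * s, \<eta>))) (0, 1)"
        using inr[OF _ \<eta>, of "t * s"] \<epsilon>r by (simp add: c_def F_def cl_id)
    qed
    ultimately show ?thesis
      by (simp add: A_int b_a[OF t \<eta>] F_def add.commute)
  qed
  moreover have "F (0, \<eta>) = \<eta>" for \<eta> by (simp add: F_def \<Phi>0)
  moreover have "(t, F (t, \<eta>)) \<in> S" if "\<bar>t\<bar> < \<epsilon>" "\<bar>\<eta>\<bar> < \<rho>" for t \<eta>
    using subsetD[OF T(3) inT[OF that]] by (simp add: F_def)
  ultimately show ?thesis using \<epsilon> \<rho> by (intro exI[of _ \<epsilon>] exI[of _ \<rho>] exI[of _ F] conjI allI impI) simp_all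
qed

text \<open>The formula for the derivative in \<open>scalar_flow\<close> involves only
  \<open>a\<close>, its derivative and \<open>F\<close>. Hence if \<open>F\<close> is of class
  \<open>n\<close>, its derivative is of class \<open>n\<close>, and \<open>F\<close> is of class
  \<open>n + 1\<close>.\<close>

lemma smooth_scalar_flow:
  fixes a :: "real \<times> real \<Rightarrow> real"
  assumes S: "open S" "(0, 0) \<in> S" and a: "smooth_on S a"
  shows "\<exists>Q F. open Q \<and> (0, 0) \<in> Q \<and> smooth_on Q F \<and> (\<forall>\<eta>. F (0, \<eta>) = \<eta>) \<and>
    (\<forall>z\<in>Q. (fst z, F z) \<in> S \<and> frechet_derivative F (at z) (1, 0) = a (fst z, F z) \<and>
      frechet_derivative F (at z) (0, 1) \<noteq> 0)"
proof -
  obtain \<epsilon> \<rho> :: real and F :: "real \<times> real \<Rightarrow> real" where e: "0 < \<epsilon>" "0 < \<rho>"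
    and F0: "\<And>\<eta>. F (0, \<eta>) = \<eta>"
    and FS: "\<And>t \<eta>. \<bar>t\<bar> < \<epsilon> \<Longrightarrow> \<bar>\<eta>\<bar> < \<rho> \<Longrightarrow> (t, F (t, \<eta>)) \<in> S"
    and dF: "\<And>t \<eta>. \<bar>t\<bar> < \<epsilon> \<Longrightarrow> \<bar>\<eta>\<bar> < \<rho> \<Longrightarrow> (F has_derivative (\<lambda>h. fst h * a (t, F (t, \<eta>)) +
      snd h * exp (t * integral {0..1} (\<lambda>s. frechet_derivative a (at (t * s, F (t * s, \<eta>))) (0, 1))))) (at (t, \<eta>))"
    using scalar_flow[OF assms] by blast
  define Q where "Q = {-\<epsilon><..<\<epsilon>} \<times> {-\<rho><..<\<rho>}"
  have Q: "open Q" "(0, 0) \<in> Q" using e by (auto simp: Q_def open_Times)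
  have QD: "\<bar>fst z\<bar> < \<epsilon>" "\<bar>snd z\<bar> < \<rho>" if "z \<in> Q" for z using that by (auto simp: Q_def)
  define g where "g y = frechet_derivative a (at (fst (fst y) * snd y, F (fst (fst y) * snd y, snd (fst y)))) (0, 1)" for y
  define F' where "F' z h = fst h * a (fst z, F z) + snd h * exp (fst z * integral {0..1} (\<lambda>s. g (z, s)))" for z h
  have dF': "(F has_derivative F' z) (at z)" if "z \<in> Q" for z
    using dF[OF QD[OF that]] by (simp add: F'_def[abs_def] g_def)
  have FS': "(fst z, F z) \<in> S" if "z \<in> Q" for z using FS[OF QD[OF that]] by simp
  \<comment> \<open>An open set on which the integrand is defined. It contains
    \<open>Q \<times> {0..1}\<close> because \<open>Q\<close> is a box, so that shrinking the time
    coordinate does not leave it.\<close>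
  define W where "W = {y :: (real \<times> real) \<times> real. (fst (fst y) * snd y, snd (fst y)) \<in> Q} \<inter> Q \<times> UNIV"
  have W: "open W"
    unfolding W_def using Q(1)
    by (intro open_Int open_Times open_UNIV continuous_open_vimage[unfolded vimage_def]) (auto intro!: continuous_intros)
  have QW: "Q \<times> {0..1::real} \<subseteq> W"
  proof
    fix y assume y: "y \<in> Q \<times> {0..1::real}"
    then have z: "fst y \<in> Q" and s: "0 \<le> snd y" "snd y \<le> 1" by auto
    have "\<bar>fst (fst y)\<bar> * \<bar>snd y\<bar> \<le> \<bar>fst (fst y)\<bar> * 1" using s by (intro mult_left_mono) auto
    then have "\<bar>fst (fst y) * snd y\<bar> < \<epsilon>" using QD(1)[OF z] by (simp add: abs_mult)
    then show "y \<in> W" using QD(2)[OF z] z by (cases y) (auto simp: W_def Q_def abs_less_iff)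
  qed
  have "Ck_on n Q F" for n
  proof (induction n)
    case 0
    show ?case unfolding Ck_on.simps
      by (intro continuous_at_imp_continuous_on ballI has_derivative_continuous[OF dF'])
  next
    case (Suc n)
    have inner: "Ck_on n W (\<lambda>y. (fst (fst y) * snd y, snd (fst y)))"
      by (intro Ck_on_Pair Ck_on_mult Ck_on_fst Ck_on_snd Ck_on_ident W)
    have "Ck_on n W (\<lambda>y. F (fst (fst y) * snd y, snd (fst y)))"
      by (rule Ck_on_compose[OF W Q(1) Suc inner]) (auto simp: W_def)
    with inner have "Ck_on n W (\<lambda>y. (fst (fst y) * snd y, F (fst (fst y) * snd y, snd (fst y))))"
      by (intro Ck_on_Pair Ck_on_mult Ck_on_fst Ck_on_snd Ck_on_ident W)
    then have "Ck_on n W g"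
      unfolding g_def
      by (rule Ck_on_compose[OF W S(1) smooth_on_Ck[OF smooth_on_frechet_derivative[OF a]]])
        (use FS' in \<open>force simp: W_def\<close>)
    then have I: "Ck_on n Q (\<lambda>z. integral {0..1} (\<lambda>s. g (z, s)))"
      by (rule Ck_on_integral_param[OF Q(1) W QW])
    have "Ck_on n Q (\<lambda>z. (fst z, F z))" by (intro Ck_on_Pair Ck_on_fst Ck_on_ident Q(1) Suc)
    then have a': "Ck_on n Q (\<lambda>z. a (fst z, F z))"
      by (rule Ck_on_compose[OF Q(1) S(1) smooth_on_Ck[OF a]]) (use FS' in auto)
    have e': "Ck_on n Q (\<lambda>z. exp (fst z * integral {0..1} (\<lambda>s. g (z, s))))"
      by (rule Ck_on_compose[OF Q(1) open_UNIV Ck_on_exp])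
        (auto intro!: Ck_on_mult Ck_on_fst Ck_on_ident Q(1) I)
    show ?case
    proof (rule Ck_on_SucI[OF Q(1) dF'])
      show "Ck_on n Q (\<lambda>z. F' z h)" for h
        unfolding F'_def by (intro Ck_on_add Ck_on_mult Ck_on_const a' e' Q(1))
    qed
  qed
  then have smooth: "smooth_on Q F" unfolding smooth_on_def by blast
  have "frechet_derivative F (at z) = F' z" if "z \<in> Q" for z
    using frechet_derivative_at[OF dF'[OF that]] by simp
  then have "\<forall>z\<in>Q. (fst z, F z) \<in> S \<and> frechet_derivative F (at z) (1, 0) = a (fst z, F z) \<and>
      frechet_derivative F (at z) (0, 1) \<noteq> 0"
    using FS' by (simp add: F'_def)
  with Q smooth F0 show ?thesis by blast
qed

text \<open>Where the second coefficient is nonzero, the leaves are graphs over the first axis that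
  solve y' = -\<alpha>1 / \<alpha>2. The flow map \<open>H\<close> sends horizontal lines to leaves,
  and the initial value of the leaf through a point is the first integral.\<close>

lemma first_integral_graph:
  fixes \<alpha> :: "real^2 \<Rightarrow> real^2"
  assumes U: "open U" "0 \<in> U" and \<alpha>: "smooth_on U \<alpha>" and nz: "\<alpha> 0 $ 2 \<noteq> 0"
  shows "\<exists>V f. open V \<and> 0 \<in> V \<and> V \<subseteq> U \<and> smooth_on V f \<and>
    (\<forall>q\<in>V. frechet_derivative f (at q) \<noteq> (\<lambda>_. 0) \<and> ker_d f q = {v. \<alpha> q \<bullet> v = 0})"
proof -
  define vec :: "real \<times> real \<Rightarrow> real^2" where "vec z = vector [fst z, snd z]" for z
  have vec_nth: "vec z $ 1 = fst z" "vec z $ 2 = snd z" for z by (simp_all add: vec_def)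
  have vec_smooth: "smooth_on Q vec" if "open Q" for Q
  proof (rule smooth_on_vec[OF that])
    fix i :: 2
    have "smooth_on Q (\<lambda>z. vec z $ 1)" "smooth_on Q (\<lambda>z. vec z $ 2)"
      unfolding vec_nth
      by (rule smooth_on_bounded_linear[OF bounded_linear_fst that smooth_on_ident[OF that]],
        rule smooth_on_bounded_linear[OF bounded_linear_snd that smooth_on_ident[OF that]])
    then show "smooth_on Q (\<lambda>z. vec z $ i)" using exhaust_2[of i] by auto
  qed
  have a_smooth: "smooth_on U (\<lambda>q. \<alpha> q $ i)" for i by (rule smooth_on_vec_nth[OF U(1) \<alpha>])
  define U' where "U' = U \<inter> (\<lambda>q. \<alpha> q $ 2) -` (- {0})"
  have U': "open U'" "0 \<in> U'" "U' \<subseteq> U"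
    unfolding U'_def
    using continuous_open_preimage[OF smooth_on_continuous_on[OF a_smooth] U(1), of "- {0}"] U(2) nz
    by (auto simp: open_Compl)
  define S where "S = vec -` U'"
  have vec_cont: "continuous_on UNIV vec" by (rule smooth_on_continuous_on[OF vec_smooth[OF open_UNIV]])
  have S: "open S" unfolding S_def
    by (rule continuous_open_vimage[OF U'(1)], rule continuous_on_interior[OF vec_cont]) simp
  have "vec (0, 0) = 0" by (simp add: vec_eq_iff forall_2 vec_nth)
  then have S0: "(0, 0) \<in> S" using U'(2) by (simp add: S_def)
  define a where "a z = - \<alpha> (vec z) $ 1 / \<alpha> (vec z) $ 2" for z
  have comp: "smooth_on S (\<lambda>z. \<alpha> (vec z) $ i)" for i
    by (rule smooth_on_compose[OF S U'(1) smooth_on_subset[OF a_smooth U'(3)] vec_smooth[OF S]]) (auto simp: S_def)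
  have a: "smooth_on S a"
    unfolding a_def by (intro smooth_on_divide smooth_on_minus S comp) (auto simp: S_def U'_def)
  obtain Q F where Q: "open Q" "(0, 0) \<in> Q" and F: "smooth_on Q F" "\<And>\<eta>. F (0, \<eta>) = \<eta>"
    "\<And>z. z \<in> Q \<Longrightarrow> (fst z, F z) \<in> S"
    "\<And>z. z \<in> Q \<Longrightarrow> frechet_derivative F (at z) (1, 0) = a (fst z, F z)"
    "\<And>z. z \<in> Q \<Longrightarrow> frechet_derivative F (at z) (0, 1) \<noteq> 0"
    using smooth_scalar_flow[OF S S0 a] by blast
  define pr :: "real^2 \<Rightarrow> real \<times> real" where "pr v = (v $ 1, v $ 2)" for v
  have pr_lin: "bounded_linear pr"
    unfolding pr_def by (intro bounded_linear_Pair bounded_linear_vec_nth)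
  define P where "P = pr -` Q"
  have P: "open P" unfolding P_def
    by (rule continuous_open_vimage[OF Q(1) linear_continuous_at[OF pr_lin]])
  have P0: "0 \<in> P" using Q(2) by (simp add: P_def pr_def)
  define H where "H v = vec (v $ 1, F (pr v))" for v
  have pr_smooth: "smooth_on P pr" by (rule smooth_on_bounded_linear[OF pr_lin P smooth_on_ident[OF P]])
  have Fpr: "smooth_on P (\<lambda>v. F (pr v))"
    by (rule smooth_on_compose[OF P Q(1) F(1) pr_smooth]) (auto simp: P_def)
  have H: "smooth_on P H"
    unfolding H_def
    by (rule smooth_on_compose[OF P open_UNIV vec_smooth[OF open_UNIV]])
      (auto intro!: smooth_on_Pair smooth_on_vec_nth smooth_on_ident P Fpr)
  have dH: "frechet_derivative H (at v) h = vec (h $ 1, frechet_derivative F (at (pr v)) (pr h))" if "v \<in> P" for v h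
  proof -
    have vl: "bounded_linear vec"
      unfolding linear_conv_bounded_linear[symmetric]
      by (rule linearI) (simp_all add: vec_eq_iff forall_2 vec_nth)
    have "((\<lambda>v. F (pr v)) has_derivative (\<lambda>h. frechet_derivative F (at (pr v)) (pr h))) (at v)"
      by (rule has_derivative_compose[OF bounded_linear.has_derivative[OF pr_lin has_derivative_ident]
            smooth_on_has_derivative[OF F(1)]]) (use that in \<open>simp add: P_def\<close>)
    from bounded_linear.has_derivative[OF vl has_derivative_Pair[OF bounded_linear.has_derivative[OF bounded_linear_vec_nth has_derivative_ident] this]]
    have "(H has_derivative (\<lambda>h. vec (h $ 1, frechet_derivative F (at (pr v)) (pr h)))) (at v)"
      unfolding H_def .
    from fun_cong[OF frechet_derivative_at[OF this], of h] show ?thesis by simp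
  qed
  have pr_axis: "pr (axis 1 1) = (1, 0)" "pr (axis 2 1) = (0, 1)" by (simp_all add: pr_def axis_def)
  have prQ: "pr v \<in> Q" and fst_pr: "fst (pr v) = v $ 1" if "v \<in> P" for v
    using that by (simp_all add: P_def pr_def)
  have dH1: "frechet_derivative H (at v) (axis 1 1) = vec (1, a (v $ 1, F (pr v)))" if "v \<in> P" for v
    unfolding dH[OF that] pr_axis F(4)[OF prQ[OF that]] fst_pr[OF that] by (simp add: axis_def)
  have dH2: "frechet_derivative H (at v) (axis 2 1) = vec (0, frechet_derivative F (at (pr v)) (0, 1))" if "v \<in> P" for v
    unfolding dH[OF that] pr_axis by (simp add: axis_def)
  have dH2_nz: "frechet_derivative F (at (pr v)) (0, 1) \<noteq> 0" if "v \<in> P" for v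
    by (rule F(5)[OF prQ[OF that]])
  have "inj (frechet_derivative H (at 0))"
  proof -
    have lin: "linear (frechet_derivative H (at 0))"
      by (rule has_derivative_linear[OF smooth_on_has_derivative[OF H P0]])
    have "v = 0" if "frechet_derivative H (at 0) v = 0" for v
    proof -
      note eq = that[unfolded linear_vec2[OF lin, of v] dH1[OF P0] dH2[OF P0]]
      have v1: "v $ 1 = 0" using arg_cong[OF eq, of "\<lambda>u. u $ 1"] by (simp add: vec_nth)
      then have "v $ 2 * frechet_derivative F (at (pr 0)) (0, 1) = 0"
        using arg_cong[OF eq, of "\<lambda>u. u $ 2"] by (simp add: vec_nth)
      then have "v $ 2 = 0" using dH2_nz[OF P0] by simp
      with v1 show ?thesis by (simp add: vec_eq_iff forall_2)
    qed
    then show ?thesis using linear_injective_0[OF lin] by blast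
  qed
  from smooth_local_inverse[OF P P0 H this]
  obtain P' where P': "0 \<in> P'" "P' \<subseteq> P" "chart P' H" by blast
  define V where "V = H ` P'"
  define G where "G = the_inv_into P' H"
  have V: "open V" "smooth_on V G" "inj_on H P'" "open P'" using P'(3) by (auto simp: chart_def V_def G_def)
  have GH: "G (H v) = v" if "v \<in> P'" for v using the_inv_into_f_f[OF V(3) that] by (simp add: G_def)
  have H0: "H 0 = 0" using F(2)[of 0] by (simp add: H_def pr_def vec_eq_iff forall_2 vec_nth)
  \<comment> \<open>The second coordinate of the inverse flow map is the initial value
    \<open>\<eta>\<close>: it is constant along each leaf and has derivative 1 across, which also
    shows that \<open>f\<close> is a submersion.\<close>
  define f where "f q = G q $ 2" for q
  have f: "smooth_on V f" unfolding f_def by (rule smooth_on_vec_nth[OF V(1,2)])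
  have fH: "frechet_derivative f (at (H v)) (frechet_derivative H (at v) h) = h $ 2" if "v \<in> P'" for v h
  proof -
    have "((\<lambda>v. f (H v)) has_derivative (\<lambda>h. frechet_derivative f (at (H v)) (frechet_derivative H (at v) h))) (at v)"
      by (rule has_derivative_compose[OF smooth_on_has_derivative[OF H] smooth_on_has_derivative[OF f]])
        (use that P' in \<open>auto simp: V_def\<close>)
    moreover have "((\<lambda>v. f (H v)) has_derivative (\<lambda>h. h $ 2)) (at v)"
      by (rule has_derivative_transform_within_open[OF bounded_linear.has_derivative[OF bounded_linear_vec_nth has_derivative_ident] V(4) that])
        (simp add: f_def GH)
    ultimately show ?thesis by (rule fun_cong[OF has_derivative_unique])
  qed
  have lin_f: "linear (frechet_derivative f (at q))" if "q \<in> V" for q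
    by (rule has_derivative_linear[OF smooth_on_has_derivative[OF f that]])
  have HU: "H v \<in> U'" if "v \<in> P" for v
    using F(3)[OF prQ[OF that]] unfolding S_def H_def fst_pr[OF that] by simp
  have key: "frechet_derivative f (at q) \<noteq> (\<lambda>_. 0) \<and> ker_d f q = {v. \<alpha> q \<bullet> v = 0}" if "q \<in> V" for q
  proof -
    obtain v where v: "v \<in> P'" "q = H v" using \<open>q \<in> V\<close> by (auto simp: V_def)
    then have vP: "v \<in> P" using P' by auto
    define w where "w = a (v $ 1, F (pr v))"
    define d where "d = frechet_derivative F (at (pr v)) (0, 1)"
    have d: "d \<noteq> 0" using dH2_nz[OF vP] by (simp add: d_def)
    have f1: "frechet_derivative f (at q) (vec (1, w)) = 0"
      using fH[OF v(1), of "axis 1 1"] unfolding v(2) dH1[OF vP] w_def by (simp add: axis_def)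
    have f2: "frechet_derivative f (at q) (vec (0, d)) = 1"
      using fH[OF v(1), of "axis 2 1"] unfolding v(2) dH2[OF vP] d_def by (simp add: axis_def)
    have "H v \<in> U'" by (rule HU[OF vP])
    then have a2: "\<alpha> q $ 2 \<noteq> 0" by (simp add: U'_def v(2))
    have wq: "w = - \<alpha> q $ 1 / \<alpha> q $ 2" by (simp add: w_def a_def v(2) H_def)
    have "u = (u $ 1) *\<^sub>R vec (1, w) + ((u $ 2 - w * u $ 1) / d) *\<^sub>R vec (0, d)" for u
      using d by (simp add: vec_eq_iff forall_2 vec_nth)
    then have du: "frechet_derivative f (at q) u = (u $ 2 - w * u $ 1) / d" for u
      using linear_add[OF lin_f[OF that], of "(u $ 1) *\<^sub>R vec (1, w)" "((u $ 2 - w * u $ 1) / d) *\<^sub>R vec (0, d)"]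
      by (simp add: linear_scale[OF lin_f[OF that]] f1 f2)
    have "frechet_derivative f (at q) u * (d * \<alpha> q $ 2) = \<alpha> q \<bullet> u" for u
    proof -
      have "w * \<alpha> q $ 2 = - \<alpha> q $ 1" using a2 by (simp add: wq)
      then have "(u $ 2 - w * u $ 1) * \<alpha> q $ 2 = \<alpha> q \<bullet> u"
        unfolding inner_vec_def sum_2 inner_real_def by algebra
      with du[of u] d show ?thesis by simp
    qed
    then have "frechet_derivative f (at q) u = 0 \<longleftrightarrow> \<alpha> q \<bullet> u = 0" for u
      using d a2 by (metis mult_eq_0_iff)
    then have "ker_d f q = {v. \<alpha> q \<bullet> v = 0}"
      unfolding ker_d_def by blast
    moreover have "frechet_derivative f (at q) \<noteq> (\<lambda>_. 0)" using f2 by auto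
    ultimately show ?thesis by blast
  qed
  have "V \<subseteq> U"
    unfolding V_def using subsetD[OF U'(3) HU[OF subsetD[OF P'(2)]]] by (rule image_subsetI)
  moreover have "0 \<in> V" using imageI[OF P'(1), of H] by (simp add: V_def H0)
  ultimately show ?thesis using V(1) f key by blast
qed

text \<open>Reduction to \<open>first_integral_graph\<close> by moving \<open>p\<close> to the
  origin and, if the second coefficient vanishes there, exchanging the coordinates.\<close>

lemma first_integral:
  fixes \<alpha> :: "real^2 \<Rightarrow> real^2"
  assumes U: "open U" "p \<in> U" and \<alpha>: "smooth_on U \<alpha>" and nz: "\<alpha> p \<noteq> 0"
  shows "\<exists>V f. open V \<and> p \<in> V \<and> V \<subseteq> U \<and> smooth_on V f \<and>
    (\<forall>q\<in>V. frechet_derivative f (at q) \<noteq> (\<lambda>_. 0) \<and> ker_d f q = {v. \<alpha> q \<bullet> v = 0})"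
proof -
  define swap :: "real^2 \<Rightarrow> real^2" where "swap v = vector [v $ 2, v $ 1]" for v
  have "linear swap" by (rule linearI) (simp_all add: swap_def vec_eq_iff forall_2)
  then have "bounded_linear swap" by (simp add: linear_conv_bounded_linear)
  moreover have "swap (swap v) = v" "swap u \<bullet> swap v = u \<bullet> v" for u v
    by (simp_all add: swap_def vec_eq_iff forall_2 inner_vec_def sum_2)
  moreover have "\<alpha> p $ 2 \<noteq> 0 \<or> swap (\<alpha> p) $ 2 \<noteq> 0"
    using nz by (auto simp: vec_eq_iff forall_2 swap_def)
  moreover have "bounded_linear (id :: real^2 \<Rightarrow> real^2)" using bounded_linear_ident by (simp add: id_def)
  \<comment> \<open>Either the identity or \<open>swap\<close>. Both are orthogonal involutions, so
    one map serves as its own inverse and carries kernels of forms to kernels.\<close>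
  ultimately obtain \<sigma> :: "real^2 \<Rightarrow> real^2" where \<sigma>: "bounded_linear \<sigma>" "\<And>v. \<sigma> (\<sigma> v) = v"
    "\<And>u v. \<sigma> u \<bullet> \<sigma> v = u \<bullet> v" "\<sigma> (\<alpha> p) $ 2 \<noteq> 0"
    by (metis id_apply)
  define m where "m q = p + \<sigma> q" for q
  define k where "k q = \<sigma> (q - p)" for q
  have km: "k (m q) = q" "m (k q) = q" for q by (simp_all add: k_def m_def \<sigma>(2))
  have m0: "m 0 = p" using linear_0[OF bounded_linear.linear[OF \<sigma>(1)]] by (simp add: m_def)
  have m_smooth: "smooth_on S m" if "open S" for S
    unfolding m_def by (intro smooth_on_add smooth_on_const smooth_on_bounded_linear[OF \<sigma>(1)] smooth_on_ident that)
  have k_smooth: "smooth_on S k" if "open S" for S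
    unfolding k_def by (intro smooth_on_diff smooth_on_const smooth_on_bounded_linear[OF \<sigma>(1)] smooth_on_ident that)
  have preim: "open (g -` S)" if "open S" "smooth_on UNIV g" for g :: "real^2 \<Rightarrow> real^2" and S
    by (rule continuous_open_vimage[OF that(1), of g], rule continuous_on_interior[OF smooth_on_continuous_on[OF that(2)]]) simp
  let ?U = "m -` U" and ?\<alpha> = "\<lambda>q. \<sigma> (\<alpha> (m q))"
  have oU: "open ?U" by (rule preim[OF U(1) m_smooth[OF open_UNIV]])
  have "smooth_on ?U ?\<alpha>"
    by (intro smooth_on_bounded_linear[OF \<sigma>(1)] smooth_on_compose[OF oU U(1) \<alpha> m_smooth[OF oU]] oU) auto
  from first_integral_graph[OF oU _ this]
  obtain V f where V: "open V" "0 \<in> V" "V \<subseteq> ?U" "smooth_on V f"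
    "\<And>q. q \<in> V \<Longrightarrow> frechet_derivative f (at q) \<noteq> (\<lambda>_. 0) \<and> ker_d f q = {v. ?\<alpha> q \<bullet> v = 0}"
    using U(2) \<sigma>(4) m0 by auto
  define V' where "V' = k -` V"
  define f' where "f' q = f (k q)" for q
  have V': "open V'" unfolding V'_def by (rule preim[OF V(1) k_smooth[OF open_UNIV]])
  have "k p = 0" using km(1)[of 0] m0 by simp
  then have "p \<in> V'" using V(2) by (simp add: V'_def)
  moreover have "V' \<subseteq> U" using V(3) km(2) by (force simp: V'_def)
  moreover have f': "smooth_on V' f'"
    unfolding f'_def by (rule smooth_on_compose[OF V' V(1,4) k_smooth[OF V']]) (auto simp: V'_def)
  moreover have "frechet_derivative f' (at q) \<noteq> (\<lambda>_. 0) \<and> ker_d f' q = {v. \<alpha> q \<bullet> v = 0}" if "q \<in> V'" for q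
  proof -
    have kq: "k q \<in> V" using that by (simp add: V'_def)
    have "(k has_derivative \<sigma>) (at q)"
      unfolding k_def
      using bounded_linear.has_derivative[OF \<sigma>(1) has_derivative_diff[OF has_derivative_ident has_derivative_const]] by simp
    from has_derivative_compose[OF this smooth_on_has_derivative[OF V(4) kq]]
    have "(f' has_derivative (\<lambda>v. frechet_derivative f (at (k q)) (\<sigma> v))) (at q)"
      unfolding f'_def .
    from fun_cong[OF frechet_derivative_at[OF this]]
    have df': "frechet_derivative f' (at q) v = frechet_derivative f (at (k q)) (\<sigma> v)" for v by simp
    have ker: "ker_d f (k q) = {v. \<sigma> (\<alpha> q) \<bullet> v = 0}"
      using V(5)[OF kq] by (simp only: km(2))
    have "v \<in> ker_d f' q \<longleftrightarrow> \<sigma> v \<in> ker_d f (k q)" for v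
      by (simp add: ker_d_def df')
    then have "ker_d f' q = {v. \<alpha> q \<bullet> v = 0}"
      unfolding ker mem_Collect_eq \<sigma>(3) by (intro set_eqI) (simp only: mem_Collect_eq)
    moreover have "frechet_derivative f' (at q) \<noteq> (\<lambda>_. 0)"
    proof
      assume "frechet_derivative f' (at q) = (\<lambda>_. 0)"
      then have "frechet_derivative f' (at q) (\<sigma> u) = 0" for u by simp
      then have "frechet_derivative f (at (k q)) u = 0" for u by (simp only: df' \<sigma>(2))
      then have "frechet_derivative f (at (k q)) = (\<lambda>_. 0)" by (intro ext)
      then show False using V(5)[OF kq] by blast
    qed
    ultimately show ?thesis by blast
  qed
  ultimately show ?thesis using V' by blast
qed

subsection \<open>Connections and Christoffel symbols\<close>

text \<open>In finite dimension an operator is a fixed linear expression in its values on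
  \<open>Basis\<close>, so smoothness of these values gives smoothness in the operator norm.\<close>

lemma smooth_on_blinfun:
  fixes T :: "'x::euclidean_space \<Rightarrow> 'a::euclidean_space \<Rightarrow>\<^sub>L 'c::real_normed_vector"
  assumes "open S" "\<And>u. smooth_on S (\<lambda>x. T x u)"
  shows "smooth_on S T"
proof (rule smooth_on_cong[OF assms(1)])
  show "(\<Sum>i\<in>Basis. blinfun_scaleR_left (T x i) o\<^sub>L blinfun_inner_left i) = T x" for x
  proof (rule blinfun_eqI)
    fix u
    have "T x u = T x (\<Sum>i\<in>Basis. (u \<bullet> i) *\<^sub>R i)" by (simp only: euclidean_representation)
    also have "\<dots> = (\<Sum>i\<in>Basis. (u \<bullet> i) *\<^sub>R T x i)" by (simp only: blinfun.sum_right blinfun.scaleR_right)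
    finally show "(\<Sum>i\<in>Basis. blinfun_scaleR_left (T x i) o\<^sub>L blinfun_inner_left i) u = T x u"
      by (simp add: blinfun.sum_left)
  qed
  have bl: "bounded_linear (\<lambda>c::'c. blinfun_scaleR_left c o\<^sub>L blinfun_inner_left i)" for i :: 'a
    by (rule bounded_linear_compose[OF bounded_bilinear.bounded_linear_left[OF bounded_bilinear_blinfun_compose] bounded_linear_blinfun_scaleR_left])
  show "smooth_on S (\<lambda>x. \<Sum>i\<in>Basis. blinfun_scaleR_left (T x i) o\<^sub>L blinfun_inner_left i)"
    by (rule smooth_on_sum[OF assms(1)], rule smooth_on_bounded_linear[OF bl assms])
qed

lemma smooth_on_blinfun_apply:
  "open S \<Longrightarrow> smooth_on S T \<Longrightarrow> smooth_on S f \<Longrightarrow> smooth_on S (\<lambda>x. blinfun_apply (T x) (f x))"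
  by (simp add: smooth_on_def Ck_on_bilinear[OF bounded_bilinear_blinfun_apply])

lemma has_derivative_blinfun_apply:
  assumes "(T has_derivative T') (at x)" "(f has_derivative f') (at x)"
  shows "((\<lambda>x. blinfun_apply (T x) (f x)) has_derivative (\<lambda>h. T x (f' h) + T' h (f x))) (at x)"
  using bounded_bilinear.FDERIV[OF bounded_bilinear_blinfun_apply assms] .

abbreviation e1 :: "real^2" where "e1 \<equiv> axis 1 1"
abbreviation e2 :: "real^2" where "e2 \<equiv> axis 2 1"

lemma e_nth [simp]: "e1 $ 1 = 1" "e1 $ 2 = 0" "e2 $ 1 = 0" "e2 $ 2 = 1"
  by (simp_all add: axis_def)

lemma vec2_expand: "(v :: real^2) = v $ 1 *\<^sub>R e1 + v $ 2 *\<^sub>R e2"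
  by (simp add: vec_eq_iff forall_2)

lemma blinfun_vec2: "blinfun_apply f v = v $ 1 *\<^sub>R f e1 + v $ 2 *\<^sub>R f e2"
  by (rule linear_vec2) (simp add: blinfun.bounded_linear_right bounded_linear.linear)

type_synonym christoffel = "real^2 \<Rightarrow> (real^2) \<Rightarrow>\<^sub>L ((real^2) \<Rightarrow>\<^sub>L (real^2))"

text \<open>The global frame of the plane makes a connection the flat derivative plus a tensor
  \<open>C\<close>. The value \<open>undefined\<close> matches the last clause of
  \<open>linear_connection\<close>, so that equality with a given connection is equality of
  functions.\<close>

definition conn_of :: "christoffel \<Rightarrow> connection" where
  "conn_of C X Y = (if smooth_on UNIV X \<and> smooth_on UNIV Y
     then (\<lambda>p. frechet_derivative Y (at p) (X p) + C p (X p) (Y p)) else undefined)"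

lemma conn_of_smooth:
  assumes "smooth_on UNIV C" "smooth_on UNIV X" "smooth_on UNIV Y"
  shows "smooth_on UNIV (conn_of C X Y)"
proof -
  have "smooth_on UNIV (\<lambda>p. frechet_derivative Y (at p) (X p) + C p (X p) (Y p))"
    by (intro smooth_on_add smooth_on_frechet_derivative_field smooth_on_blinfun_apply open_UNIV assms)
  then show ?thesis using assms by (simp add: conn_of_def)
qed

lemma frechet_derivative_add_smooth:
  assumes "smooth_on UNIV f" "smooth_on UNIV g"
  shows "frechet_derivative (\<lambda>q. f q + g q) (at p) v = frechet_derivative f (at p) v + frechet_derivative g (at p) v"
  using fun_cong[OF frechet_derivative_at[OF has_derivative_add[OF smooth_on_has_derivative[OF assms(1)] smooth_on_has_derivative[OF assms(2)]]], of p v]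
  by simp

lemma frechet_derivative_scaleR_smooth:
  assumes "smooth_on UNIV f" "smooth_on UNIV g"
  shows "frechet_derivative (\<lambda>q. f q *\<^sub>R g q) (at p) v = f p *\<^sub>R frechet_derivative g (at p) v + frechet_derivative f (at p) v *\<^sub>R g p"
  using fun_cong[OF frechet_derivative_at[OF has_derivative_scaleR[OF smooth_on_has_derivative[OF assms(1)] smooth_on_has_derivative[OF assms(2)]]], of p v]
  by simp

lemma frechet_derivative_vec_nth:
  fixes f :: "'a::euclidean_space \<Rightarrow> real^'n"
  assumes "f differentiable at x"
  shows "frechet_derivative (\<lambda>x. f x $ i) (at x) u = frechet_derivative f (at x) u $ i"
  using fun_cong[OF frechet_derivative_at[OF bounded_linear.has_derivative[OF bounded_linear_vec_nth
        assms[unfolded frechet_derivative_works]]], of u] by simp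

lemma linear_connection_conn_of:
  assumes C: "smooth_on UNIV C"
  shows "linear_connection (conn_of C)"
  unfolding linear_connection_def
proof (intro conjI allI impI)
  fix X X' Y Y' :: vector_field and f :: "real^2 \<Rightarrow> real"
  assume X: "smooth_on UNIV X" and Y: "smooth_on UNIV Y"
  show "smooth_on UNIV (conn_of C X Y)" by (rule conn_of_smooth[OF C X Y])
  note lin = has_derivative_linear[OF smooth_on_has_derivative[OF Y UNIV_I]]
  show "conn_of C (\<lambda>p. X p + X' p) Y = (\<lambda>p. conn_of C X Y p + conn_of C X' Y p)" if "smooth_on UNIV X'"
    using smooth_on_add[OF open_UNIV X that] X Y that
    by (simp add: conn_of_def fun_eq_iff blinfun.bilinear_simps linear_add[OF lin])
  show "conn_of C (\<lambda>p. f p *\<^sub>R X p) Y = (\<lambda>p. f p *\<^sub>R conn_of C X Y p)" if "smooth_on UNIV f"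
    using smooth_on_scaleR[OF open_UNIV that X] X Y
    by (simp add: conn_of_def fun_eq_iff blinfun.bilinear_simps linear_scale[OF lin] scaleR_add_right)
  show "conn_of C X (\<lambda>p. Y p + Y' p) = (\<lambda>p. conn_of C X Y p + conn_of C X Y' p)" if "smooth_on UNIV Y'"
    using smooth_on_add[OF open_UNIV Y that] X Y that
    by (simp add: conn_of_def fun_eq_iff blinfun.bilinear_simps frechet_derivative_add_smooth)
  show "conn_of C X (\<lambda>p. f p *\<^sub>R Y p) = (\<lambda>p. frechet_derivative f (at p) (X p) *\<^sub>R Y p + f p *\<^sub>R conn_of C X Y p)"
    if "smooth_on UNIV f"
    using smooth_on_scaleR[OF open_UNIV that Y] X Y that
    by (simp add: conn_of_def fun_eq_iff blinfun.bilinear_simps frechet_derivative_scaleR_smooth scaleR_add_right)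
next
  fix X Y :: vector_field assume "\<not> (smooth_on UNIV X \<and> smooth_on UNIV Y)"
  then show "conn_of C X Y = undefined" by (simp only: conn_of_def if_False)
qed

lemma bounded_linear_vec2I: "linear (f :: real^2 \<Rightarrow> 'b::real_normed_vector) \<Longrightarrow> bounded_linear f"
  by (simp add: linear_conv_bounded_linear)

text \<open>Every field is a combination of the constant fields \<open>e1\<close> and
  \<open>e2\<close> with smooth coefficients. Linearity in the first argument and the Leibniz rule
  in the second reduce \<open>D\<close> to its values \<open>c\<close> on constant fields.\<close>

lemma linear_connection_imp_conn_of:
  assumes D: "linear_connection D"
  shows "\<exists>C. smooth_on UNIV C \<and> D = conn_of C"
proof -
  have Dsm: "smooth_on UNIV (D X Y)" if "smooth_on UNIV X" "smooth_on UNIV Y" for X Y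
    using D that unfolding linear_connection_def by blast
  have Dadd1: "D (\<lambda>p. X p + X' p) Y = (\<lambda>p. D X Y p + D X' Y p)"
    if "smooth_on UNIV X" "smooth_on UNIV X'" "smooth_on UNIV Y" for X X' Y
    using D that unfolding linear_connection_def by blast
  have Dsc1: "D (\<lambda>p. f p *\<^sub>R X p) Y = (\<lambda>p. f p *\<^sub>R D X Y p)"
    if "smooth_on UNIV f" "smooth_on UNIV X" "smooth_on UNIV Y" for f X Y
    using D that unfolding linear_connection_def by blast
  have Dadd2: "D X (\<lambda>p. Y p + Y' p) = (\<lambda>p. D X Y p + D X Y' p)"
    if "smooth_on UNIV X" "smooth_on UNIV Y" "smooth_on UNIV Y'" for X Y Y'
    using D that unfolding linear_connection_def by blast
  have Dsc2: "D X (\<lambda>p. f p *\<^sub>R Y p) = (\<lambda>p. frechet_derivative f (at p) (X p) *\<^sub>R Y p + f p *\<^sub>R D X Y p)"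
    if "smooth_on UNIV f" "smooth_on UNIV X" "smooth_on UNIV Y" for f X Y
    using D that unfolding linear_connection_def by blast
  have Dund: "D X Y = undefined" if "\<not> (smooth_on UNIV X \<and> smooth_on UNIV Y)" for X Y
    using D that unfolding linear_connection_def by blast
  define c where "c p u v = D (\<lambda>_. u) (\<lambda>_. v) p" for p u v
  note const = smooth_on_const[of UNIV]
  have lin1: "linear (\<lambda>u. c p u v)" for p v
  proof (rule linearI)
    show "c p (u + u') v = c p u v + c p u' v" for u u'
      using Dadd1[OF const const const, of u u' v] by (simp add: c_def)
    show "c p (r *\<^sub>R u) v = r *\<^sub>R c p u v" for r u
      using Dsc1[OF const const const, of r u v] by (simp add: c_def)
  qed
  have lin2: "linear (c p u)" for p u
  proof (rule linearI)
    show "c p u (v + v') = c p u v + c p u v'" for v v'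
      using Dadd2[OF const const const, of u v v'] by (simp add: c_def)
    show "c p u (r *\<^sub>R v) = r *\<^sub>R c p u v" for r v
      using Dsc2[OF const const const, of u r v] by (simp add: c_def)
  qed
  define C where "C p = Blinfun (\<lambda>u. Blinfun (c p u))" for p
  have Cin: "blinfun_apply (Blinfun (c p u)) v = c p u v" for p u v
    by (rule fun_cong[OF bounded_linear_Blinfun_apply[OF bounded_linear_vec2I[OF lin2]]])
  have "linear (\<lambda>u. Blinfun (c p u))" for p
    by (rule linearI; rule blinfun_eqI)
      (simp_all add: Cin blinfun.bilinear_simps linear_add[OF lin1] linear_scale[OF lin1])
  from fun_cong[OF bounded_linear_Blinfun_apply[OF bounded_linear_vec2I[OF this]]]
  have C: "C p u v = c p u v" for p u v by (simp add: C_def Cin)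
  have "smooth_on UNIV (\<lambda>p. C p u v)" for u v
    unfolding C c_def by (rule Dsm[OF const const])
  then have smC: "smooth_on UNIV C" by (intro smooth_on_blinfun open_UNIV)
  have D1: "D (\<lambda>_. u) Y p = frechet_derivative Y (at p) u + C p u (Y p)" if Y: "smooth_on UNIV Y" for u Y p
  proof -
    have Yi: "smooth_on UNIV (\<lambda>p. Y p $ i)" for i by (rule smooth_on_vec_nth[OF open_UNIV Y])
    have "D (\<lambda>_. u) Y = D (\<lambda>_. u) (\<lambda>p. (Y p $ 1) *\<^sub>R e1 + (Y p $ 2) *\<^sub>R e2)"
      by (rule arg_cong[of _ _ "D (\<lambda>_. u)"], rule ext, rule vec2_expand)
    also have "\<dots> = (\<lambda>p. (frechet_derivative (\<lambda>p. Y p $ 1) (at p) u *\<^sub>R e1 + (Y p $ 1) *\<^sub>R c p u e1) +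
        (frechet_derivative (\<lambda>p. Y p $ 2) (at p) u *\<^sub>R e2 + (Y p $ 2) *\<^sub>R c p u e2))"
      by (simp add: Dadd2[OF const smooth_on_scaleR[OF open_UNIV Yi const] smooth_on_scaleR[OF open_UNIV Yi const]]
          Dsc2[OF Yi const const] c_def)
    finally have "D (\<lambda>_. u) Y p = (frechet_derivative (\<lambda>p. Y p $ 1) (at p) u *\<^sub>R e1 + frechet_derivative (\<lambda>p. Y p $ 2) (at p) u *\<^sub>R e2)
      + ((Y p $ 1) *\<^sub>R c p u e1 + (Y p $ 2) *\<^sub>R c p u e2)" by (simp add: algebra_simps)
    moreover have "frechet_derivative (\<lambda>p. Y p $ i) (at p) u = frechet_derivative Y (at p) u $ i" for i
      by (rule frechet_derivative_vec_nth[OF smooth_on_differentiable[OF Y UNIV_I]])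
    ultimately show ?thesis
      using vec2_expand[of "frechet_derivative Y (at p) u"] blinfun_vec2[of "C p u" "Y p"] by (simp add: C)
  qed
  have "D X Y = conn_of C X Y" for X Y :: vector_field
  proof (cases "smooth_on UNIV X \<and> smooth_on UNIV Y")
    case True
    then have X: "smooth_on UNIV X" and Y: "smooth_on UNIV Y" by blast+
    have Xi: "smooth_on UNIV (\<lambda>p. X p $ i)" for i by (rule smooth_on_vec_nth[OF open_UNIV X])
    have "D X Y = D (\<lambda>p. (X p $ 1) *\<^sub>R e1 + (X p $ 2) *\<^sub>R e2) Y"
      by (rule arg_cong[of _ _ "\<lambda>X. D X Y"], rule ext, rule vec2_expand)
    also have "\<dots> = (\<lambda>p. (X p $ 1) *\<^sub>R D (\<lambda>_. e1) Y p + (X p $ 2) *\<^sub>R D (\<lambda>_. e2) Y p)"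
      by (simp add: Dadd1[OF smooth_on_scaleR[OF open_UNIV Xi const] smooth_on_scaleR[OF open_UNIV Xi const] Y]
          Dsc1[OF Xi const Y])
    also have "\<dots> = conn_of C X Y"
    proof (rule ext)
      fix p
      have "C p (X p) (Y p) = (X p $ 1) *\<^sub>R C p e1 (Y p) + (X p $ 2) *\<^sub>R C p e2 (Y p)"
        using arg_cong[OF blinfun_vec2[of "C p" "X p"], of "\<lambda>b. b (Y p)"] by (simp add: blinfun.bilinear_simps)
      then show "(X p $ 1) *\<^sub>R D (\<lambda>_. e1) Y p + (X p $ 2) *\<^sub>R D (\<lambda>_. e2) Y p = conn_of C X Y p"
        using linear_vec2[OF has_derivative_linear[OF smooth_on_has_derivative[OF Y UNIV_I]], of p "X p"] X Y
        by (simp add: conn_of_def D1[OF Y] algebra_simps)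
    qed
    finally show ?thesis .
  next
    case False
    then show ?thesis unfolding conn_of_def Dund[OF False] by (simp only: if_False)
  qed
  then have "D = conn_of C" by (intro ext) (simp only:)
  with smC show ?thesis by blast
qed

lemma torsion_free_conn_of:
  assumes "smooth_on UNIV C"
  shows "torsion_free (conn_of C) \<longleftrightarrow> (\<forall>p u v. C p u v = C p v u)"
proof
  assume tf: "torsion_free (conn_of C)"
  show "\<forall>p u v. C p u v = C p v u"
  proof (intro allI)
    fix p u v
    have "conn_of C (\<lambda>_. u) (\<lambda>_. v) p - conn_of C (\<lambda>_. v) (\<lambda>_. u) p = lie_bracket (\<lambda>_. u) (\<lambda>_. v) p"
      using tf smooth_on_const unfolding torsion_free_def by blast
    then show "C p u v = C p v u"
      by (simp add: conn_of_def smooth_on_const lie_bracket_def)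
  qed
next
  assume "\<forall>p u v. C p u v = C p v u"
  then show "torsion_free (conn_of C)"
    by (simp add: torsion_free_def conn_of_def lie_bracket_def)
qed

section \<open>Curvature and Ricci tensor in terms of Christoffel symbols\<close>

definition curv :: "christoffel \<Rightarrow> real^2 \<Rightarrow> real^2 \<Rightarrow> real^2 \<Rightarrow> real^2 \<Rightarrow> real^2" where
  "curv C p u v z = frechet_derivative C (at p) u v z - frechet_derivative C (at p) v u z
     + C p u (C p v z) - C p v (C p u z)"

lemma second_derivative_symmetric_vec:
  fixes f :: "'a::euclidean_space \<Rightarrow> real^2"
  assumes "open S" "smooth_on S f" "x \<in> S"
  shows "frechet_derivative (\<lambda>x. frechet_derivative f (at x) v) (at x) w =
    frechet_derivative (\<lambda>x. frechet_derivative f (at x) w) (at x) v"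
proof -
  have nth: "frechet_derivative g (at y) u $ i = frechet_derivative (\<lambda>x. g x $ i) (at y) u"
    if "smooth_on S g" "y \<in> S" for g :: "'a \<Rightarrow> real^2" and y u i
    using frechet_derivative_vec_nth[OF smooth_on_differentiable[OF that]] by (rule sym)
  have *: "frechet_derivative (\<lambda>x. frechet_derivative f (at x) v) (at x) w $ i =
      frechet_derivative (\<lambda>x. frechet_derivative (\<lambda>x. f x $ i) (at x) v) (at x) w" for v w i
    unfolding nth[OF smooth_on_frechet_derivative[OF assms(2)] assms(3)]
    by (rule fun_cong[OF frechet_derivative_cong_open[OF assms(1,3)]]) (rule nth[OF assms(2)])
  show ?thesis
    unfolding vec_eq_iff *
    by (intro allI second_derivative_symmetric[OF assms(1) _ assms(3)] smooth_on_Ck smooth_on_vec_nth assms)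
qed

text \<open>The second derivatives of \<open>Z\<close> cancel by symmetry, and the derivatives of
  \<open>Y\<close> cancel against the bracket term. A constant first argument is the case that
  enters \<open>ricci\<close>.\<close>

lemma curvature_conn_of:
  assumes C: "smooth_on UNIV C" and Y: "smooth_on UNIV Y" and Z: "smooth_on UNIV Z"
  shows "curvature (conn_of C) (\<lambda>_. u) Y Z p = curv C p u (Y p) (Z p)"
proof -
  note const = smooth_on_const[of "UNIV :: (real^2) set" u]
  note dC = smooth_on_has_derivative[OF C UNIV_I] and dY = smooth_on_has_derivative[OF Y UNIV_I]
    and dZ = smooth_on_has_derivative[OF Z UNIV_I]
  let ?dC = "frechet_derivative C (at p)" and ?dY = "frechet_derivative Y (at p)" and ?dZ = "frechet_derivative Z (at p)"
  let ?H = "\<lambda>v w. frechet_derivative (\<lambda>q. frechet_derivative Z (at q) v) (at p) w"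
  have dZf: "((\<lambda>q. frechet_derivative Z (at q) v) has_derivative ?H v) (at p)" for v
    by (rule smooth_on_has_derivative[OF smooth_on_frechet_derivative[OF Z] UNIV_I])
  have dZY: "((\<lambda>q. frechet_derivative Z (at q) (Y q)) has_derivative (\<lambda>h. ?H (Y p) h + ?dZ (?dY h))) (at p)"
  proof -
    have Y_nth: "((\<lambda>q. Y q $ i) has_derivative (\<lambda>h. ?dY h $ i)) (at p)" for i
      by (rule bounded_linear.has_derivative[OF bounded_linear_vec_nth dY])
    have H_lin: "?H (Y p) h = Y p $ 1 *\<^sub>R ?H e1 h + Y p $ 2 *\<^sub>R ?H e2 h" for h
    proof -
      have "((\<lambda>q. frechet_derivative Z (at q) (Y p)) has_derivative (\<lambda>h. Y p $ 1 *\<^sub>R ?H e1 h + Y p $ 2 *\<^sub>R ?H e2 h)) (at p)"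
        unfolding linear_vec2[OF has_derivative_linear[OF dZ], of _ "Y p"]
        by (intro has_derivative_add has_derivative_scaleR_right dZf)
      from fun_cong[OF frechet_derivative_at[OF this], of h] show ?thesis by simp
    qed
    have "((\<lambda>q. Y q $ 1 *\<^sub>R frechet_derivative Z (at q) e1 + Y q $ 2 *\<^sub>R frechet_derivative Z (at q) e2) has_derivative
        (\<lambda>h. (Y p $ 1 *\<^sub>R ?H e1 h + ?dY h $ 1 *\<^sub>R ?dZ e1) + (Y p $ 2 *\<^sub>R ?H e2 h + ?dY h $ 2 *\<^sub>R ?dZ e2))) (at p)"
      by (intro has_derivative_add has_derivative_scaleR dZf Y_nth)
    moreover have "(Y p $ 1 *\<^sub>R ?H e1 h + ?dY h $ 1 *\<^sub>R ?dZ e1) + (Y p $ 2 *\<^sub>R ?H e2 h + ?dY h $ 2 *\<^sub>R ?dZ e2)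
        = ?H (Y p) h + ?dZ (?dY h)" for h
      unfolding H_lin linear_vec2[OF has_derivative_linear[OF dZ], of p "?dY h"] by simp
    ultimately show ?thesis
      unfolding linear_vec2[OF has_derivative_linear[OF dZ], symmetric] by simp
  qed
  have YZ: "conn_of C Y Z = (\<lambda>q. frechet_derivative Z (at q) (Y q) + C q (Y q) (Z q))"
    and uZ: "conn_of C (\<lambda>_. u) Z = (\<lambda>q. frechet_derivative Z (at q) u + C q u (Z q))"
    using Y Z const by (simp_all add: conn_of_def)
  have d1: "frechet_derivative (conn_of C Y Z) (at p) h =
      (?H (Y p) h + ?dZ (?dY h)) + (C p (Y p) (?dZ h) + (C p (?dY h) + ?dC h (Y p)) (Z p))" for h
    unfolding YZ
    using fun_cong[OF frechet_derivative_at[OF has_derivative_add[OF dZY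
          has_derivative_blinfun_apply[OF has_derivative_blinfun_apply[OF dC dY] dZ]]], of h] by simp
  have d2: "frechet_derivative (conn_of C (\<lambda>_. u) Z) (at p) h =
      ?H u h + (C p u (?dZ h) + (C p 0 + ?dC h u) (Z p))" for h
    unfolding uZ
    using fun_cong[OF frechet_derivative_at[OF has_derivative_add[OF dZf[of u]
          has_derivative_blinfun_apply[OF has_derivative_blinfun_apply[OF dC has_derivative_const[of u]] dZ]]], of h] by simp
  have br: "lie_bracket (\<lambda>_. u) Y = (\<lambda>q. frechet_derivative Y (at q) u)"
    by (simp add: lie_bracket_def fun_eq_iff)
  have sym: "?H (Y p) u = ?H u (Y p)"
    by (rule second_derivative_symmetric_vec[OF open_UNIV Z UNIV_I])
  have o1: "conn_of C (\<lambda>_. u) (conn_of C Y Z) p = frechet_derivative (conn_of C Y Z) (at p) u + C p u (conn_of C Y Z p)"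
    and o2: "conn_of C Y (conn_of C (\<lambda>_. u) Z) p = frechet_derivative (conn_of C (\<lambda>_. u) Z) (at p) (Y p) + C p (Y p) (conn_of C (\<lambda>_. u) Z p)"
    and o3: "conn_of C (lie_bracket (\<lambda>_. u) Y) Z p = ?dZ (?dY u) + C p (?dY u) (Z p)"
    using conn_of_smooth[OF C Y Z] conn_of_smooth[OF C const Z] const Y Z smooth_on_frechet_derivative[OF Y, of u]
    by (simp_all add: conn_of_def[of C "\<lambda>_. u" "conn_of C Y Z"] conn_of_def[of C Y "conn_of C (\<lambda>_. u) Z"]
        conn_of_def[of C "\<lambda>q. frechet_derivative Y (at q) u" Z] br)
  show ?thesis
    unfolding curvature_def o1 o2 o3 d1 d2 sym
    by (simp add: YZ uZ curv_def blinfun.bilinear_simps)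
qed

text \<open>Curvature is alternating in its first two arguments, so in the plane the endomorphism
  R(e1,e2) carries all of it.\<close>

lemma curv_vec2: "curv C p u v z = (u $ 1 * v $ 2 - u $ 2 * v $ 1) *\<^sub>R curv C p e1 e2 z"
  if "smooth_on UNIV C"
proof -
  have lin: "linear (frechet_derivative C (at p))"
    by (rule has_derivative_linear[OF smooth_on_has_derivative[OF that UNIV_I]])
  show ?thesis
    unfolding curv_def linear_vec2[OF lin, of u] linear_vec2[OF lin, of v]
      blinfun_vec2[of "C p" u] blinfun_vec2[of "C p" v]
      blinfun_vec2[of "frechet_derivative C (at p) e1" u] blinfun_vec2[of "frechet_derivative C (at p) e1" v]
      blinfun_vec2[of "frechet_derivative C (at p) e2" u] blinfun_vec2[of "frechet_derivative C (at p) e2" v]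
    by (simp add: blinfun.bilinear_simps algebra_simps)
       (simp add: blinfun_vec2[of _ u] blinfun_vec2[of _ v] blinfun.bilinear_simps algebra_simps)
qed

lemma ricci_conn_of:
  assumes "smooth_on UNIV C" "smooth_on UNIV Y" "smooth_on UNIV Z"
  shows "ricci (conn_of C) Y Z p = Y p $ 2 * curv C p e1 e2 (Z p) $ 1 - Y p $ 1 * curv C p e1 e2 (Z p) $ 2"
  unfolding ricci_def curvature_conn_of[OF assms] trace_def sum_2
  by (simp add: matrix_def curv_vec2[OF assms(1), of p e1 "Y p"] curv_vec2[OF assms(1), of p e2 "Y p"])

text \<open>With R = R(e1,e2), Ric(y,z) = y2 (R z)1 - y1 (R z)2. Skewness on (e1,e1) and (e2,e2)
  kills the off-diagonal entries of R, and on (e1,e2) it equates the diagonal ones.\<close>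

lemma ricci_skew_conn_of:
  assumes C: "smooth_on UNIV C"
  shows "ricci_skew (conn_of C) \<longleftrightarrow> (\<forall>p. \<exists>\<kappa>. \<forall>z. curv C p e1 e2 z = \<kappa> *\<^sub>R z)"
proof
  assume skew: "ricci_skew (conn_of C)"
  show "\<forall>p. \<exists>\<kappa>. \<forall>z. curv C p e1 e2 z = \<kappa> *\<^sub>R z"
  proof
    fix p
    let ?R = "curv C p e1 e2"
    have lin: "linear ?R"
      by (rule linearI) (simp_all add: curv_def blinfun.bilinear_simps algebra_simps)
    have *: "y $ 2 * ?R z $ 1 - y $ 1 * ?R z $ 2 = - (z $ 2 * ?R y $ 1 - z $ 1 * ?R y $ 2)" for y z
    proof -
      have "ricci (conn_of C) (\<lambda>_. y) (\<lambda>_. z) p = - ricci (conn_of C) (\<lambda>_. z) (\<lambda>_. y) p"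
        using skew smooth_on_const unfolding ricci_skew_def by blast
      then show ?thesis by (simp only: ricci_conn_of[OF C smooth_on_const smooth_on_const])
    qed
    have "?R e1 $ 2 = 0" "?R e2 $ 1 = 0" "?R e2 $ 2 = ?R e1 $ 1"
      using *[of e1 e1] *[of e2 e2] *[of e1 e2] by simp_all
    then have "?R z = (?R e1 $ 1) *\<^sub>R z" for z
      unfolding linear_vec2[OF lin, of z] by (simp add: vec_eq_iff forall_2)
    then show "\<exists>\<kappa>. \<forall>z. ?R z = \<kappa> *\<^sub>R z" by blast
  qed
next
  assume *: "\<forall>p. \<exists>\<kappa>. \<forall>z. curv C p e1 e2 z = \<kappa> *\<^sub>R z"
  show "ricci_skew (conn_of C)"
    unfolding ricci_skew_def
  proof (intro allI impI)
    fix Y Z :: vector_field and p assume Y: "smooth_on UNIV Y" and Z: "smooth_on UNIV Z"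
    obtain \<kappa> where "\<And>z. curv C p e1 e2 z = \<kappa> *\<^sub>R z" using * by blast
    then show "ricci (conn_of C) Y Z p = - ricci (conn_of C) Z Y p"
      by (simp add: ricci_conn_of[OF C Y Z] ricci_conn_of[OF C Z Y])
  qed
qed

subsection \<open>Connections for which all leaves of a web are parallel\<close>

lemma line_of_hpoint:
  assumes "(s, t) \<noteq> (0, 0)"
  shows "line_of (hpoint s t) = span {vector [s, t]}"
proof -
  have "(vector [s, t] :: real^2) \<noteq> 0" using assms by (auto simp: vec_eq_iff forall_2)
  then have "subspace (span {vector [s, t] :: real^2}) \<and> dim (span {vector [s, t] :: real^2}) = 1"
    by (simp add: dim_eq_card_independent)
  then show ?thesis unfolding hpoint_def by (intro rp1_of_line_inverse) blast
qed

lemma hpoint_cases: "\<exists>s t. (s, t) \<noteq> (0, 0) \<and> P = hpoint s t"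
proof -
  have L: "subspace (line_of P)" "dim (line_of P) = 1" using line_of[of P] by auto
  obtain B where B: "B \<subseteq> line_of P" "independent B" "line_of P \<subseteq> span B" "card B = 1"
    using basis_exists[of "line_of P"] L(2) by metis
  then obtain b where b: "B = {b}" using card_1_singletonE by blast
  have b0: "b \<noteq> 0" using B(2) b by auto
  have "line_of P = span {b}"
    using B(1,3) L(1) b span_minimal by blast
  moreover have "b = vector [b $ 1, b $ 2]" by (simp add: vec_eq_iff forall_2)
  ultimately have "P = hpoint (b $ 1) (b $ 2)"
    unfolding hpoint_def by (metis line_of_inverse)
  moreover have "(b $ 1, b $ 2) \<noteq> (0, 0)" using b0 by (auto simp: vec_eq_iff forall_2)
  ultimately show ?thesis by blast
qed

lemma moebius_hpoint:
  assumes "(s, t) \<noteq> (0, 0)"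
  shows "moebius A (hpoint s t) = hpoint ((A *v vector [s, t]) $ 1) ((A *v vector [s, t]) $ 2)"
proof -
  have "(\<lambda>v. A *v v) ` span {vector [s, t]} = span {A *v vector [s, t]}"
    using span_linear_image[OF matrix_vector_mul_linear, of A "{vector [s, t]}"] by simp
  moreover have "vector [(A *v vector [s, t]) $ 1, (A *v vector [s, t]) $ 2] = A *v vector [s, t]"
    by (simp add: vec_eq_iff forall_2)
  ultimately have "rp1_of_line ((\<lambda>v. A *v v) ` span {vector [s, t]}) = hpoint ((A *v vector [s, t]) $ 1) ((A *v vector [s, t]) $ 2)"
    by (simp only: hpoint_def)
  then show ?thesis by (simp only: moebius_def line_of_hpoint[OF assms])
qed

section \<open>Parallel line fields and coframes of a web\<close>

type_synonym one_form = "real^2 \<Rightarrow> (real^2) \<Rightarrow>\<^sub>L real"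

type_synonym christoffel_pt = "(real^2) \<Rightarrow>\<^sub>L ((real^2) \<Rightarrow>\<^sub>L (real^2))"

text \<open>The difference of the two sides is the covariant derivative of the form; vanishing on
  the kernel says that it is a multiple of the form, without naming the factor. The symbol
  \<open>c\<close> is a single value rather than a field, so that uniqueness can be argued point by
  point.\<close>

definition parallel_at :: "christoffel_pt \<Rightarrow> one_form \<Rightarrow> real^2 \<Rightarrow> bool" where
  "parallel_at c \<alpha> q \<longleftrightarrow> (\<forall>v z. \<alpha> q z = 0 \<longrightarrow> frechet_derivative \<alpha> (at q) v z = \<alpha> q (c v z))"

definition symmetric_pt :: "christoffel_pt \<Rightarrow> bool" where
  "symmetric_pt c \<longleftrightarrow> (\<forall>u v. c u v = c v u)"

definition represents :: "(real^2) set \<Rightarrow> one_form \<Rightarrow> line_field \<Rightarrow> bool" where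
  "represents U \<alpha> T \<longleftrightarrow> open U \<and> smooth_on U \<alpha> \<and> (\<forall>r\<in>U. \<alpha> r \<noteq> 0 \<and> T r = {v. \<alpha> r v = 0})"

text \<open>Ranging over all representing forms and all parameters makes the notion depend on the
  set of foliations alone, neither on a frame nor on the parametrization;
  \<open>parallel_at_cong\<close> reduces its verification to one form per foliation.\<close>

definition web_parallel_at :: "christoffel_pt \<Rightarrow> (rp1 \<Rightarrow> line_field) \<Rightarrow> real^2 \<Rightarrow> bool" where
  "web_parallel_at c F q \<longleftrightarrow> (\<forall>P U \<alpha>. q \<in> U \<longrightarrow> represents U \<alpha> (F P) \<longrightarrow> parallel_at c \<alpha> q)"

lemma form_has_derivative:
  assumes "smooth_on U \<alpha>" "q \<in> U"
  shows "((\<lambda>r. blinfun_apply (\<alpha> r) z) has_derivative (\<lambda>v. frechet_derivative \<alpha> (at q) v z)) (at q)"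
  using has_derivative_blinfun_apply[OF smooth_on_has_derivative[OF assms] has_derivative_const[of z]]
  by (simp add: blinfun.bilinear_simps)

text \<open>The identity \<open>\<alpha> w * \<beta> z = \<alpha> z * \<beta> w\<close> expresses that \<open>\<alpha>\<close> and \<open>\<beta>\<close> have the same kernel;
  it is differentiated in the direction \<open>v\<close>.\<close>

lemma parallel_at_cong:
  assumes \<alpha>: "represents U \<alpha> T" and \<beta>: "represents U \<beta> T" and q: "q \<in> U" and par: "parallel_at c \<alpha> q"
  shows "parallel_at c \<beta> q"
  unfolding parallel_at_def
proof (intro allI impI)
  fix v z assume z: "\<beta> q z = 0"
  let ?A = "frechet_derivative \<alpha> (at q) v" and ?B = "frechet_derivative \<beta> (at q) v"
  have ker: "\<alpha> r x = 0 \<longleftrightarrow> \<beta> r x = 0" if "r \<in> U" for r x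
  proof -
    have "{v. \<alpha> r v = 0} = {v. \<beta> r v = 0}" using \<alpha> \<beta> that unfolding represents_def by metis
    then show ?thesis by blast
  qed
  have id: "\<alpha> r w * \<beta> r x = \<alpha> r x * \<beta> r w" if "r \<in> U" for r w x
  proof -
    have "\<alpha> r (\<alpha> r w *\<^sub>R x - \<alpha> r x *\<^sub>R w) = 0" by (simp add: blinfun.bilinear_simps)
    with ker[OF that] have "\<beta> r (\<alpha> r w *\<^sub>R x - \<alpha> r x *\<^sub>R w) = 0" by blast
    then show ?thesis by (simp add: blinfun.bilinear_simps)
  qed
  have U: "open U" "smooth_on U \<alpha>" "smooth_on U \<beta>" using \<alpha> \<beta> by (auto simp: represents_def)
  have "\<alpha> q \<noteq> 0" using \<alpha> q by (auto simp: represents_def)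
  then obtain w where w: "\<alpha> q w \<noteq> 0" by (metis blinfun_eqI zero_blinfun.rep_eq)
  have \<alpha>z: "\<alpha> q z = 0" using ker[OF q] z by blast
  have d1: "((\<lambda>r. \<alpha> r w * \<beta> r z) has_derivative (\<lambda>h. \<alpha> q w * frechet_derivative \<beta> (at q) h z + frechet_derivative \<alpha> (at q) h w * \<beta> q z)) (at q)"
    by (rule has_derivative_mult[OF form_has_derivative[OF U(2) q] form_has_derivative[OF U(3) q]])
  have d2: "((\<lambda>r. \<alpha> r z * \<beta> r w) has_derivative (\<lambda>h. \<alpha> q z * frechet_derivative \<beta> (at q) h w + frechet_derivative \<alpha> (at q) h z * \<beta> q w)) (at q)"
    by (rule has_derivative_mult[OF form_has_derivative[OF U(2) q] form_has_derivative[OF U(3) q]])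
  have "((\<lambda>r. \<alpha> r z * \<beta> r w) has_derivative (\<lambda>h. \<alpha> q w * frechet_derivative \<beta> (at q) h z + frechet_derivative \<alpha> (at q) h w * \<beta> q z)) (at q)"
    by (rule has_derivative_transform_within_open[OF d1 U(1) q id])
  from fun_cong[OF has_derivative_unique[OF this d2], of v]
  have "\<alpha> q w * ?B z = ?A z * \<beta> q w" by (simp add: z \<alpha>z)
  also have "?A z = \<alpha> q (c v z)" using par \<alpha>z by (simp add: parallel_at_def)
  also have "\<alpha> q (c v z) * \<beta> q w = \<alpha> q w * \<beta> q (c v z)" using id[OF q] by simp
  finally show "?B z = \<beta> q (c v z)" using w by simp
qed

lemma represents_subset: "represents U \<alpha> T \<Longrightarrow> open V \<Longrightarrow> V \<subseteq> U \<Longrightarrow> represents V \<alpha> T"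
  unfolding represents_def by (blast intro: smooth_on_subset)

lemma blinfun_proportional:
  fixes f g :: "'a::real_normed_vector \<Rightarrow>\<^sub>L real"
  assumes "g \<noteq> 0" "\<And>z. g z = 0 \<Longrightarrow> f z = 0"
  shows "\<exists>\<mu>. \<forall>z. f z = \<mu> * g z"
proof -
  obtain n where n: "g n \<noteq> 0" using assms(1) by (metis blinfun_eqI zero_blinfun.rep_eq)
  have "f z = (f n / g n) * g z" for z
  proof -
    have "g (z - (g z / g n) *\<^sub>R n) = 0" using n by (simp add: blinfun.bilinear_simps)
    from assms(2)[OF this] show ?thesis by (simp add: blinfun.bilinear_simps)
  qed
  then show ?thesis by blast
qed

lemma parallel_at_factor:
  assumes "parallel_at c \<alpha> q" "\<alpha> q \<noteq> 0"
  shows "\<exists>\<theta>. \<forall>v z. frechet_derivative \<alpha> (at q) v z = \<alpha> q (c v z) + \<theta> v * \<alpha> q z"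
proof -
  have "\<exists>\<theta>. \<forall>z. (frechet_derivative \<alpha> (at q) v - (\<alpha> q o\<^sub>L c v)) z = \<theta> * \<alpha> q z" for v
    by (rule blinfun_proportional[OF assms(2)]) (use assms(1) in \<open>simp add: parallel_at_def blinfun.diff_left\<close>)
  then obtain \<theta> where "\<And>v z. (frechet_derivative \<alpha> (at q) v - (\<alpha> q o\<^sub>L c v)) z = \<theta> v * \<alpha> q z" by metis
  then show ?thesis by (intro exI[of _ \<theta>]) (simp add: blinfun.diff_left algebra_simps)
qed

text \<open>Independence is restated as a nonvanishing determinant, which can be divided by and
  enters Cramer's rule.\<close>

definition web_frame :: "(real^2) set \<Rightarrow> one_form \<Rightarrow> one_form \<Rightarrow> (rp1 \<Rightarrow> line_field) \<Rightarrow> bool" where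
  "web_frame U \<omega>0 \<omega>1 F \<longleftrightarrow> open U \<and> smooth_on U \<omega>0 \<and> smooth_on U \<omega>1 \<and>
     (\<forall>q\<in>U. \<omega>0 q e1 * \<omega>1 q e2 - \<omega>0 q e2 * \<omega>1 q e1 \<noteq> 0) \<and>
     (\<forall>s t. (s, t) \<noteq> (0, 0) \<longrightarrow> (\<forall>q\<in>U. F (hpoint s t) q = {v. s * \<omega>0 q v + t * \<omega>1 q v = 0}))"

lemma web_frame_exists:
  assumes "F \<in> veronese_webs"
  shows "\<exists>U \<omega>0 \<omega>1. p \<in> U \<and> web_frame U \<omega>0 \<omega>1 F"
proof -
  have "\<exists>U \<omega>0 \<omega>1. open U \<and> p \<in> U \<and> indep_one_forms_on U \<omega>0 \<omega>1 \<and>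
        (\<forall>s t. (s, t) \<noteq> (0, 0) \<longrightarrow>
           (\<forall>q\<in>U. F (hpoint s t) q = {v. blinfun_apply (s *\<^sub>R \<omega>0 q + t *\<^sub>R \<omega>1 q) v = 0}))"
    using assms unfolding veronese_webs_def mem_Collect_eq by (rule conjunct2[THEN spec])
  then obtain U \<omega>0 \<omega>1 where U: "open U" "p \<in> U" and ind: "indep_one_forms_on U \<omega>0 \<omega>1"
    and F: "\<forall>s t. (s, t) \<noteq> (0, 0) \<longrightarrow>
           (\<forall>q\<in>U. F (hpoint s t) q = {v. blinfun_apply (s *\<^sub>R \<omega>0 q + t *\<^sub>R \<omega>1 q) v = 0})"
    by (elim exE conjE)
  have "\<omega>0 q e1 * \<omega>1 q e2 - \<omega>0 q e2 * \<omega>1 q e1 \<noteq> 0" if q: "q \<in> U" for q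
  proof
    assume d: "\<omega>0 q e1 * \<omega>1 q e2 - \<omega>0 q e2 * \<omega>1 q e1 = 0"
    have ind': "a = 0 \<and> b = 0" if "a *\<^sub>R \<omega>0 q + b *\<^sub>R \<omega>1 q = 0" for a b
      using ind q that unfolding indep_one_forms_on_def by blast
    have ext: "f = 0" if "f e1 = 0" "f e2 = 0" for f :: "(real^2) \<Rightarrow>\<^sub>L real"
      by (rule blinfun_eqI) (use blinfun_vec2[of f] that in simp)
    have "\<omega>1 q e1 *\<^sub>R \<omega>0 q + (- \<omega>0 q e1) *\<^sub>R \<omega>1 q = 0"
      by (rule ext) (use d in \<open>simp_all add: blinfun.bilinear_simps algebra_simps\<close>)
    from ind'[OF this] have 1: "\<omega>0 q e1 = 0" by simp
    have "\<omega>1 q e2 *\<^sub>R \<omega>0 q + (- \<omega>0 q e2) *\<^sub>R \<omega>1 q = 0"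
      by (rule ext) (use d in \<open>simp_all add: blinfun.bilinear_simps algebra_simps\<close>)
    from ind'[OF this] have 2: "\<omega>0 q e2 = 0" by simp
    have "1 *\<^sub>R \<omega>0 q + 0 *\<^sub>R \<omega>1 q = 0" using ext[OF 1 2] by simp
    from ind'[OF this] show False by simp
  qed
  then have "web_frame U \<omega>0 \<omega>1 F"
    using U(1) ind F unfolding web_frame_def indep_one_forms_on_def by (simp add: blinfun.bilinear_simps)
  with U(2) show ?thesis by blast
qed

lemma web_frame_separates:
  assumes "web_frame U \<omega>0 \<omega>1 F" "q \<in> U" "\<omega>0 q x = 0" "\<omega>1 q x = 0"
  shows "x = 0"
proof -
  let ?d = "\<omega>0 q e1 * \<omega>1 q e2 - \<omega>0 q e2 * \<omega>1 q e1"
  have d: "?d \<noteq> 0" using assms(1,2) by (auto simp: web_frame_def)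
  have a: "x $ 1 * \<omega>0 q e1 + x $ 2 * \<omega>0 q e2 = 0" "x $ 1 * \<omega>1 q e1 + x $ 2 * \<omega>1 q e2 = 0"
    using blinfun_vec2[of "\<omega>0 q" x] blinfun_vec2[of "\<omega>1 q" x] assms(3,4) by simp_all
  have "x $ 1 * ?d = 0" "x $ 2 * ?d = 0" using a by algebra+
  with d show ?thesis by (simp add: vec_eq_iff forall_2)
qed

lemma web_frame_represents:
  assumes "web_frame U \<omega>0 \<omega>1 F" "(s, t) \<noteq> (0, 0)"
  shows "represents U (\<lambda>q. s *\<^sub>R \<omega>0 q + t *\<^sub>R \<omega>1 q) (F (hpoint s t))"
proof -
  have U: "open U" "smooth_on U \<omega>0" "smooth_on U \<omega>1" using assms(1) by (auto simp: web_frame_def)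
  have "s *\<^sub>R \<omega>0 q + t *\<^sub>R \<omega>1 q \<noteq> 0" if q: "q \<in> U" for q
  proof
    let ?d = "\<omega>0 q e1 * \<omega>1 q e2 - \<omega>0 q e2 * \<omega>1 q e1"
    assume "s *\<^sub>R \<omega>0 q + t *\<^sub>R \<omega>1 q = 0"
    then have "(s *\<^sub>R \<omega>0 q + t *\<^sub>R \<omega>1 q) x = 0" for x by simp
    then have a: "s * \<omega>0 q x + t * \<omega>1 q x = 0" for x by (simp add: blinfun.bilinear_simps)
    have "s * ?d = 0" "t * ?d = 0" using a[of e1] a[of e2] by algebra+
    moreover have "?d \<noteq> 0" using assms(1) q by (auto simp: web_frame_def)
    ultimately show False using assms(2) by simp
  qed
  moreover have "F (hpoint s t) q = {v. (s *\<^sub>R \<omega>0 q + t *\<^sub>R \<omega>1 q) v = 0}" if "q \<in> U" for q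
    using assms that by (simp add: web_frame_def blinfun.bilinear_simps)
  moreover have "smooth_on U (\<lambda>q. s *\<^sub>R \<omega>0 q + t *\<^sub>R \<omega>1 q)"
    by (intro smooth_on_add smooth_on_scaleR smooth_on_const U)
  ultimately show ?thesis using U(1) by (simp add: represents_def)
qed

lemma combination_derivative:
  assumes "smooth_on U \<omega>0" "smooth_on U \<omega>1" "q \<in> U"
  shows "frechet_derivative (\<lambda>q. s *\<^sub>R \<omega>0 q + t *\<^sub>R \<omega>1 q) (at q) v =
    s *\<^sub>R frechet_derivative \<omega>0 (at q) v + t *\<^sub>R frechet_derivative \<omega>1 (at q) v"
  using fun_cong[OF frechet_derivative_at[OF has_derivative_add[OF has_derivative_scaleR_right[OF smooth_on_has_derivative[OF assms(1,3)], of s]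
        has_derivative_scaleR_right[OF smooth_on_has_derivative[OF assms(2,3)], of t]]], of v] by simp

text \<open>Because the factor \<open>\<theta>\<close> is common to both forms, every combination of
  them satisfies the same equation, hence every member of the pencil is parallel.\<close>

lemma web_frame_parallelI:
  assumes fr: "web_frame U \<omega>0 \<omega>1 F" and q: "q \<in> U"
    and \<omega>: "\<And>v z. frechet_derivative \<omega>0 (at q) v z = \<omega>0 q (blinfun_apply (blinfun_apply c v) z) + \<theta> v * \<omega>0 q z"
      "\<And>v z. frechet_derivative \<omega>1 (at q) v z = \<omega>1 q (blinfun_apply (blinfun_apply c v) z) + \<theta> v * \<omega>1 q z"
  shows "web_parallel_at c F q"
  unfolding web_parallel_at_def
proof (intro allI impI)
  fix P V \<alpha> assume V: "q \<in> V" "represents V \<alpha> (F P)"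
  obtain s t where st: "(s, t) \<noteq> (0, 0)" and P: "P = hpoint s t" using hpoint_cases by blast
  have U: "open U" "smooth_on U \<omega>0" "smooth_on U \<omega>1" using fr by (auto simp: web_frame_def)
  have oV: "open V" using V(2) by (simp add: represents_def)
  let ?\<beta> = "\<lambda>q. s *\<^sub>R \<omega>0 q + t *\<^sub>R \<omega>1 q"
  have "parallel_at c ?\<beta> q"
    unfolding parallel_at_def combination_derivative[OF U(2,3) q] blinfun.add_left blinfun.scaleR_left \<omega>
  proof (intro allI impI)
    fix v z assume z: "s *\<^sub>R \<omega>0 q z + t *\<^sub>R \<omega>1 q z = 0"
    have "s *\<^sub>R (\<omega>0 q (c v z) + \<theta> v * \<omega>0 q z) + t *\<^sub>R (\<omega>1 q (c v z) + \<theta> v * \<omega>1 q z) =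
      s *\<^sub>R \<omega>0 q (c v z) + t *\<^sub>R \<omega>1 q (c v z) + \<theta> v * (s *\<^sub>R \<omega>0 q z + t *\<^sub>R \<omega>1 q z)"
      by (simp add: algebra_simps)
    then show "s *\<^sub>R (\<omega>0 q (c v z) + \<theta> v * \<omega>0 q z) + t *\<^sub>R (\<omega>1 q (c v z) + \<theta> v * \<omega>1 q z) =
      s *\<^sub>R \<omega>0 q (c v z) + t *\<^sub>R \<omega>1 q (c v z)" using z by simp
  qed
  then show "parallel_at c \<alpha> q"
    using parallel_at_cong[OF represents_subset[OF web_frame_represents[OF fr st], of "U \<inter> V"]
        represents_subset[OF V(2)[unfolded P], of "U \<inter> V"]] U(1) oV V(1) q by (simp add: open_Int)
qed

text \<open>Each parallel form has its own factor; the rigidity comes from a third member of the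
  pencil.\<close>

lemma web_frame_parallelD:
  assumes fr: "web_frame U \<omega>0 \<omega>1 F" and q: "q \<in> U" and par: "web_parallel_at c F q"
  shows "\<exists>\<theta>. \<forall>v z. frechet_derivative \<omega>0 (at q) v z = \<omega>0 q (c v z) + \<theta> v * \<omega>0 q z \<and>
    frechet_derivative \<omega>1 (at q) v z = \<omega>1 q (c v z) + \<theta> v * \<omega>1 q z"
proof -
  have U: "smooth_on U \<omega>0" "smooth_on U \<omega>1" using fr by (auto simp: web_frame_def)
  have *: "\<exists>\<theta>. \<forall>v z. (s *\<^sub>R frechet_derivative \<omega>0 (at q) v + t *\<^sub>R frechet_derivative \<omega>1 (at q) v) z
      = (s *\<^sub>R \<omega>0 q + t *\<^sub>R \<omega>1 q) (c v z) + \<theta> v * (s *\<^sub>R \<omega>0 q + t *\<^sub>R \<omega>1 q) z" if st: "(s, t) \<noteq> (0, 0)" for s t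
  proof -
    note rep = web_frame_represents[OF fr st]
    have "parallel_at c (\<lambda>q. s *\<^sub>R \<omega>0 q + t *\<^sub>R \<omega>1 q) q"
      using par rep q unfolding web_parallel_at_def by blast
    moreover have "s *\<^sub>R \<omega>0 q + t *\<^sub>R \<omega>1 q \<noteq> 0" using rep q unfolding represents_def by blast
    ultimately show ?thesis
      using parallel_at_factor[of c "\<lambda>q. s *\<^sub>R \<omega>0 q + t *\<^sub>R \<omega>1 q" q] unfolding combination_derivative[OF U q] by blast
  qed
  obtain \<theta>0 where 0: "\<And>v z. frechet_derivative \<omega>0 (at q) v z = \<omega>0 q (c v z) + \<theta>0 v * \<omega>0 q z"
    using *[of 1 0] by (auto simp: blinfun.bilinear_simps)
  obtain \<theta>1 where 1: "\<And>v z. frechet_derivative \<omega>1 (at q) v z = \<omega>1 q (c v z) + \<theta>1 v * \<omega>1 q z"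
    using *[of 0 1] by (auto simp: blinfun.bilinear_simps)
  obtain \<theta>2 where 2: "\<And>v z. frechet_derivative \<omega>0 (at q) v z + frechet_derivative \<omega>1 (at q) v z =
      \<omega>0 q (c v z) + \<omega>1 q (c v z) + \<theta>2 v * (\<omega>0 q z + \<omega>1 q z)"
    using *[of 1 1] by (auto simp: blinfun.bilinear_simps)
  \<comment> \<open>Comparing the equation of \<omega>0 + \<omega>1 with the sum of the two others
    gives a linear relation between independent forms, so all three factors agree.\<close>
  have "\<theta>1 v = \<theta>0 v" for v
  proof -
    let ?d = "\<omega>0 q e1 * \<omega>1 q e2 - \<omega>0 q e2 * \<omega>1 q e1"
    have "(\<theta>0 v - \<theta>2 v) * \<omega>0 q z + (\<theta>1 v - \<theta>2 v) * \<omega>1 q z = 0" for z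
      using 2[of v z] unfolding 0 1 by (simp add: algebra_simps)
    from this[of e1] this[of e2] have "(\<theta>0 v - \<theta>2 v) * ?d = 0" "(\<theta>1 v - \<theta>2 v) * ?d = 0" by algebra+
    moreover have "?d \<noteq> 0" using fr q by (auto simp: web_frame_def)
    ultimately show ?thesis by simp
  qed
  then show ?thesis using 0 1 by (intro exI[of _ \<theta>0]) simp
qed

text \<open>The coframe equations show that the difference of the two symbols multiplies
  \<open>z\<close> by a scalar \<sigma>(v). Symmetry gives \<sigma>(v) z = \<sigma>(z) v, and
  independent arguments force \<sigma> = 0.\<close>

lemma web_parallel_at_unique:
  assumes F: "F \<in> veronese_webs" and c: "web_parallel_at c F q" "symmetric_pt c"
    and c': "web_parallel_at c' F q" "symmetric_pt c'"
  shows "c = c'"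
proof -
  obtain U \<omega>0 \<omega>1 where q: "q \<in> U" and fr: "web_frame U \<omega>0 \<omega>1 F" using web_frame_exists[OF F] by blast
  obtain \<theta> where \<theta>: "\<And>v z. frechet_derivative \<omega>0 (at q) v z = \<omega>0 q (c v z) + \<theta> v * \<omega>0 q z"
    "\<And>v z. frechet_derivative \<omega>1 (at q) v z = \<omega>1 q (c v z) + \<theta> v * \<omega>1 q z"
    using web_frame_parallelD[OF fr q c(1)] by blast
  obtain \<theta>' where \<theta>': "\<And>v z. frechet_derivative \<omega>0 (at q) v z = \<omega>0 q (c' v z) + \<theta>' v * \<omega>0 q z"
    "\<And>v z. frechet_derivative \<omega>1 (at q) v z = \<omega>1 q (c' v z) + \<theta>' v * \<omega>1 q z"
    using web_frame_parallelD[OF fr q c'(1)] by blast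
  define \<sigma> where "\<sigma> v = \<theta>' v - \<theta> v" for v
  have diff: "c v z - c' v z = \<sigma> v *\<^sub>R z" for v z
  proof -
    have "c v z - c' v z - \<sigma> v *\<^sub>R z = 0"
      by (rule web_frame_separates[OF fr q])
        (use \<theta>(1)[of v z] \<theta>'(1)[of v z] \<theta>(2)[of v z] \<theta>'(2)[of v z] in
          \<open>simp_all add: blinfun.bilinear_simps \<sigma>_def algebra_simps\<close>)
    then show ?thesis by simp
  qed
  have sym: "\<sigma> v *\<^sub>R z = \<sigma> z *\<^sub>R v" for v z
    using diff[of v z] diff[of z v] c(2) c'(2) unfolding symmetric_pt_def by metis
  have "\<sigma> e1 = 0"
    using arg_cong[OF sym[of e1 e2], of "\<lambda>x. x $ 2"] by simp
  then have "\<sigma> v = 0" for v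
    using arg_cong[OF sym[of v e1], of "\<lambda>x. x $ 1"] by simp
  then have "c v z = c' v z" for v z using diff[of v z] by simp
  then show ?thesis by (intro blinfun_eqI) simp
qed

lemma blinfun2_exists:
  fixes f :: "real^2 \<Rightarrow> real^2 \<Rightarrow> 'b::real_normed_vector"
  assumes "\<And>v. linear (\<lambda>u. f u v)" "\<And>u. linear (f u)"
  shows "\<exists>c :: (real^2) \<Rightarrow>\<^sub>L (real^2) \<Rightarrow>\<^sub>L 'b. \<forall>u v. c u v = f u v"
proof -
  have Cin: "blinfun_apply (Blinfun (f u)) v = f u v" for u v
    by (rule fun_cong[OF bounded_linear_Blinfun_apply[OF bounded_linear_vec2I[OF assms(2)]]])
  have "linear (\<lambda>u. Blinfun (f u))"
    by (rule linearI; rule blinfun_eqI)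
      (simp_all add: Cin blinfun.bilinear_simps linear_add[OF assms(1)] linear_scale[OF assms(1)])
  from fun_cong[OF bounded_linear_Blinfun_apply[OF bounded_linear_vec2I[OF this]]]
  show ?thesis by (intro exI[of _ "Blinfun (\<lambda>u. Blinfun (f u))"]) (simp add: Cin)
qed

text \<open>With \<open>d \<omega>\<^sub>i = \<theta> \<and> \<omega>\<^sub>i\<close> one gets \<open>\<theta>\<close> from the coframe, and \<open>\<omega>\<^sub>i (C u v) = m\<^sub>i u v\<close> is then solved
  by Cramer's rule.\<close>

lemma web_frame_christoffel:
  assumes fr: "web_frame U \<omega>0 \<omega>1 F"
  shows "\<exists>C. smooth_on U C \<and> (\<forall>r\<in>U. symmetric_pt (C r) \<and> web_parallel_at (C r) F r)"
proof -
  have U: "open U" "smooth_on U \<omega>0" "smooth_on U \<omega>1" using fr by (auto simp: web_frame_def)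
  define d where "d r = \<omega>0 r e1 * \<omega>1 r e2 - \<omega>0 r e2 * \<omega>1 r e1" for r
  have d: "d r \<noteq> 0" if "r \<in> U" for r using fr that by (auto simp: web_frame_def d_def)
  let ?D0 = "\<lambda>r. frechet_derivative \<omega>0 (at r)" and ?D1 = "\<lambda>r. frechet_derivative \<omega>1 (at r)"
  define k0 where "k0 r = ?D0 r e1 e2 - ?D0 r e2 e1" for r
  define k1 where "k1 r = ?D1 r e1 e2 - ?D1 r e2 e1" for r
  \<comment> \<open>\<open>k0\<close> and \<open>k1\<close> are the values of d\<omega>0 and
    d\<omega>1 on (e1,e2), and this is the form whose wedge product with each \<omega>i is
    d\<omega>i. Antisymmetrising the equations of a torsion-free solution leaves exactly this
    condition.\<close>
  define \<theta> where "\<theta> r v = (k1 r * \<omega>0 r v - k0 r * \<omega>1 r v) / d r" for r v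
  define m0 where "m0 r u v = ?D0 r u v - \<theta> r u * \<omega>0 r v" for r u v
  define m1 where "m1 r u v = ?D1 r u v - \<theta> r u * \<omega>1 r v" for r u v
  define f :: "real^2 \<Rightarrow> real^2 \<Rightarrow> real^2 \<Rightarrow> real^2" where
    "f r u v = ((m0 r u v * \<omega>1 r e2 - m1 r u v * \<omega>0 r e2) / d r) *\<^sub>R e1 +
      ((m1 r u v * \<omega>0 r e1 - m0 r u v * \<omega>1 r e1) / d r) *\<^sub>R e2" for r u v
  have lin0: "linear (?D0 r)" and lin1: "linear (?D1 r)" if "r \<in> U" for r
    by (rule has_derivative_linear[OF smooth_on_has_derivative[OF U(2) that]],
        rule has_derivative_linear[OF smooth_on_has_derivative[OF U(3) that]])
  have \<theta>_lin: "\<theta> r (u + v) = \<theta> r u + \<theta> r v" "\<theta> r (a *\<^sub>R u) = a * \<theta> r u" for r u v a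
    by (simp_all add: \<theta>_def blinfun.bilinear_simps add_divide_distrib diff_divide_distrib algebra_simps)
  have m_lin: "m0 r (u + u') v = m0 r u v + m0 r u' v" "m0 r (a *\<^sub>R u) v = a * m0 r u v"
    "m0 r u (v + v') = m0 r u v + m0 r u v'" "m0 r u (a *\<^sub>R v) = a * m0 r u v"
    "m1 r (u + u') v = m1 r u v + m1 r u' v" "m1 r (a *\<^sub>R u) v = a * m1 r u v"
    "m1 r u (v + v') = m1 r u v + m1 r u v'" "m1 r u (a *\<^sub>R v) = a * m1 r u v" if "r \<in> U" for r u u' v v' a
    by (simp_all add: m0_def m1_def \<theta>_lin linear_add[OF lin0[OF that]] linear_add[OF lin1[OF that]]
        linear_scale[OF lin0[OF that]] linear_scale[OF lin1[OF that]] blinfun.bilinear_simps algebra_simps)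
  have "\<exists>c. \<forall>u v. blinfun_apply (blinfun_apply c u) v = f r u v" if r: "r \<in> U" for r
    by (rule blinfun2_exists; rule linearI)
      (simp_all add: f_def m_lin[OF r] vec_eq_iff forall_2 add_divide_distrib diff_divide_distrib algebra_simps)
  then have "\<forall>r\<in>U. \<exists>c. \<forall>u v. blinfun_apply (blinfun_apply c u) v = f r u v" by (rule ballI)
  from bchoice[OF this] obtain C where C: "\<forall>r\<in>U. \<forall>u v. blinfun_apply (blinfun_apply (C r) u) v = f r u v" by (rule exE)
  have w0: "smooth_on U (\<lambda>r. \<omega>0 r v)" and w1: "smooth_on U (\<lambda>r. \<omega>1 r v)"
    and D0: "smooth_on U (\<lambda>r. ?D0 r u v)" and D1: "smooth_on U (\<lambda>r. ?D1 r u v)" for u v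
    by (intro smooth_on_blinfun_apply smooth_on_const smooth_on_frechet_derivative U)+
  have sd: "smooth_on U d" unfolding d_def by (intro smooth_on_diff smooth_on_mult U(1) w0 w1)
  have sk: "smooth_on U k0" "smooth_on U k1"
    unfolding k0_def k1_def by (intro smooth_on_diff U(1) D0 D1)+
  have s\<theta>: "smooth_on U (\<lambda>r. \<theta> r v)" for v
    unfolding \<theta>_def by (rule smooth_on_divide[OF U(1) _ sd d]) (intro smooth_on_diff smooth_on_mult U(1) w0 w1 sk)+
  have sm: "smooth_on U (\<lambda>r. m0 r u v)" "smooth_on U (\<lambda>r. m1 r u v)" for u v
    unfolding m0_def m1_def by (intro smooth_on_diff smooth_on_mult U(1) w0 w1 D0 D1 s\<theta>)+
  have "smooth_on U (\<lambda>r. m0 r u v * \<omega>1 r e2 - m1 r u v * \<omega>0 r e2)"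
    "smooth_on U (\<lambda>r. m1 r u v * \<omega>0 r e1 - m0 r u v * \<omega>1 r e1)" for u v
    by (intro smooth_on_diff[OF U(1)] smooth_on_mult[OF U(1)] w0 w1 sm)+
  then have sf: "smooth_on U (\<lambda>r. f r u v)" for u v
    unfolding f_def
    by (intro smooth_on_add[OF U(1)] smooth_on_scaleR[OF U(1) _ smooth_on_const] smooth_on_divide[OF U(1) _ sd d])
  have "smooth_on U (\<lambda>r. C r u v)" for u v
    by (rule smooth_on_cong[OF U(1) _ sf[of u v]]) (simp add: C)
  then have "smooth_on U C" by (intro smooth_on_blinfun U(1))
  moreover have "symmetric_pt (C r) \<and> web_parallel_at (C r) F r" if r: "r \<in> U" for r
  proof
    have expand: "\<omega>0 r u = u $ 1 * \<omega>0 r e1 + u $ 2 * \<omega>0 r e2" "\<omega>1 r u = u $ 1 * \<omega>1 r e1 + u $ 2 * \<omega>1 r e2"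
      for u using blinfun_vec2[of "\<omega>0 r" u] blinfun_vec2[of "\<omega>1 r" u] by simp_all
    have wedge: "\<omega>0 r u * \<omega>1 r v - \<omega>0 r v * \<omega>1 r u = (u $ 1 * v $ 2 - u $ 2 * v $ 1) * d r" for u v
      unfolding expand[of u] expand[of v] d_def by (simp add: algebra_simps)
    have alt: "D u v - D v u = (u $ 1 * v $ 2 - u $ 2 * v $ 1) * (D e1 e2 - D e2 e1)"
      if "linear D" for D :: "real^2 \<Rightarrow> (real^2) \<Rightarrow>\<^sub>L real" and u v
      unfolding linear_vec2[OF that, of u] linear_vec2[OF that, of v] blinfun.add_left blinfun.scaleR_left
        blinfun_vec2[of "D e1" u] blinfun_vec2[of "D e1" v] blinfun_vec2[of "D e2" u] blinfun_vec2[of "D e2" v]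
      by (simp add: algebra_simps)
    have \<theta>d: "\<theta> r u * d r = k1 r * \<omega>0 r u - k0 r * \<omega>1 r u" for u
      using d[OF r] by (simp add: \<theta>_def)
    \<comment> \<open>The antisymmetric part of \<open>m0\<close> is d\<omega>0 minus the wedge
      product of \<theta> and \<omega>0, which vanishes by the choice of \<open>\<theta>\<close>;
      likewise for \<open>m1\<close>. This is what makes the solution torsion-free.\<close>
    have m_sym: "m0 r u v = m0 r v u" "m1 r u v = m1 r v u" for u v
    proof -
      have "(m0 r u v - m0 r v u) * d r = (?D0 r u v - ?D0 r v u) * d r - (\<theta> r u * d r) * \<omega>0 r v + (\<theta> r v * d r) * \<omega>0 r u"
        by (simp add: m0_def algebra_simps)
      also have "\<dots> = ((u $ 1 * v $ 2 - u $ 2 * v $ 1) * d r) * k0 r - k0 r * (\<omega>0 r u * \<omega>1 r v - \<omega>0 r v * \<omega>1 r u)"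
        unfolding \<theta>d alt[OF lin0[OF r], of u v] k0_def by (simp add: algebra_simps)
      also have "\<dots> = 0" unfolding wedge by simp
      finally show "m0 r u v = m0 r v u" using d[OF r] by simp
      have "(m1 r u v - m1 r v u) * d r = (?D1 r u v - ?D1 r v u) * d r - (\<theta> r u * d r) * \<omega>1 r v + (\<theta> r v * d r) * \<omega>1 r u"
        by (simp add: m1_def algebra_simps)
      also have "\<dots> = ((u $ 1 * v $ 2 - u $ 2 * v $ 1) * d r) * k1 r - k1 r * (\<omega>0 r u * \<omega>1 r v - \<omega>0 r v * \<omega>1 r u)"
        unfolding \<theta>d alt[OF lin1[OF r], of u v] k1_def by (simp add: algebra_simps)
      also have "\<dots> = 0" unfolding wedge by simp
      finally show "m1 r u v = m1 r v u" using d[OF r] by simp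
    qed
    show "symmetric_pt (C r)" using C r by (simp add: symmetric_pt_def f_def m_sym)
    have \<omega>f: "\<omega>0 r (f r u v) = m0 r u v" "\<omega>1 r (f r u v) = m1 r u v" for u v
    proof -
      have "\<omega>0 r (f r u v) * d r = m0 r u v * d r" "\<omega>1 r (f r u v) * d r = m1 r u v * d r"
        using d[OF r] by (simp_all add: f_def blinfun.bilinear_simps distrib_right) (simp_all add: d_def algebra_simps)
      then show "\<omega>0 r (f r u v) = m0 r u v" "\<omega>1 r (f r u v) = m1 r u v" using d[OF r] by simp_all
    qed
    show "web_parallel_at (C r) F r"
      by (rule web_frame_parallelI[OF fr r, where \<theta> = "\<theta> r"]) (use C r in \<open>simp_all add: \<omega>f m0_def m1_def\<close>)
  qed
  ultimately show ?thesis by blast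
qed

text \<open>Pointwise uniqueness lets the global symbol be defined by description; near each point
  it coincides with the smooth local solution.\<close>

lemma web_christoffel_exists:
  assumes F: "F \<in> veronese_webs"
  shows "\<exists>C. smooth_on UNIV C \<and> (\<forall>q. symmetric_pt (C q) \<and> web_parallel_at (C q) F q)"
proof -
  have loc: "\<exists>U. \<exists>C. open U \<and> p \<in> U \<and> smooth_on U C \<and> (\<forall>r\<in>U. symmetric_pt (C r) \<and> web_parallel_at (C r) F r)" for p
  proof -
    obtain U \<omega>0 \<omega>1 where "p \<in> U" "web_frame U \<omega>0 \<omega>1 F" using web_frame_exists[OF F] by blast
    then show ?thesis using web_frame_christoffel[of U \<omega>0 \<omega>1 F] by (auto simp: web_frame_def)
  qed
  define C :: christoffel where "C q = (THE c. symmetric_pt c \<and> web_parallel_at c F q)" for q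
  have Ceq: "C q = c" if "symmetric_pt c" "web_parallel_at c F q" for q c
    unfolding C_def by (rule the_equality) (use that web_parallel_at_unique[OF F] in blast)+
  have "smooth_on UNIV C"
  proof (rule smooth_on_local)
    fix p
    obtain U and C' where U: "open U" "p \<in> U" "smooth_on U C'"
      and C': "\<forall>r\<in>U. symmetric_pt (C' r) \<and> web_parallel_at (C' r) F r"
      using loc[of p] by (elim exE conjE)
    have "C' r = C r" if "r \<in> U" for r using Ceq[of "C' r" r] C' that by simp
    then have "smooth_on U C" by (rule smooth_on_cong[OF U(1) _ U(3)])
    then show "\<exists>T. open T \<and> p \<in> T \<and> smooth_on T C" using U by blast
  qed
  moreover have "symmetric_pt (C q) \<and> web_parallel_at (C q) F q" for q
  proof -
    obtain U and C' where "q \<in> U"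
      and C': "\<forall>r\<in>U. symmetric_pt (C' r) \<and> web_parallel_at (C' r) F r"
      using loc[of q] by (elim exE conjE)
    then have c: "symmetric_pt (C' q) \<and> web_parallel_at (C' q) F q" by blast
    with Ceq[of "C' q" q] have "C q = C' q" by blast
    with c show ?thesis by simp
  qed
  ultimately show ?thesis by blast
qed

text \<open>Differentiating d\<omega> = \<omega> C + \<tau> \<omega> once more and antisymmetrising
  cancels the second derivatives of \<omega> and leaves \<omega>(R z) = \<kappa> \<omega>(z). Since
  \<open>\<tau>\<close> is the same for both forms, so is \<kappa> = -d\<tau>(e1,e2), and a coframe
  detects vectors.\<close>

lemma web_curv_scalar:
  assumes F: "F \<in> veronese_webs" and C: "smooth_on UNIV C" and par: "\<And>q. web_parallel_at (C q) F q"
  shows "\<exists>\<kappa>. \<forall>z. curv C p e1 e2 z = \<kappa> *\<^sub>R z"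
proof -
  obtain U \<omega>0 \<omega>1 where p: "p \<in> U" and fr: "web_frame U \<omega>0 \<omega>1 F" using web_frame_exists[OF F] by blast
  have U: "open U" "smooth_on U \<omega>0" "smooth_on U \<omega>1" using fr by (auto simp: web_frame_def)
  have "\<omega>0 p e1 \<noteq> 0 \<or> \<omega>0 p e2 \<noteq> 0" using fr p by (auto simp: web_frame_def)
  then obtain n where n: "\<omega>0 p n \<noteq> 0" by blast
  define V where "V = U \<inter> (\<lambda>r. \<omega>0 r n) -` (- {0})"
  have sn: "smooth_on U (\<lambda>r. \<omega>0 r n)" by (intro smooth_on_blinfun_apply smooth_on_const U)
  have V: "open V" "p \<in> V" "V \<subseteq> U"
    using continuous_open_preimage[OF smooth_on_continuous_on[OF sn] U(1), of "- {0}"] p n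
    by (simp_all add: V_def open_Compl)
  \<comment> \<open>\<open>web_frame_parallelD\<close> yields the factor only point by point.
    Evaluating on a vector \<open>n\<close> outside the kernel of \<omega>0 gives a formula for it
    that is visibly smooth near \<open>p\<close>.\<close>
  define \<tau> where "\<tau> r v = (frechet_derivative \<omega>0 (at r) v n - \<omega>0 r (C r v n)) / \<omega>0 r n" for r v
  have sV: "smooth_on V \<omega>0" "smooth_on V \<omega>1" "smooth_on V C"
    using smooth_on_subset[OF U(2) V(3)] smooth_on_subset[OF U(3) V(3)] smooth_on_subset[OF C subset_UNIV] by blast+
  have s\<tau>: "smooth_on V (\<lambda>r. \<tau> r v)" for v
    unfolding \<tau>_def
    by (intro smooth_on_divide smooth_on_diff smooth_on_blinfun_apply smooth_on_const smooth_on_frechet_derivative V sV)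
      (simp add: V_def)
  have \<tau>: "frechet_derivative \<omega>0 (at r) v z = \<omega>0 r (C r v z) + \<tau> r v * \<omega>0 r z"
    "frechet_derivative \<omega>1 (at r) v z = \<omega>1 r (C r v z) + \<tau> r v * \<omega>1 r z" if r: "r \<in> V" for r v z
  proof -
    have "r \<in> U" using V(3) r by blast
    from web_frame_parallelD[OF fr this par]
    obtain \<theta> where \<theta>: "\<And>v z. frechet_derivative \<omega>0 (at r) v z = \<omega>0 r (C r v z) + \<theta> v * \<omega>0 r z"
      "\<And>v z. frechet_derivative \<omega>1 (at r) v z = \<omega>1 r (C r v z) + \<theta> v * \<omega>1 r z" by blast
    have "\<tau> r v = \<theta> v" using r unfolding \<tau>_def \<theta>(1) by (simp add: V_def)
    then show "frechet_derivative \<omega>0 (at r) v z = \<omega>0 r (C r v z) + \<tau> r v * \<omega>0 r z"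
      "frechet_derivative \<omega>1 (at r) v z = \<omega>1 r (C r v z) + \<tau> r v * \<omega>1 r z" by (simp_all add: \<theta>)
  qed
  let ?T = "\<lambda>v h. frechet_derivative (\<lambda>r. \<tau> r v) (at p) h"
  let ?dC = "frechet_derivative C (at p)"
  define \<kappa> where "\<kappa> = ?T e1 e2 - ?T e2 e1"
  have key: "blinfun_apply (\<omega> p) (curv C p e1 e2 z) = \<kappa> * blinfun_apply (\<omega> p) z"
    if s: "smooth_on V \<omega>" and \<omega>: "\<And>r v z. r \<in> V \<Longrightarrow> blinfun_apply (frechet_derivative \<omega> (at r) v) z = blinfun_apply (\<omega> r) (C r v z) + \<tau> r v * blinfun_apply (\<omega> r) z"
    for \<omega> z
  proof -
    let ?g = "\<lambda>r. \<omega> r z"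
    have sg: "smooth_on V ?g" by (intro smooth_on_blinfun_apply smooth_on_const V s)
    have dg: "frechet_derivative ?g (at r) v = \<omega> r (C r v z) + \<tau> r v * \<omega> r z" if "r \<in> V" for r v
      using fun_cong[OF frechet_derivative_at[OF form_has_derivative[OF s that]], of v z] \<omega>[OF that] by simp
    have d2: "frechet_derivative (\<lambda>r. frechet_derivative ?g (at r) v) (at p) h =
        \<omega> p (?dC h v z) + frechet_derivative \<omega> (at p) h (C p v z) + (\<tau> p v * frechet_derivative \<omega> (at p) h z + ?T v h * \<omega> p z)" for v h
    proof -
      have dCv: "((\<lambda>r. C r v z) has_derivative (\<lambda>h. ?dC h v z)) (at p)"
        using has_derivative_blinfun_apply[OF has_derivative_blinfun_apply[OF smooth_on_has_derivative[OF C UNIV_I] has_derivative_const[of v]] has_derivative_const[of z]]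
        by (simp add: blinfun.bilinear_simps)
      have "((\<lambda>r. \<omega> r (C r v z) + \<tau> r v * \<omega> r z) has_derivative
        (\<lambda>h. (\<omega> p (?dC h v z) + frechet_derivative \<omega> (at p) h (C p v z)) + (\<tau> p v * frechet_derivative \<omega> (at p) h z + ?T v h * \<omega> p z))) (at p)"
        by (rule has_derivative_add[OF has_derivative_blinfun_apply[OF smooth_on_has_derivative[OF s V(2)] dCv]
              has_derivative_mult[OF smooth_on_has_derivative[OF s\<tau> V(2)] form_has_derivative[OF s V(2)]]])
      note eq = fun_cong[OF frechet_derivative_at[OF this], of h]
      have "frechet_derivative (\<lambda>r. frechet_derivative ?g (at r) v) (at p) =
          frechet_derivative (\<lambda>r. \<omega> r (C r v z) + \<tau> r v * \<omega> r z) (at p)"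
        by (rule frechet_derivative_cong_open[OF V(1,2) dg])
      then show ?thesis using eq by simp
    qed
    have "frechet_derivative (\<lambda>r. frechet_derivative ?g (at r) e2) (at p) e1 = frechet_derivative (\<lambda>r. frechet_derivative ?g (at r) e1) (at p) e2"
      by (rule second_derivative_symmetric[OF V(1) smooth_on_Ck[OF sg] V(2)])
    then show ?thesis
      unfolding d2 \<omega>[OF V(2)] by (simp add: curv_def blinfun.bilinear_simps \<kappa>_def algebra_simps)
  qed
  have "curv C p e1 e2 z - \<kappa> *\<^sub>R z = 0" for z
    by (rule web_frame_separates[OF fr p]; simp add: blinfun.bilinear_simps)
      (simp_all add: key[OF sV(1) \<tau>(1)] key[OF sV(2) \<tau>(2)])
  then have "\<forall>z. curv C p e1 e2 z = \<kappa> *\<^sub>R z" by simp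
  then show ?thesis by blast
qed

subsection \<open>Adapted coordinates\<close>

text \<open>The formula of \<open>conn_of\<close> without its smoothness guard, so that it can be
  applied to coordinate fields, which are smooth only on the chart domain.\<close>

definition cov :: "christoffel \<Rightarrow> vector_field \<Rightarrow> vector_field \<Rightarrow> vector_field" where
  "cov C A B p = frechet_derivative B (at p) (A p) + C p (A p) (B p)"

lemma conn_of_germ:
  assumes "smooth_on UNIV A'" "smooth_on UNIV B'" "\<forall>\<^sub>F q in nhds p. A' q = A q \<and> B' q = B q"
  shows "conn_of C A' B' p = cov C A B p"
proof -
  obtain S where S: "open S" "p \<in> S" "\<forall>q\<in>S. A' q = A q \<and> B' q = B q"
    using assms(3) unfolding eventually_nhds by blast
  have "frechet_derivative B' (at p) = frechet_derivative B (at p)"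
    by (rule frechet_derivative_cong_open[OF S(1,2)]) (use S(3) in blast)
  with S assms(1,2) show ?thesis by (simp add: conn_of_def cov_def)
qed

definition differential :: "(real^2 \<Rightarrow> real) \<Rightarrow> one_form" where
  "differential f r = Blinfun (frechet_derivative f (at r))"

lemma differential_apply:
  "smooth_on U f \<Longrightarrow> r \<in> U \<Longrightarrow> differential f r v = frechet_derivative f (at r) v"
  unfolding differential_def
  by (rule fun_cong[OF bounded_linear_Blinfun_apply[OF has_derivative_bounded_linear[OF smooth_on_has_derivative]]])

lemma smooth_on_differential: "open U \<Longrightarrow> smooth_on U f \<Longrightarrow> smooth_on U (differential f)"
  by (rule smooth_on_blinfun, assumption, rule smooth_on_cong[OF _ _ smooth_on_frechet_derivative])
    (simp_all add: differential_apply)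

lemma represents_differential:
  assumes "open U" "smooth_on U f" "\<And>r. r \<in> U \<Longrightarrow> T r = ker_d f r" "\<And>r. r \<in> U \<Longrightarrow> \<exists>v. frechet_derivative f (at r) v \<noteq> 0"
  shows "represents U (differential f) T"
  unfolding represents_def
proof (intro conjI ballI assms(1) smooth_on_differential assms(2))
  fix r assume r: "r \<in> U"
  show "T r = {v. differential f r v = 0}"
    unfolding assms(3)[OF r] ker_d_def differential_apply[OF assms(2) r] ..
  obtain v where "frechet_derivative f (at r) v \<noteq> 0" using assms(4)[OF r] by (rule exE)
  then have "differential f r v \<noteq> 0" unfolding differential_apply[OF assms(2) r] .
  then show "differential f r \<noteq> 0" by auto
qed

text \<open>Differentiating \<alpha>(B) = 0 shows that a field tangent to a parallel foliation stays
  tangent to it under covariant differentiation in every direction.\<close>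

lemma parallel_at_annihilates:
  assumes "represents U \<alpha> T" "q \<in> U" "parallel_at c \<alpha> q" "smooth_on U B" "\<And>r. r \<in> U \<Longrightarrow> \<alpha> r (B r) = 0"
  shows "\<alpha> q (frechet_derivative B (at q) v + c v (B q)) = 0"
proof -
  have U: "open U" "smooth_on U \<alpha>" using assms(1) by (auto simp: represents_def)
  have "((\<lambda>r. \<alpha> r (B r)) has_derivative (\<lambda>h. \<alpha> q (frechet_derivative B (at q) h) + frechet_derivative \<alpha> (at q) h (B q))) (at q)"
    by (rule has_derivative_blinfun_apply[OF smooth_on_has_derivative[OF U(2) assms(2)] smooth_on_has_derivative[OF assms(4,2)]])
  moreover have "((\<lambda>r. \<alpha> r (B r)) has_derivative (\<lambda>h. 0)) (at q)"
    by (rule has_derivative_transform_within_open[OF has_derivative_const U(1) assms(2)]) (simp add: assms(5))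
  ultimately have "\<alpha> q (frechet_derivative B (at q) v) + frechet_derivative \<alpha> (at q) v (B q) = 0"
    by (rule fun_cong[OF has_derivative_unique])
  moreover have "frechet_derivative \<alpha> (at q) v (B q) = \<alpha> q (c v (B q))"
    using assms(3) assms(5)[OF assms(2)] unfolding parallel_at_def by blast
  ultimately show ?thesis by (simp add: blinfun.add_right)
qed

lemma chart_inverse_derivative:
  assumes "chart U \<phi>" "q \<in> U"
  shows "frechet_derivative \<phi> (at q) (frechet_derivative (the_inv_into U \<phi>) (at (\<phi> q)) h) = h"
    and "frechet_derivative (the_inv_into U \<phi>) (at (\<phi> q)) (frechet_derivative \<phi> (at q) h) = h"
proof -
  let ?\<psi> = "the_inv_into U \<phi>"
  have U: "open U" "inj_on \<phi> U" "smooth_on U \<phi>" "open (\<phi> ` U)" "smooth_on (\<phi> ` U) ?\<psi>"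
    using assms(1) by (auto simp: chart_def)
  have \<psi>\<phi>: "?\<psi> (\<phi> r) = r" if "r \<in> U" for r by (rule the_inv_into_f_f[OF U(2) that])
  have \<phi>\<psi>: "\<phi> (?\<psi> z) = z" if "z \<in> \<phi> ` U" for z by (rule f_the_inv_into_f[OF U(2) that])
  note d\<phi> = smooth_on_has_derivative[OF U(3) assms(2)]
  note d\<psi> = smooth_on_has_derivative[OF U(5) imageI[OF assms(2)]]
  have "((\<lambda>z. \<phi> (?\<psi> z)) has_derivative (\<lambda>h. frechet_derivative \<phi> (at (?\<psi> (\<phi> q))) (frechet_derivative ?\<psi> (at (\<phi> q)) h))) (at (\<phi> q))"
    by (rule has_derivative_compose[OF d\<psi>]) (simp add: \<psi>\<phi>[OF assms(2)] d\<phi>)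
  moreover have "((\<lambda>z. \<phi> (?\<psi> z)) has_derivative (\<lambda>h. h)) (at (\<phi> q))"
    by (rule has_derivative_transform_within_open[OF has_derivative_ident U(4) imageI[OF assms(2)]]) (simp add: \<phi>\<psi>)
  ultimately show "frechet_derivative \<phi> (at q) (frechet_derivative ?\<psi> (at (\<phi> q)) h) = h"
    using fun_cong[OF has_derivative_unique] unfolding \<psi>\<phi>[OF assms(2)] by blast
  have "((\<lambda>r. ?\<psi> (\<phi> r)) has_derivative (\<lambda>h. frechet_derivative ?\<psi> (at (\<phi> q)) (frechet_derivative \<phi> (at q) h))) (at q)"
    by (rule has_derivative_compose[OF d\<phi> d\<psi>])
  moreover have "((\<lambda>r. ?\<psi> (\<phi> r)) has_derivative (\<lambda>h. h)) (at q)"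
    by (rule has_derivative_transform_within_open[OF has_derivative_ident U(1) assms(2)]) (simp add: \<psi>\<phi>)
  ultimately show "frechet_derivative ?\<psi> (at (\<phi> q)) (frechet_derivative \<phi> (at q) h) = h"
    by (rule fun_cong[OF has_derivative_unique])
qed

text \<open>Coordinate fields are the partial derivatives of the inverse chart. The third claim is
  the vanishing of their bracket, which is the symmetry of its second derivatives.\<close>

lemma coord_field_props:
  assumes "chart U \<phi>"
  shows "smooth_on U (coord_field U \<phi> i)"
    and "q \<in> U \<Longrightarrow> frechet_derivative \<phi> (at q) (coord_field U \<phi> i q) = axis i 1"
    and "q \<in> U \<Longrightarrow> frechet_derivative (coord_field U \<phi> i) (at q) (coord_field U \<phi> j q) =
      frechet_derivative (coord_field U \<phi> j) (at q) (coord_field U \<phi> i q)"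
    and "q \<in> U \<Longrightarrow> v = (frechet_derivative \<phi> (at q) v $ 1) *\<^sub>R coord_field U \<phi> 1 q + (frechet_derivative \<phi> (at q) v $ 2) *\<^sub>R coord_field U \<phi> 2 q"
proof -
  let ?\<psi> = "the_inv_into U \<phi>"
  have U: "open U" "smooth_on U \<phi>" "open (\<phi> ` U)" "smooth_on (\<phi> ` U) ?\<psi>"
    using assms by (auto simp: chart_def)
  show "smooth_on U (coord_field U \<phi> i)"
    unfolding coord_field_def
    by (rule smooth_on_compose[OF U(1,3) smooth_on_frechet_derivative[OF U(4)] U(2) order_refl])
  show d\<phi>: "frechet_derivative \<phi> (at q) (coord_field U \<phi> i q) = axis i 1" if "q \<in> U" for i
    unfolding coord_field_def by (rule chart_inverse_derivative(1)[OF assms that])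
  have "frechet_derivative (coord_field U \<phi> i) (at q) h = frechet_derivative (\<lambda>z. frechet_derivative ?\<psi> (at z) (axis i 1)) (at (\<phi> q)) (frechet_derivative \<phi> (at q) h)"
    if "q \<in> U" for i h
    using fun_cong[OF frechet_derivative_at[OF has_derivative_compose[OF smooth_on_has_derivative[OF U(2) that]
            smooth_on_has_derivative[OF smooth_on_frechet_derivative[OF U(4)] imageI[OF that]]]], of "axis i 1" h]
    by (simp add: coord_field_def[abs_def])
  then show "frechet_derivative (coord_field U \<phi> i) (at q) (coord_field U \<phi> j q) =
      frechet_derivative (coord_field U \<phi> j) (at q) (coord_field U \<phi> i q)" if "q \<in> U"
    using second_derivative_symmetric_vec[OF U(3,4) imageI[OF that]] by (simp add: d\<phi>[OF that] that)
  show "v = (frechet_derivative \<phi> (at q) v $ 1) *\<^sub>R coord_field U \<phi> 1 q + (frechet_derivative \<phi> (at q) v $ 2) *\<^sub>R coord_field U \<phi> 2 q"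
    if "q \<in> U"
    unfolding coord_field_def
      linear_vec2[OF has_derivative_linear[OF smooth_on_has_derivative[OF U(4) imageI[OF that]]], of "frechet_derivative \<phi> (at q) v", symmetric]
    by (rule chart_inverse_derivative(2)[OF assms that, symmetric])
qed

text \<open>\<open>\<nabla>\<^sub>X Y\<close> is killed by \<open>dx\<close> and \<open>dy\<close>; the coefficients of \<open>\<nabla>\<^sub>X X\<close> and \<open>\<nabla>\<^sub>Y Y\<close> are found by
  differentiating \<open>dw V = 0\<close> for the field \<open>V = w\<^sub>y X - w\<^sub>x Y\<close> tangent to the third foliation.\<close>

lemma adapted_coords_cov:
  assumes ad: "adapted_coords F t0 U \<phi> w" and q: "q \<in> U"
    and sym: "symmetric_pt (C q)" and par: "web_parallel_at (C q) F q"
  shows "cov C (coord_field U \<phi> 1) (coord_field U \<phi> 1) q = christoffel_x w (\<phi> q) *\<^sub>R coord_field U \<phi> 1 q"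
    and "cov C (coord_field U \<phi> 2) (coord_field U \<phi> 2) q = christoffel_y w (\<phi> q) *\<^sub>R coord_field U \<phi> 2 q"
    and "cov C (coord_field U \<phi> 1) (coord_field U \<phi> 2) q = 0"
    and "cov C (coord_field U \<phi> 2) (coord_field U \<phi> 1) q = 0"
proof -
  let ?X = "coord_field U \<phi> 1" and ?Y = "coord_field U \<phi> 2"
  have ch: "chart U \<phi>" and w: "smooth_on (\<phi> ` U) w" and nz: "\<And>z. z \<in> \<phi> ` U \<Longrightarrow> pd 1 w z \<noteq> 0 \<and> pd 2 w z \<noteq> 0"
    and F: "\<And>q. q \<in> U \<Longrightarrow> F (hpoint 1 0) q = ker_d (\<lambda>r. \<phi> r $ 1) q"
      "\<And>q. q \<in> U \<Longrightarrow> F (hpoint 0 1) q = ker_d (\<lambda>r. \<phi> r $ 2) q"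
      "\<And>q. q \<in> U \<Longrightarrow> F (hpoint 1 t0) q = ker_d (\<lambda>r. w (\<phi> r)) q"
    using ad unfolding adapted_coords_def by blast+
  have U: "open U" "smooth_on U \<phi>" "open (\<phi> ` U)" using ch by (auto simp: chart_def)
  have sX: "smooth_on U ?X" and sY: "smooth_on U ?Y" by (rule coord_field_props(1)[OF ch])+
  have d\<phi>: "frechet_derivative \<phi> (at r) (?X r) = e1" "frechet_derivative \<phi> (at r) (?Y r) = e2" if "r \<in> U" for r
    by (rule coord_field_props(2)[OF ch that])+
  have s\<phi>: "smooth_on U (\<lambda>r. \<phi> r $ i)" for i by (rule smooth_on_vec_nth[OF U(1,2)])
  have sW: "smooth_on U (\<lambda>r. w (\<phi> r))" by (rule smooth_on_compose[OF U(1,3) w U(2) order_refl])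
  have spd: "smooth_on (\<phi> ` U) (pd i w)" for i unfolding pd_def by (rule smooth_on_frechet_derivative[OF w])
  have D\<phi>: "frechet_derivative (\<lambda>r. \<phi> r $ i) (at r) h = frechet_derivative \<phi> (at r) h $ i" if "r \<in> U" for i r h
    by (rule frechet_derivative_vec_nth[OF smooth_on_differentiable[OF U(2) that]])
  have Dcomp: "frechet_derivative (\<lambda>r. g (\<phi> r)) (at r) h = frechet_derivative g (at (\<phi> r)) (frechet_derivative \<phi> (at r) h)"
    if "r \<in> U" "smooth_on (\<phi> ` U) g" for g :: "real^2 \<Rightarrow> real" and r h
    using fun_cong[OF frechet_derivative_at[OF has_derivative_compose[OF smooth_on_has_derivative[OF U(2) that(1)]
          smooth_on_has_derivative[OF that(2) imageI[OF that(1)]]]], of h] by simp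
  have DW: "frechet_derivative (\<lambda>r. w (\<phi> r)) (at r) (?X r) = pd 1 w (\<phi> r)"
    "frechet_derivative (\<lambda>r. w (\<phi> r)) (at r) (?Y r) = pd 2 w (\<phi> r)" if "r \<in> U" for r
    unfolding Dcomp[OF that w] d\<phi>[OF that] pd_def by (rule refl)+
  have rx: "represents U (differential (\<lambda>r. \<phi> r $ 1)) (F (hpoint 1 0))"
  proof (rule represents_differential[OF U(1) s\<phi> F(1)])
    show "\<exists>v. frechet_derivative (\<lambda>r. \<phi> r $ 1) (at r) v \<noteq> 0" if "r \<in> U" for r
      by (rule exI[of _ "?X r"]) (simp add: D\<phi>[OF that] d\<phi>[OF that])
  qed
  have ry: "represents U (differential (\<lambda>r. \<phi> r $ 2)) (F (hpoint 0 1))"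
  proof (rule represents_differential[OF U(1) s\<phi> F(2)])
    show "\<exists>v. frechet_derivative (\<lambda>r. \<phi> r $ 2) (at r) v \<noteq> 0" if "r \<in> U" for r
      by (rule exI[of _ "?Y r"]) (simp add: D\<phi>[OF that] d\<phi>[OF that])
  qed
  have rw: "represents U (differential (\<lambda>r. w (\<phi> r))) (F (hpoint 1 t0))"
  proof (rule represents_differential[OF U(1) sW F(3)])
    show "\<exists>v. frechet_derivative (\<lambda>r. w (\<phi> r)) (at r) v \<noteq> 0" if "r \<in> U" for r
      by (rule exI[of _ "?X r"]) (use nz[OF imageI[OF that]] in \<open>simp add: DW(1)[OF that]\<close>)
  qed
  have px: "parallel_at (C q) (differential (\<lambda>r. \<phi> r $ 1)) q"
    and py: "parallel_at (C q) (differential (\<lambda>r. \<phi> r $ 2)) q"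
    and pw: "parallel_at (C q) (differential (\<lambda>r. w (\<phi> r))) q"
    using par rx ry rw q unfolding web_parallel_at_def by blast+
  \<comment> \<open>The field \<open>?Y\<close> is tangent to the foliation ker dx, so its covariant
    derivatives have no \<open>?X\<close> component; \<open>y0\<close> is the mirror
    statement.\<close>
  have x0: "frechet_derivative \<phi> (at q) (cov C A ?Y q) $ 1 = 0" for A
    unfolding cov_def D\<phi>[OF q, symmetric] differential_apply[OF s\<phi> q, symmetric]
    by (rule parallel_at_annihilates[OF rx q px sY]) (simp add: differential_apply[OF s\<phi>] D\<phi> d\<phi>)
  have y0: "frechet_derivative \<phi> (at q) (cov C A ?X q) $ 2 = 0" for A
    unfolding cov_def D\<phi>[OF q, symmetric] differential_apply[OF s\<phi> q, symmetric]
    by (rule parallel_at_annihilates[OF ry q py sX]) (simp add: differential_apply[OF s\<phi>] D\<phi> d\<phi>)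
  \<comment> \<open>Zero torsion and commuting coordinate fields identify the two mixed derivatives,
    so the common value is tangent to two transversal foliations and vanishes.\<close>
  have comm: "cov C ?X ?Y q = cov C ?Y ?X q"
    using coord_field_props(3)[OF ch q, of 2 1] sym by (simp add: cov_def symmetric_pt_def)
  have basis: "v = (frechet_derivative \<phi> (at q) v $ 1) *\<^sub>R ?X q + (frechet_derivative \<phi> (at q) v $ 2) *\<^sub>R ?Y q" for v
    by (rule coord_field_props(4)[OF ch q])
  have XY: "cov C ?X ?Y q = 0"
    using basis[of "cov C ?X ?Y q"] x0[of ?X] y0[of ?Y] comm by simp
  then have YX: "cov C ?Y ?X q = 0" using comm by simp
  define a where "a = frechet_derivative \<phi> (at q) (cov C ?X ?X q) $ 1"
  define b where "b = frechet_derivative \<phi> (at q) (cov C ?Y ?Y q) $ 2"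
  have XX: "cov C ?X ?X q = a *\<^sub>R ?X q" using basis[of "cov C ?X ?X q"] y0[of ?X] by (simp add: a_def)
  have YY: "cov C ?Y ?Y q = b *\<^sub>R ?Y q" using basis[of "cov C ?Y ?Y q"] x0[of ?Y] by (simp add: b_def)
  define V where "V r = pd 2 w (\<phi> r) *\<^sub>R ?X r - pd 1 w (\<phi> r) *\<^sub>R ?Y r" for r
  have spd\<phi>: "smooth_on U (\<lambda>r. pd i w (\<phi> r))" for i
    by (rule smooth_on_compose[OF U(1,3) spd U(2) order_refl])
  have sV: "smooth_on U V"
    unfolding V_def by (intro smooth_on_diff smooth_on_scaleR U(1) sX sY spd\<phi>)
  let ?W = "differential (\<lambda>r. w (\<phi> r))"
  have WX: "?W r (?X r) = pd 1 w (\<phi> r)" "?W r (?Y r) = pd 2 w (\<phi> r)" if "r \<in> U" for r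
    by (simp_all add: differential_apply[OF sW that] DW[OF that])
  have WV: "?W r (V r) = 0" if "r \<in> U" for r
    by (simp add: V_def blinfun.bilinear_simps WX[OF that])
  have dV: "frechet_derivative V (at q) v =
      (pd 2 w (\<phi> q) *\<^sub>R frechet_derivative ?X (at q) v + frechet_derivative (pd 2 w) (at (\<phi> q)) (frechet_derivative \<phi> (at q) v) *\<^sub>R ?X q)
      - (pd 1 w (\<phi> q) *\<^sub>R frechet_derivative ?Y (at q) v + frechet_derivative (pd 1 w) (at (\<phi> q)) (frechet_derivative \<phi> (at q) v) *\<^sub>R ?Y q)" for v
  proof -
    have "(V has_derivative (\<lambda>v. (pd 2 w (\<phi> q) *\<^sub>R frechet_derivative ?X (at q) v + frechet_derivative (\<lambda>r. pd 2 w (\<phi> r)) (at q) v *\<^sub>R ?X q)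
      - (pd 1 w (\<phi> q) *\<^sub>R frechet_derivative ?Y (at q) v + frechet_derivative (\<lambda>r. pd 1 w (\<phi> r)) (at q) v *\<^sub>R ?Y q))) (at q)"
      unfolding V_def[abs_def]
      by (intro has_derivative_diff has_derivative_scaleR smooth_on_has_derivative[OF sX q] smooth_on_has_derivative[OF sY q]
          smooth_on_has_derivative[OF spd\<phi> q])
    from fun_cong[OF frechet_derivative_at[OF this], of v] show ?thesis by (simp add: Dcomp[OF q spd])
  qed
  have covV: "cov C A V q = pd 2 w (\<phi> q) *\<^sub>R cov C A ?X q + frechet_derivative (pd 2 w) (at (\<phi> q)) (frechet_derivative \<phi> (at q) (A q)) *\<^sub>R ?X q
      - (pd 1 w (\<phi> q) *\<^sub>R cov C A ?Y q + frechet_derivative (pd 1 w) (at (\<phi> q)) (frechet_derivative \<phi> (at q) (A q)) *\<^sub>R ?Y q)" for A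
    unfolding cov_def dV by (simp add: V_def blinfun.bilinear_simps algebra_simps)
  have W0: "?W q (cov C A V q) = 0" for A
    unfolding cov_def by (rule parallel_at_annihilates[OF rw q pw sV WV])
  have pdpd: "frechet_derivative (pd i w) (at (\<phi> q)) (axis j 1) = pd j (pd i w) (\<phi> q)" for i j by (simp add: pd_def)
  have pd_sym: "pd 1 (pd 2 w) (\<phi> q) = pd 2 (pd 1 w) (\<phi> q)"
    unfolding pd_def by (rule second_derivative_symmetric[OF U(3) smooth_on_Ck[OF w] imageI[OF q]])
  have nzq: "pd 1 w (\<phi> q) \<noteq> 0" "pd 2 w (\<phi> q) \<noteq> 0" using nz[OF imageI[OF q]] by blast+
  have "pd 2 w (\<phi> q) * (a * pd 1 w (\<phi> q)) + pd 2 (pd 1 w) (\<phi> q) * pd 1 w (\<phi> q) - pd 1 (pd 1 w) (\<phi> q) * pd 2 w (\<phi> q) = 0"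
    using W0[of ?X] unfolding covV XX XY d\<phi>[OF q] pdpd pd_sym by (simp add: blinfun.bilinear_simps WX[OF q])
  then have "a * (pd 1 w (\<phi> q) * pd 2 w (\<phi> q)) = pd 2 w (\<phi> q) * pd 1 (pd 1 w) (\<phi> q) - pd 1 w (\<phi> q) * pd 2 (pd 1 w) (\<phi> q)"
    by (simp add: algebra_simps)
  then have "a = christoffel_x w (\<phi> q)" unfolding christoffel_x_def using nzq by (simp add: nonzero_eq_divide_eq)
  then show "cov C ?X ?X q = christoffel_x w (\<phi> q) *\<^sub>R ?X q" using XX by simp
  have "pd 2 (pd 2 w) (\<phi> q) * pd 1 w (\<phi> q) - (pd 1 w (\<phi> q) * (b * pd 2 w (\<phi> q)) + pd 2 (pd 1 w) (\<phi> q) * pd 2 w (\<phi> q)) = 0"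
    using W0[of ?Y] unfolding covV YY YX d\<phi>[OF q] pdpd by (simp add: blinfun.bilinear_simps WX[OF q])
  then have "b * (pd 1 w (\<phi> q) * pd 2 w (\<phi> q)) = pd 1 w (\<phi> q) * pd 2 (pd 2 w) (\<phi> q) - pd 2 w (\<phi> q) * pd 2 (pd 1 w) (\<phi> q)"
    by (simp add: algebra_simps)
  then have "b = christoffel_y w (\<phi> q)" unfolding christoffel_y_def using nzq by (simp add: nonzero_eq_divide_eq)
  then show "cov C ?Y ?Y q = christoffel_y w (\<phi> q) *\<^sub>R ?Y q" using YY by simp
  show "cov C ?X ?Y q = 0" "cov C ?Y ?X q = 0" using XY YX by simp_all
qed

text \<open>Parallelism mentions neither t0 nor a chart nor w, so a single \<open>C\<close> meets
  the requirement in all adapted coordinates simultaneously. This is the independence of choices in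
  the definition of the web connection.\<close>

lemma is_web_connection_conn_of:
  assumes C: "smooth_on UNIV C" and sym: "\<And>q. symmetric_pt (C q)" and par: "\<And>q. web_parallel_at (C q) F q"
  shows "is_web_connection F (conn_of C)"
  unfolding is_web_connection_def Let_def
proof (intro conjI allI impI linear_connection_conn_of C)
  fix t0 U \<phi> w assume ad: "adapted_coords F t0 U \<phi> w"
  have "cov_deriv_on (conn_of C) U A B Z" if "\<And>p. p \<in> U \<Longrightarrow> cov C A B p = Z p" for A B Z
    unfolding cov_deriv_on_def
  proof (intro ballI allI impI)
    fix p A' B' assume "p \<in> U" "smooth_on UNIV A'" "smooth_on UNIV B'" "\<forall>\<^sub>F q in nhds p. A' q = A q \<and> B' q = B q"
    then show "conn_of C A' B' p = Z p" using conn_of_germ[of A' B' A B p C] that[of p] by simp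
  qed
  note I = this and K = adapted_coords_cov[OF ad _ sym par]
  show "cov_deriv_on (conn_of C) U (coord_field U \<phi> 1) (coord_field U \<phi> 1) (\<lambda>q. christoffel_x w (\<phi> q) *\<^sub>R coord_field U \<phi> 1 q)"
    by (rule I[OF K(1)])
  show "cov_deriv_on (conn_of C) U (coord_field U \<phi> 2) (coord_field U \<phi> 2) (\<lambda>q. christoffel_y w (\<phi> q) *\<^sub>R coord_field U \<phi> 2 q)"
    by (rule I[OF K(2)])
  show "cov_deriv_on (conn_of C) U (coord_field U \<phi> 1) (coord_field U \<phi> 2) (\<lambda>_. 0)"
    by (rule I[OF K(3)])
  show "cov_deriv_on (conn_of C) U (coord_field U \<phi> 2) (coord_field U \<phi> 1) (\<lambda>_. 0)"
    by (rule I[OF K(4)])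
qed

lemma web_transversal:
  assumes F: "F \<in> veronese_webs" and v: "v \<in> F (hpoint s t) q" "v \<in> F (hpoint s' t') q" and st: "s * t' - s' * t \<noteq> 0"
  shows "v = 0"
proof -
  obtain U \<omega>0 \<omega>1 where q: "q \<in> U" and fr: "web_frame U \<omega>0 \<omega>1 F" using web_frame_exists[OF F] by blast
  have "(s, t) \<noteq> (0, 0)" "(s', t') \<noteq> (0, 0)" using st by auto
  then have a: "s * \<omega>0 q v + t * \<omega>1 q v = 0" "s' * \<omega>0 q v + t' * \<omega>1 q v = 0"
    using v fr q unfolding web_frame_def by blast+
  have "(s * t' - s' * t) * \<omega>0 q v = 0" "(s * t' - s' * t) * \<omega>1 q v = 0" using a by algebra+
  with st have "\<omega>0 q v = 0" "\<omega>1 q v = 0" by simp_all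
  then show ?thesis by (rule web_frame_separates[OF fr q])
qed

text \<open>Local first integrals of the foliations at (1:0) and (0:1) form a chart because their
  kernels are transversal, and a first integral of the one at (1:1), read in this chart, is
  \<open>w\<close>. Without such coordinates around every point the defining condition could not
  determine the connection.\<close>

lemma adapted_coords_exist:
  assumes F: "F \<in> veronese_webs"
  shows "\<exists>U \<phi> w. p \<in> U \<and> adapted_coords F 1 U \<phi> w"
proof -
  have fol: "\<exists>U f. open U \<and> p \<in> U \<and> smooth_on U f \<and> (\<forall>q\<in>U. F P q = ker_d f q)" for P
  proof -
    have "foliation (F P)" using F unfolding veronese_webs_def by blast
    then show ?thesis unfolding foliation_def by meson
  qed
  obtain U0 f0 where 0: "open U0" "p \<in> U0" "smooth_on U0 f0" "\<forall>q\<in>U0. F (hpoint 1 0) q = ker_d f0 q" using fol by blast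
  obtain U1 f1 where 1: "open U1" "p \<in> U1" "smooth_on U1 f1" "\<forall>q\<in>U1. F (hpoint 0 1) q = ker_d f1 q" using fol by blast
  obtain U2 f2 where 2: "open U2" "p \<in> U2" "smooth_on U2 f2" "\<forall>q\<in>U2. F (hpoint 1 1) q = ker_d f2 q" using fol by blast
  define U where "U = U0 \<inter> U1 \<inter> U2"
  have U: "open U" "p \<in> U" using 0 1 2 by (auto simp: U_def)
  have s: "smooth_on U f0" "smooth_on U f1" "smooth_on U f2"
    by (rule smooth_on_subset[OF 0(3)] smooth_on_subset[OF 1(3)] smooth_on_subset[OF 2(3)], force simp: U_def)+
  define \<phi> :: "real^2 \<Rightarrow> real^2" where "\<phi> q = vector [f0 q, f1 q]" for q
  have \<phi>_nth: "\<phi> q $ 1 = f0 q" "\<phi> q $ 2 = f1 q" for q by (simp_all add: \<phi>_def)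
  have s\<phi>: "smooth_on U \<phi>"
  proof (rule smooth_on_vec[OF U(1)])
    fix i :: 2
    show "smooth_on U (\<lambda>q. \<phi> q $ i)" using exhaust_2[of i] s by (auto simp: \<phi>_nth)
  qed
  have D\<phi>: "frechet_derivative \<phi> (at q) v $ 1 = frechet_derivative f0 (at q) v"
    "frechet_derivative \<phi> (at q) v $ 2 = frechet_derivative f1 (at q) v" if "q \<in> U" for q v
    using frechet_derivative_vec_nth[OF smooth_on_differentiable[OF s\<phi> that], of 1 v]
      frechet_derivative_vec_nth[OF smooth_on_differentiable[OF s\<phi> that], of 2 v] by (simp_all add: \<phi>_nth)
  have ker: "v \<in> F (hpoint 1 0) q \<longleftrightarrow> frechet_derivative f0 (at q) v = 0"
    "v \<in> F (hpoint 0 1) q \<longleftrightarrow> frechet_derivative f1 (at q) v = 0"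
    "v \<in> F (hpoint 1 1) q \<longleftrightarrow> frechet_derivative f2 (at q) v = 0" if "q \<in> U" for q v
    using 0(4) 1(4) 2(4) that by (auto simp: U_def ker_d_def)
  have "inj (frechet_derivative \<phi> (at p))"
  proof -
    have lin: "linear (frechet_derivative \<phi> (at p))"
      by (rule has_derivative_linear[OF smooth_on_has_derivative[OF s\<phi> U(2)]])
    have "v = 0" if "frechet_derivative \<phi> (at p) v = 0" for v
    proof (rule web_transversal[OF F, of v 1 0 p 0 1])
      show "v \<in> F (hpoint 1 0) p" "v \<in> F (hpoint 0 1) p"
        using D\<phi>[OF U(2), of v] that by (simp_all add: ker[OF U(2)])
    qed simp
    then show ?thesis using linear_injective_0[OF lin] by blast
  qed
  from smooth_local_inverse[OF U s\<phi> this]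
  obtain U' where U': "p \<in> U'" "U' \<subseteq> U" "chart U' \<phi>" by blast
  let ?\<psi> = "the_inv_into U' \<phi>"
  have ch: "open U'" "inj_on \<phi> U'" "open (\<phi> ` U')" "smooth_on (\<phi> ` U') ?\<psi>" using U'(3) by (auto simp: chart_def)
  have \<psi>\<phi>: "?\<psi> (\<phi> r) = r" if "r \<in> U'" for r by (rule the_inv_into_f_f[OF ch(2) that])
  define w where "w z = f2 (?\<psi> z)" for z
  have sub: "?\<psi> ` (\<phi> ` U') \<subseteq> U" using \<psi>\<phi> U'(2) by auto
  have w: "smooth_on (\<phi> ` U') w"
    unfolding w_def by (rule smooth_on_compose[OF ch(3) U(1) s(3) ch(4) sub])
  have pdw: "pd i w (\<phi> q) = frechet_derivative f2 (at q) (coord_field U' \<phi> i q)" if "q \<in> U'" for i q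
  proof -
    have qU: "?\<psi> (\<phi> q) \<in> U" using \<psi>\<phi>[OF that] that U'(2) by auto
    from fun_cong[OF frechet_derivative_at[OF has_derivative_compose[OF smooth_on_has_derivative[OF ch(4) imageI[OF that]]
          smooth_on_has_derivative[OF s(3) qU]]], of "axis i 1"]
    show ?thesis by (simp add: pd_def w_def[abs_def] \<psi>\<phi>[OF that] coord_field_def)
  qed
  have d\<phi>: "frechet_derivative \<phi> (at q) (coord_field U' \<phi> i q) = axis i 1" if "q \<in> U'" for i q
    by (rule coord_field_props(2)[OF U'(3) that])
  \<comment> \<open>Each coordinate field is nonzero and tangent to one of the first two foliations,
    so by transversality it is not tangent to the third.\<close>
  have pd_nz: "pd 1 w (\<phi> q) \<noteq> 0 \<and> pd 2 w (\<phi> q) \<noteq> 0" if q: "q \<in> U'" for q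
  proof -
    have qU: "q \<in> U" using q U'(2) by blast
    have "coord_field U' \<phi> i q \<noteq> 0" for i
    proof
      assume "coord_field U' \<phi> i q = 0"
      then have "axis i 1 = frechet_derivative \<phi> (at q) 0" using d\<phi>[OF q, of i] by simp
      then show False
        using linear_0[OF has_derivative_linear[OF smooth_on_has_derivative[OF s\<phi> qU]]] by (simp add: axis_eq_0_iff)
    qed
    moreover have "coord_field U' \<phi> 1 q \<in> F (hpoint 0 1) q" "coord_field U' \<phi> 2 q \<in> F (hpoint 1 0) q"
      using D\<phi>[OF qU] d\<phi>[OF q] by (simp_all add: ker[OF qU] flip: D\<phi>[OF qU])
    ultimately show ?thesis
      using web_transversal[OF F, of "coord_field U' \<phi> 1 q" 0 1 q 1 1] web_transversal[OF F, of "coord_field U' \<phi> 2 q" 1 0 q 1 1]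
      unfolding pdw[OF q] by (auto simp: ker(3)[OF qU])
  qed
  have "F (hpoint 1 1) q = ker_d (\<lambda>r. w (\<phi> r)) q" if "q \<in> U'" for q
  proof -
    have "frechet_derivative (\<lambda>r. w (\<phi> r)) (at q) = frechet_derivative f2 (at q)"
      by (rule frechet_derivative_cong_open[OF ch(1) that]) (simp add: w_def \<psi>\<phi>)
    then show ?thesis using 2(4) that U'(2) by (auto simp: U_def ker_d_def)
  qed
  moreover have "F (hpoint 1 0) q = ker_d (\<lambda>r. \<phi> r $ 1) q" "F (hpoint 0 1) q = ker_d (\<lambda>r. \<phi> r $ 2) q" if "q \<in> U'" for q
    using 0(4) 1(4) that U'(2) unfolding \<phi>_nth by (auto simp: U_def)
  ultimately have "adapted_coords F 1 U' \<phi> w"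
    unfolding adapted_coords_def using U'(3) w pd_nz by blast
  with U'(1) show ?thesis by blast
qed

text \<open>Global extensions of the coordinate germs are fed to both connections. The derivative
  terms coincide, so the Christoffel symbols agree on a basis of the tangent plane and hence
  everywhere.\<close>

lemma web_connection_unique:
  assumes F: "F \<in> veronese_webs" and D: "is_web_connection F D" and D': "is_web_connection F D'"
  shows "D = D'"
proof -
  obtain C where C: "D = conn_of C" using linear_connection_imp_conn_of D unfolding is_web_connection_def by blast
  obtain C' where C': "D' = conn_of C'" using linear_connection_imp_conn_of D' unfolding is_web_connection_def by blast
  have "C p u v = C' p u v" for p u v
  proof -
    obtain U \<phi> w where p: "p \<in> U" and ad: "adapted_coords F 1 U \<phi> w" using adapted_coords_exist[OF F] by blast
    have ch: "chart U \<phi>" using ad unfolding adapted_coords_def by (rule conjunct1)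
    then have U: "open U" unfolding chart_def by (rule conjunct1)
    note DD = D[unfolded is_web_connection_def Let_def, THEN conjunct2, THEN spec, THEN spec, THEN spec, THEN spec,
        THEN mp, OF one_neq_zero, THEN mp, OF ad]
      and DD' = D'[unfolded is_web_connection_def Let_def, THEN conjunct2, THEN spec, THEN spec, THEN spec, THEN spec,
        THEN mp, OF one_neq_zero, THEN mp, OF ad]
    have ex: "\<exists>Z. cov_deriv_on D U (coord_field U \<phi> i) (coord_field U \<phi> j) Z \<and> cov_deriv_on D' U (coord_field U \<phi> i) (coord_field U \<phi> j) Z" for i j
    proof -
      consider "i = 1" "j = 1" | "i = 1" "j = 2" | "i = 2" "j = 1" | "i = 2" "j = 2"
        using exhaust_2[of i] exhaust_2[of j] by blast
      then show ?thesis by cases (use DD DD' in \<open>simp only:, blast\<close>)+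
    qed
    have eq: "C p (coord_field U \<phi> i p) (coord_field U \<phi> j p) = C' p (coord_field U \<phi> i p) (coord_field U \<phi> j p)" for i j
    proof -
      obtain Z where Z: "cov_deriv_on D U (coord_field U \<phi> i) (coord_field U \<phi> j) Z" "cov_deriv_on D' U (coord_field U \<phi> i) (coord_field U \<phi> j) Z"
        using ex[of i j] by blast
      obtain A B where A: "smooth_on UNIV A" "\<forall>\<^sub>F q in nhds p. A q = coord_field U \<phi> i q"
        and B: "smooth_on UNIV B" "\<forall>\<^sub>F q in nhds p. B q = coord_field U \<phi> j q"
        using smooth_germ_extension[OF U p coord_field_props(1)[OF ch, of i]]
          smooth_germ_extension[OF U p coord_field_props(1)[OF ch, of j]] by blast
      have ev: "\<forall>\<^sub>F q in nhds p. A q = coord_field U \<phi> i q \<and> B q = coord_field U \<phi> j q"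
        by (rule eventually_conj[OF A(2) B(2)])
      have "D A B p = Z p" "D' A B p = Z p"
        using Z p A(1) B(1) ev unfolding cov_deriv_on_def by blast+
      then have "cov C (coord_field U \<phi> i) (coord_field U \<phi> j) p = cov C' (coord_field U \<phi> i) (coord_field U \<phi> j) p"
        unfolding C C' conn_of_germ[OF A(1) B(1) ev] by simp
      then show ?thesis by (simp add: cov_def)
    qed
    obtain a b where u: "u = a *\<^sub>R coord_field U \<phi> 1 p + b *\<^sub>R coord_field U \<phi> 2 p"
      using coord_field_props(4)[OF ch p] by blast
    obtain c d where v: "v = c *\<^sub>R coord_field U \<phi> 1 p + d *\<^sub>R coord_field U \<phi> 2 p"
      using coord_field_props(4)[OF ch p] by blast
    show ?thesis unfolding u v by (simp add: blinfun.bilinear_simps eq)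
  qed
  then have "C = C'" by (intro ext blinfun_eqI)
  then show ?thesis using C C' by simp
qed

subsection \<open>The web of a connection with skew-symmetric Ricci tensor\<close>

text \<open>The component form of the flatness needed in \<open>parallel_coframe\<close>. The
  matrices (a b; c d) and (p q; r t) stand for C h and C k, \<open>m\<close> and \<open>n\<close>
  for the derivatives of C k along h and of C h along k, and \<open>s\<close> for the scalar
  curvature factor. Commutators are traceless, so half the trace of \<open>E\<close> gives M - N =
  s: the subtracted traces remove exactly the curvature, while \<open>T\<close> and \<open>P\<close>
  cancel.\<close>

lemma traceless_transpose_flat:
  fixes a b c d p q r t m11 m12 m21 m22 n11 n12 n21 n22 s w1 w2 :: real
  assumes E: "m11 - n11 + (p * a + r * b) - (a * p + c * q) = s" "m21 - n21 + (p * c + r * d) - (a * r + c * t) = 0"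
    "m12 - n12 + (q * a + t * b) - (b * p + d * q) = 0" "m22 - n22 + (q * c + t * d) - (b * r + d * t) = s"
    and M: "2 * M = m11 + m22" and N: "2 * N = n11 + n22"
  shows "w1 * m11 + w2 * m21 - M * w1 + ((w1 * a + w2 * c - T * w1) * p + (w1 * b + w2 * d - T * w2) * r - P * (w1 * a + w2 * c - T * w1))
      = w1 * n11 + w2 * n21 - N * w1 + ((w1 * p + w2 * r - P * w1) * a + (w1 * q + w2 * t - P * w2) * c - T * (w1 * p + w2 * r - P * w1))"
      (is "?l1 = ?r1")
    and "w1 * m12 + w2 * m22 - M * w2 + ((w1 * a + w2 * c - T * w1) * q + (w1 * b + w2 * d - T * w2) * t - P * (w1 * b + w2 * d - T * w2))
      = w1 * n12 + w2 * n22 - N * w2 + ((w1 * p + w2 * r - P * w1) * b + (w1 * q + w2 * t - P * w2) * d - T * (w1 * q + w2 * t - P * w2))"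
      (is "?l2 = ?r2")
proof -
  have "2 * (M - N) = 2 * s" using E(1,4) M N by (simp add: algebra_simps)
  then have MN: "M - N = s" by simp
  have "?l1 - ?r1 = w1 * (m11 - n11 + (p * a + r * b) - (a * p + c * q)) + w2 * (m21 - n21 + (p * c + r * d) - (a * r + c * t)) - (M - N) * w1"
    by (simp add: algebra_simps)
  then show "?l1 = ?r1" unfolding E MN by simp
  have "?l2 - ?r2 = w1 * (m12 - n12 + (q * a + t * b) - (b * p + d * q)) + w2 * (m22 - n22 + (q * c + t * d) - (b * r + d * t)) - (M - N) * w2"
    by (simp add: algebra_simps)
  then show "?l2 = ?r2" unfolding E MN by simp
qed

text \<open>With \<open>A\<^sub>v = C v\<close>, the forms \<open>w\<close> solve \<open>d w(v) = (A\<^sub>v - tr A\<^sub>v / 2)\<^sup>T w\<close>. Subtracting half the trace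
  makes the system flat as soon as the curvature is a multiple of the identity, and it keeps the
  determinant of two solutions constant.\<close>

lemma parallel_coframe:
  assumes C: "smooth_on UNIV C" and scalar: "\<And>p. \<exists>\<kappa>. \<forall>z. curv C p e1 e2 z = \<kappa> *\<^sub>R z"
  shows "\<exists>w0 w1 \<theta>. smooth_on UNIV w0 \<and> smooth_on UNIV w1 \<and>
    (\<forall>q v z. frechet_derivative w0 (at q) v \<bullet> z = w0 q \<bullet> blinfun_apply (blinfun_apply (C q) v) z + \<theta> q v * (w0 q \<bullet> z)) \<and>
    (\<forall>q v z. frechet_derivative w1 (at q) v \<bullet> z = w1 q \<bullet> blinfun_apply (blinfun_apply (C q) v) z + \<theta> q v * (w1 q \<bullet> z)) \<and>
    (\<forall>q. w0 q $ 1 * w1 q $ 2 - w0 q $ 2 * w1 q $ 1 = 1)"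
proof -
  define \<tau> :: "christoffel_pt \<Rightarrow> real^2 \<Rightarrow> real" where "\<tau> c v = (c v e1 $ 1 + c v e2 $ 2) / 2" for c v
  \<comment> \<open>The transpose of \<open>c v\<close>, written on the standard basis, minus half
    the trace; it becomes the coefficient of the system for the coefficient vector of a
    one-form.\<close>
  define g :: "christoffel_pt \<Rightarrow> real^2 \<Rightarrow> real^2 \<Rightarrow> real^2" where
    "g c v w = (w \<bullet> c v e1) *\<^sub>R e1 + (w \<bullet> c v e2) *\<^sub>R e2 - \<tau> c v *\<^sub>R w" for c v w
  have "\<exists>n. \<forall>v w. blinfun_apply (blinfun_apply n v) w = g c v w" for c
  proof (rule blinfun2_exists)
    have \<tau>: "\<tau> c (u + v) = \<tau> c u + \<tau> c v" "\<tau> c (a *\<^sub>R v) = a * \<tau> c v" for u v a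
      by (simp_all add: \<tau>_def blinfun.bilinear_simps add_divide_distrib distrib_left)
    show "linear (\<lambda>u. g c u v)" for v
      by (rule linearI) (simp_all add: g_def \<tau> blinfun.bilinear_simps inner_add_right vec_eq_iff forall_2 algebra_simps)
    show "linear (g c u)" for u
      by (rule linearI) (simp_all add: g_def inner_add_left vec_eq_iff forall_2 algebra_simps)
  qed
  then have "\<forall>q. \<exists>n. \<forall>v w. blinfun_apply (blinfun_apply n v) w = g (C q) v w" by (intro allI)
  then obtain N where N: "\<forall>q. \<forall>v w. blinfun_apply (blinfun_apply (N q) v) w = g (C q) v w"
    by (rule choice[THEN exE])
  have Cs: "smooth_on UNIV (\<lambda>q. C q u v)" for u v
    by (intro smooth_on_blinfun_apply smooth_on_const open_UNIV C)
  have "smooth_on UNIV (\<lambda>q. N q v w)" for v w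
  proof -
    have "smooth_on UNIV (\<lambda>q. w \<bullet> C q v e1)" "smooth_on UNIV (\<lambda>q. w \<bullet> C q v e2)" "smooth_on UNIV (\<lambda>q. \<tau> (C q) v)"
      unfolding \<tau>_def
      by (rule smooth_on_bounded_linear[OF bounded_linear_inner_right open_UNIV Cs],
          rule smooth_on_bounded_linear[OF bounded_linear_inner_right open_UNIV Cs],
          rule smooth_on_divide[OF open_UNIV smooth_on_add[OF open_UNIV smooth_on_vec_nth[OF open_UNIV Cs] smooth_on_vec_nth[OF open_UNIV Cs]] smooth_on_const]) simp
    then have "smooth_on UNIV (\<lambda>q. g (C q) v w)"
      unfolding g_def by (intro smooth_on_diff smooth_on_add smooth_on_scaleR smooth_on_const open_UNIV)
    then show ?thesis by (simp add: N)
  qed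
  then have sN: "smooth_on UNIV N" by (intro smooth_on_blinfun open_UNIV)
  have dN: "frechet_derivative N (at x) h k w = g (frechet_derivative C (at x) h) k w" for x h k w
  proof -
    have dC: "((\<lambda>q. C q k z) has_derivative (\<lambda>h. frechet_derivative C (at x) h k z)) (at x)" for z
      using has_derivative_blinfun_apply[OF has_derivative_blinfun_apply[OF smooth_on_has_derivative[OF C UNIV_I] has_derivative_const[of k]] has_derivative_const[of z]]
      by (simp add: blinfun.bilinear_simps)
    have dCi: "((\<lambda>q. C q k z $ i) has_derivative (\<lambda>h. frechet_derivative C (at x) h k z $ i)) (at x)" for z i
      by (rule bounded_linear.has_derivative[OF bounded_linear_vec_nth dC])
    have "((\<lambda>q. \<tau> (C q) k) has_derivative (\<lambda>h. \<tau> (frechet_derivative C (at x) h) k)) (at x)"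
      unfolding \<tau>_def divide_inverse by (intro has_derivative_mult_left has_derivative_add dCi)
    then have 1: "((\<lambda>q. g (C q) k w) has_derivative (\<lambda>h. g (frechet_derivative C (at x) h) k w)) (at x)"
      unfolding g_def by (intro has_derivative_diff has_derivative_add has_derivative_scaleR_left has_derivative_inner_right dC)
    have "((\<lambda>q. N q k w) has_derivative (\<lambda>h. frechet_derivative N (at x) h k w)) (at x)"
      using has_derivative_blinfun_apply[OF has_derivative_blinfun_apply[OF smooth_on_has_derivative[OF sN UNIV_I] has_derivative_const[of k]] has_derivative_const[of w]]
      by (simp add: blinfun.bilinear_simps)
    from fun_cong[OF has_derivative_unique[OF this[unfolded N[rule_format]] 1], of h] show ?thesis .
  qed
  have flat: "frechet_derivative N (at x) h k + (N x k o\<^sub>L N x h) = frechet_derivative N (at x) k h + (N x h o\<^sub>L N x k)" for x h k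
  proof (rule blinfun_eqI)
    fix w
    let ?dC = "frechet_derivative C (at x)"
    obtain \<kappa> where \<kappa>: "\<And>z. curv C x e1 e2 z = \<kappa> *\<^sub>R z" using scalar by blast
    define s where "s = (h $ 1 * k $ 2 - h $ 2 * k $ 1) * \<kappa>"
    have cv: "curv C x h k z = s *\<^sub>R z" for z
      using curv_vec2[OF C, of x h k z] by (simp add: \<kappa> s_def)
    have ex: "C x h z = z $ 1 *\<^sub>R C x h e1 + z $ 2 *\<^sub>R C x h e2" "C x k z = z $ 1 *\<^sub>R C x k e1 + z $ 2 *\<^sub>R C x k e2" for z
      using blinfun_vec2 by blast+
    have c: "?dC h k e1 - ?dC k h e1 + C x h (C x k e1) - C x k (C x h e1) = s *\<^sub>R e1"
      "?dC h k e2 - ?dC k h e2 + C x h (C x k e2) - C x k (C x h e2) = s *\<^sub>R e2"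
      using cv[of e1] cv[of e2] unfolding curv_def by simp_all
    note c' = c[unfolded ex(1)[of "C x k e1"] ex(1)[of "C x k e2"] ex(2)[of "C x h e1"] ex(2)[of "C x h e2"], unfolded vec_eq_iff forall_2]
    have "g (?dC h) k w + g (C x) k (g (C x) h w) = g (?dC k) h w + g (C x) h (g (C x) k w)"
    proof -
      have 1: "?dC h k e1 $ 1 - ?dC k h e1 $ 1 + (C x k e1 $ 1 * C x h e1 $ 1 + C x k e1 $ 2 * C x h e2 $ 1)
          - (C x h e1 $ 1 * C x k e1 $ 1 + C x h e1 $ 2 * C x k e2 $ 1) = s"
        and 2: "?dC h k e1 $ 2 - ?dC k h e1 $ 2 + (C x k e1 $ 1 * C x h e1 $ 2 + C x k e1 $ 2 * C x h e2 $ 2)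
          - (C x h e1 $ 1 * C x k e1 $ 2 + C x h e1 $ 2 * C x k e2 $ 2) = 0"
        and 3: "?dC h k e2 $ 1 - ?dC k h e2 $ 1 + (C x k e2 $ 1 * C x h e1 $ 1 + C x k e2 $ 2 * C x h e2 $ 1)
          - (C x h e2 $ 1 * C x k e1 $ 1 + C x h e2 $ 2 * C x k e2 $ 1) = 0"
        and 4: "?dC h k e2 $ 2 - ?dC k h e2 $ 2 + (C x k e2 $ 1 * C x h e1 $ 2 + C x k e2 $ 2 * C x h e2 $ 2)
          - (C x h e2 $ 1 * C x k e1 $ 2 + C x h e2 $ 2 * C x k e2 $ 2) = s"
        using c' by simp_all
      have g_nth: "g c v u $ 1 = u $ 1 * c v e1 $ 1 + u $ 2 * c v e1 $ 2 - \<tau> c v * u $ 1"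
        "g c v u $ 2 = u $ 1 * c v e2 $ 1 + u $ 2 * c v e2 $ 2 - \<tau> c v * u $ 2" for c v u
        by (simp_all add: g_def inner_vec_def sum_2)
      have t: "2 * \<tau> c v = c v e1 $ 1 + c v e2 $ 2" for c v by (simp add: \<tau>_def)
      show ?thesis
        unfolding vec_eq_iff forall_2 vector_add_component g_nth
        by (intro conjI traceless_transpose_flat[OF 1 2 3 4 t t])
    qed
    then show "(frechet_derivative N (at x) h k + (N x k o\<^sub>L N x h)) w = (frechet_derivative N (at x) k h + (N x h o\<^sub>L N x k)) w"
      by (simp add: blinfun.add_left dN N)
  qed
  \<comment> \<open>The initial values \<open>e1\<close> and \<open>e2\<close> give determinant 1 at
    the origin; the determinant is constant, so the solutions form a coframe on the whole
    plane.\<close>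
  obtain w0 where w0: "smooth_on UNIV w0" "w0 0 = e1" "\<forall>x. (w0 has_derivative (\<lambda>h. N x h (w0 x))) (at x)"
    using flat_linear_system[OF sN flat, of e1] by (elim exE conjE)
  obtain w1 where w1: "smooth_on UNIV w1" "w1 0 = e2" "\<forall>x. (w1 has_derivative (\<lambda>h. N x h (w1 x))) (at x)"
    using flat_linear_system[OF sN flat, of e2] by (elim exE conjE)
  have dw: "frechet_derivative w0 (at q) v = g (C q) v (w0 q)" "frechet_derivative w1 (at q) v = g (C q) v (w1 q)" for q v
    using fun_cong[OF frechet_derivative_at[OF w0(3)[rule_format]]] fun_cong[OF frechet_derivative_at[OF w1(3)[rule_format]]]
    by (simp_all add: N)
  have g_inner: "g c v w \<bullet> z = w \<bullet> c v z + (- \<tau> c v) * (w \<bullet> z)" for c :: christoffel_pt and v w z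
    using blinfun_vec2[of "c v" z]
    by (simp add: g_def inner_diff_left inner_add_left inner_vec_def[of e1 z] inner_vec_def[of e2 z] sum_2 inner_add_right)
  have "((\<lambda>q. w0 q $ 1 * w1 q $ 2 - w0 q $ 2 * w1 q $ 1) has_derivative (\<lambda>h. 0)) (at x within UNIV)" for x
  proof -
    have d: "((\<lambda>q. w0 q $ i) has_derivative (\<lambda>h. g (C x) h (w0 x) $ i)) (at x)"
      "((\<lambda>q. w1 q $ i) has_derivative (\<lambda>h. g (C x) h (w1 x) $ i)) (at x)" for i
      using bounded_linear.has_derivative[OF bounded_linear_vec_nth w0(3)[rule_format, of x], of i]
        bounded_linear.has_derivative[OF bounded_linear_vec_nth w1(3)[rule_format, of x], of i] by (simp_all add: N)
    have "(w0 x $ 1 * g (C x) h (w1 x) $ 2 + g (C x) h (w0 x) $ 1 * w1 x $ 2) -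
        (w0 x $ 2 * g (C x) h (w1 x) $ 1 + g (C x) h (w0 x) $ 2 * w1 x $ 1) = 0" for h
      by (simp add: g_def \<tau>_def inner_vec_def sum_2 field_simps)
    with has_derivative_diff[OF has_derivative_mult[OF d(1)[of 1] d(2)[of 2]] has_derivative_mult[OF d(1)[of 2] d(2)[of 1]]]
    show ?thesis by simp
  qed
  from has_derivative_zero_constant[OF convex_UNIV this]
  obtain c where "\<And>q. w0 q $ 1 * w1 q $ 2 - w0 q $ 2 * w1 q $ 1 = c" by blast
  from this this[of 0] have det: "w0 q $ 1 * w1 q $ 2 - w0 q $ 2 * w1 q $ 1 = 1" for q by (simp add: w0(2) w1(2))
  show ?thesis
    by (rule exI[of _ w0], rule exI[of _ w1], rule exI[of _ "\<lambda>q v. - \<tau> (C q) v"])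
      (intro conjI allI w0(1) w1(1) det; simp only: dw g_inner)
qed

text \<open>The web is the pencil of the parallel coframe. Parallelism follows from the common
  factor \<open>\<theta>\<close>, and each member is a foliation because a nonvanishing one-form in
  the plane has local first integrals.\<close>

lemma web_of_connection:
  assumes C: "smooth_on UNIV C" and scalar: "\<And>p. \<exists>\<kappa>. \<forall>z. curv C p e1 e2 z = \<kappa> *\<^sub>R z"
  shows "\<exists>F\<in>veronese_webs. \<forall>q. web_parallel_at (C q) F q"
proof -
  obtain w0 w1 \<theta> where w: "smooth_on UNIV w0" "smooth_on UNIV w1"
    and dw: "\<forall>q v z. frechet_derivative w0 (at q) v \<bullet> z = w0 q \<bullet> blinfun_apply (blinfun_apply (C q) v) z + \<theta> q v * (w0 q \<bullet> z)"
      "\<forall>q v z. frechet_derivative w1 (at q) v \<bullet> z = w1 q \<bullet> blinfun_apply (blinfun_apply (C q) v) z + \<theta> q v * (w1 q \<bullet> z)"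
    and det: "\<forall>q. w0 q $ 1 * w1 q $ 2 - w0 q $ 2 * w1 q $ 1 = 1"
    using parallel_coframe[OF assms] by (elim exE conjE)
  \<comment> \<open>Imposing the equation for every vector of the line \<open>line_of P\<close>
    makes \<open>F\<close> well defined without choosing homogeneous coordinates.\<close>
  define F :: "rp1 \<Rightarrow> line_field" where
    "F P q = {v. \<forall>a\<in>line_of P. a $ 1 * (w0 q \<bullet> v) + a $ 2 * (w1 q \<bullet> v) = 0}" for P q
  have F: "F (hpoint s t) q = {v. s * (w0 q \<bullet> v) + t * (w1 q \<bullet> v) = 0}" if "(s, t) \<noteq> (0, 0)" for s t q
  proof -
    have "(\<forall>a\<in>span {vector [s, t] :: real^2}. a $ 1 * x + a $ 2 * y = 0) \<longleftrightarrow> s * x + t * y = 0" for x y :: real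
    proof
      assume "\<forall>a\<in>span {vector [s, t] :: real^2}. a $ 1 * x + a $ 2 * y = 0"
      from this[rule_format, OF span_base[OF singletonI]] show "s * x + t * y = 0" by simp
    next
      assume 0: "s * x + t * y = 0"
      have "k * s * x + k * t * y = 0" for k
        using arg_cong[OF 0, of "\<lambda>r. k * r"] by (simp add: algebra_simps)
      then show "\<forall>a\<in>span {vector [s, t] :: real^2}. a $ 1 * x + a $ 2 * y = 0" by (auto simp: span_singleton)
    qed
    then show ?thesis unfolding F_def line_of_hpoint[OF that] by blast
  qed
  have nz: "s *\<^sub>R w0 q + t *\<^sub>R w1 q \<noteq> 0" if "(s, t) \<noteq> (0, 0)" for s t q
  proof
    assume "s *\<^sub>R w0 q + t *\<^sub>R w1 q = 0"
    then have "s * w0 q $ 1 + t * w1 q $ 1 = 0" "s * w0 q $ 2 + t * w1 q $ 2 = 0" by (simp_all add: vec_eq_iff forall_2)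
    with det[rule_format, of q] have "s = 0" "t = 0" by algebra+
    with that show False by simp
  qed
  have fol: "foliation (F P)" for P
    unfolding foliation_def
  proof
    fix p
    obtain s t where st: "(s, t) \<noteq> (0, 0)" and P: "P = hpoint s t" using hpoint_cases by blast
    have "smooth_on UNIV (\<lambda>q. s *\<^sub>R w0 q + t *\<^sub>R w1 q)"
      by (intro smooth_on_add smooth_on_scaleR smooth_on_const open_UNIV w)
    from first_integral[OF open_UNIV UNIV_I this nz[OF st, of p]]
    obtain V f where "open V" "p \<in> V" "smooth_on V f"
      "\<forall>q\<in>V. frechet_derivative f (at q) \<noteq> (\<lambda>_. 0) \<and> ker_d f q = {v. (s *\<^sub>R w0 q + t *\<^sub>R w1 q) \<bullet> v = 0}"
      by (elim exE conjE)
    moreover have "F P q = {v. (s *\<^sub>R w0 q + t *\<^sub>R w1 q) \<bullet> v = 0}" for q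
      unfolding P F[OF st] by (simp add: inner_add_left)
    ultimately show "\<exists>U f. open U \<and> p \<in> U \<and> smooth_on U f \<and> (\<forall>q\<in>U. frechet_derivative f (at q) \<noteq> (\<lambda>_. 0) \<and> F P q = ker_d f q)"
      by (intro exI[of _ V] exI[of _ f]) simp
  qed
  define \<omega>0 \<omega>1 where "\<omega>0 q = blinfun_inner_left (w0 q)" and "\<omega>1 q = blinfun_inner_left (w1 q)" for q
  have sw: "smooth_on UNIV \<omega>0" "smooth_on UNIV \<omega>1"
    unfolding \<omega>0_def \<omega>1_def by (intro smooth_on_bounded_linear[OF bounded_linear_blinfun_inner_left] open_UNIV w)+
  have ap: "\<omega>0 q v = w0 q \<bullet> v" "\<omega>1 q v = w1 q \<bullet> v" for q v by (simp_all add: \<omega>0_def \<omega>1_def inner_commute)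
  have "indep_one_forms_on UNIV \<omega>0 \<omega>1"
    unfolding indep_one_forms_on_def
  proof (intro conjI sw ballI allI impI)
    fix q a b assume 0: "a *\<^sub>R \<omega>0 q + b *\<^sub>R \<omega>1 q = 0"
    have "(a *\<^sub>R w0 q + b *\<^sub>R w1 q) \<bullet> v = 0" for v
      using arg_cong[OF 0, of "\<lambda>f. blinfun_apply f v"] by (simp add: blinfun.bilinear_simps ap inner_add_left)
    from this[of "a *\<^sub>R w0 q + b *\<^sub>R w1 q"] have "a *\<^sub>R w0 q + b *\<^sub>R w1 q = 0" by (simp only: inner_eq_zero_iff)
    with nz[of a b q] show "a = 0" "b = 0" by auto
  qed
  moreover have F\<omega>: "F (hpoint s t) q = {v. s * \<omega>0 q v + t * \<omega>1 q v = 0}" if "(s, t) \<noteq> (0, 0)" for s t q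
    unfolding F[OF that] ap ..
  ultimately have "F \<in> veronese_webs"
    unfolding veronese_webs_def using fol
    by (intro CollectI conjI allI exI[of _ UNIV] exI[of _ \<omega>0] exI[of _ \<omega>1] impI ballI open_UNIV UNIV_I)
      (simp_all add: blinfun.bilinear_simps)
  moreover have "web_parallel_at (C q) F q" for q
  proof (rule web_frame_parallelI)
    have "\<omega>0 q e1 * \<omega>1 q e2 - \<omega>0 q e2 * \<omega>1 q e1 = 1" for q
      using det[rule_format, of q] by (simp add: ap inner_axis)
    then show "web_frame UNIV \<omega>0 \<omega>1 F"
      unfolding web_frame_def using sw F\<omega> by simp
    have "(\<omega>0 has_derivative (\<lambda>v. blinfun_inner_left (frechet_derivative w0 (at q) v))) (at q)"
      "(\<omega>1 has_derivative (\<lambda>v. blinfun_inner_left (frechet_derivative w1 (at q) v))) (at q)"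
      unfolding \<omega>0_def[abs_def] \<omega>1_def[abs_def]
      by (rule bounded_linear.has_derivative[OF bounded_linear_blinfun_inner_left smooth_on_has_derivative[OF w(1) UNIV_I]],
          rule bounded_linear.has_derivative[OF bounded_linear_blinfun_inner_left smooth_on_has_derivative[OF w(2) UNIV_I]])
    note dd = this[THEN frechet_derivative_at]
    have d: "frechet_derivative \<omega>0 (at q) v = blinfun_inner_left (frechet_derivative w0 (at q) v)"
      "frechet_derivative \<omega>1 (at q) v = blinfun_inner_left (frechet_derivative w1 (at q) v)" for v
      using fun_cong[OF dd(1), of v] fun_cong[OF dd(2), of v] by simp_all
    show "blinfun_apply (frechet_derivative \<omega>0 (at q) v) z = \<omega>0 q (blinfun_apply (blinfun_apply (C q) v) z) + \<theta> q v * \<omega>0 q z" for v z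
      using dw(1)[rule_format, of q v z] by (simp only: d ap blinfun_inner_left.rep_eq inner_commute[of z])
    show "blinfun_apply (frechet_derivative \<omega>1 (at q) v) z = \<omega>1 q (blinfun_apply (blinfun_apply (C q) v) z) + \<theta> q v * \<omega>1 q z" for v z
      using dw(2)[rule_format, of q v z] by (simp only: d ap blinfun_inner_left.rep_eq inner_commute[of z])
  qed simp
  ultimately show ?thesis by blast
qed

subsection \<open>Webs with the same connection\<close>

text \<open>Two forms are proportional iff their determinant \<open>h\<close> vanishes; if both are parallel up to a
  factor, then \<open>h\<close> solves a linear homogeneous equation along every line.\<close>

lemma parallel_at_local_factor:
  assumes C: "smooth_on UNIV C" and \<alpha>: "represents U \<alpha> T" and p: "p \<in> U" and par: "\<forall>q\<in>U. parallel_at (C q) \<alpha> q"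
  shows "\<exists>V \<sigma>. open V \<and> p \<in> V \<and> V \<subseteq> U \<and> (\<forall>v. continuous_on V (\<lambda>r. \<sigma> r v)) \<and>
    (\<forall>r\<in>V. \<forall>v z. blinfun_apply (frechet_derivative \<alpha> (at r) v) z = blinfun_apply (\<alpha> r) (C r v z) + \<sigma> r v * blinfun_apply (\<alpha> r) z)"
proof -
  have U: "open U" "smooth_on U \<alpha>" "\<And>r. r \<in> U \<Longrightarrow> \<alpha> r \<noteq> 0" using \<alpha> by (auto simp: represents_def)
  obtain n where n: "\<alpha> p n \<noteq> 0" using U(3)[OF p] by (metis blinfun_eqI zero_blinfun.rep_eq)
  define V where "V = U \<inter> (\<lambda>r. \<alpha> r n) -` (- {0})"
  have sn: "smooth_on U (\<lambda>r. \<alpha> r n)" by (intro smooth_on_blinfun_apply smooth_on_const U)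
  have V: "open V" "p \<in> V" "V \<subseteq> U"
    using continuous_open_preimage[OF smooth_on_continuous_on[OF sn] U(1), of "- {0}"] p n
    by (simp_all add: V_def open_Compl)
  define \<sigma> where "\<sigma> r v = (frechet_derivative \<alpha> (at r) v n - \<alpha> r (C r v n)) / \<alpha> r n" for r v
  have sV: "smooth_on V \<alpha>" "smooth_on V C"
    using smooth_on_subset[OF U(2) V(3)] smooth_on_subset[OF C subset_UNIV] by blast+
  have "smooth_on V (\<lambda>r. \<sigma> r v)" for v
    unfolding \<sigma>_def
    by (intro smooth_on_divide smooth_on_diff smooth_on_blinfun_apply smooth_on_const smooth_on_frechet_derivative V sV)
      (simp add: V_def)
  then have "\<forall>v. continuous_on V (\<lambda>r. \<sigma> r v)" using smooth_on_continuous_on by blast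
  moreover have "blinfun_apply (frechet_derivative \<alpha> (at r) v) z = blinfun_apply (\<alpha> r) (C r v z) + \<sigma> r v * blinfun_apply (\<alpha> r) z"
    if r: "r \<in> V" for r v z
  proof -
    have rU: "r \<in> U" using V(3) r by blast
    from parallel_at_factor[OF par[rule_format, OF rU] U(3)[OF rU]]
    obtain \<theta> where \<theta>: "\<forall>v z. frechet_derivative \<alpha> (at r) v z = \<alpha> r (C r v z) + \<theta> v * \<alpha> r z" by (rule exE)
    have "\<sigma> r v = \<theta> v" using r unfolding \<sigma>_def \<theta>[rule_format] by (simp add: V_def)
    with \<theta> show ?thesis by simp
  qed
  ultimately show ?thesis using V by (intro exI[of _ V] exI[of _ \<sigma>]) simp
qed

definition form_det :: "one_form \<Rightarrow> one_form \<Rightarrow> real^2 \<Rightarrow> real" where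
  "form_det \<alpha> \<beta> r = \<alpha> r e1 * \<beta> r e2 - \<alpha> r e2 * \<beta> r e1"

lemma form_det_eq_0_iff:
  assumes "represents U \<alpha> T" "represents U \<beta> T'" "r \<in> U"
  shows "form_det \<alpha> \<beta> r = 0 \<longleftrightarrow> T r = T' r"
proof -
  have T: "T r = {v. \<alpha> r v = 0}" "T' r = {v. \<beta> r v = 0}" and nz: "\<alpha> r \<noteq> 0" "\<beta> r \<noteq> 0"
    using assms unfolding represents_def by blast+
  show ?thesis
  proof
    assume h: "form_det \<alpha> \<beta> r = 0"
    have id: "\<alpha> r x * \<beta> r y = \<alpha> r y * \<beta> r x" for x y
    proof -
      have "\<alpha> r x * \<beta> r y - \<alpha> r y * \<beta> r x = (x $ 1 * y $ 2 - x $ 2 * y $ 1) * form_det \<alpha> \<beta> r"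
        unfolding form_det_def blinfun_vec2[of "\<alpha> r" x] blinfun_vec2[of "\<alpha> r" y] blinfun_vec2[of "\<beta> r" x] blinfun_vec2[of "\<beta> r" y]
        by (simp add: algebra_simps)
      with h show ?thesis by simp
    qed
    obtain x where x: "\<alpha> r x \<noteq> 0" using nz(1) by (metis blinfun_eqI zero_blinfun.rep_eq)
    obtain y where y: "\<beta> r y \<noteq> 0" using nz(2) by (metis blinfun_eqI zero_blinfun.rep_eq)
    have "\<alpha> r v = 0 \<longleftrightarrow> \<beta> r v = 0" for v
      using id[of x v] id[of v y] x y by auto
    then show "T r = T' r" unfolding T by simp
  next
    assume eq: "T r = T' r"
    have "\<alpha> r (\<alpha> r e1 *\<^sub>R e2 - \<alpha> r e2 *\<^sub>R e1) = 0" by (simp add: blinfun.bilinear_simps)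
    then have "\<alpha> r e1 *\<^sub>R e2 - \<alpha> r e2 *\<^sub>R e1 \<in> T' r" unfolding eq[symmetric] T by simp
    then show "form_det \<alpha> \<beta> r = 0" unfolding T by (simp add: form_det_def blinfun.bilinear_simps)
  qed
qed

text \<open>Gronwall without inhomogeneity: along a segment inside the ball the determinant
  satisfies h' = m h with bounded m, so a zero at one end forces a zero at the other. Convexity of
  the ball supplies the segments.\<close>

lemma parallel_line_fields_locally:
  assumes C: "smooth_on UNIV C" and \<alpha>: "represents U \<alpha> T" and \<beta>: "represents U \<beta> T'" and p: "p \<in> U"
    and par: "\<forall>q\<in>U. parallel_at (C q) \<alpha> q" "\<forall>q\<in>U. parallel_at (C q) \<beta> q"
  shows "\<exists>e>0. \<forall>x\<in>ball p e. \<forall>y\<in>ball p e. T x = T' x \<longrightarrow> T y = T' y"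
proof -
  obtain V \<sigma> where V: "open V" "p \<in> V" "V \<subseteq> U" and \<sigma>c: "\<forall>v. continuous_on V (\<lambda>r. \<sigma> r v)"
    and \<sigma>: "\<forall>r\<in>V. \<forall>v z. blinfun_apply (frechet_derivative \<alpha> (at r) v) z = blinfun_apply (\<alpha> r) (C r v z) + \<sigma> r v * blinfun_apply (\<alpha> r) z"
    using parallel_at_local_factor[OF C \<alpha> p par(1)] by (elim exE conjE)
  obtain W \<rho> where W: "open W" "p \<in> W" "W \<subseteq> U" and \<rho>c: "\<forall>v. continuous_on W (\<lambda>r. \<rho> r v)"
    and \<rho>: "\<forall>r\<in>W. \<forall>v z. blinfun_apply (frechet_derivative \<beta> (at r) v) z = blinfun_apply (\<beta> r) (C r v z) + \<rho> r v * blinfun_apply (\<beta> r) z"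
    using parallel_at_local_factor[OF C \<beta> p par(2)] by (elim exE conjE)
  obtain e where e: "0 < e" "ball p e \<subseteq> V \<inter> W"
    using openE[OF open_Int[OF V(1) W(1)], of p] V(2) W(2) by blast
  have s: "smooth_on U \<alpha>" "smooth_on U \<beta>" using \<alpha> \<beta> by (auto simp: represents_def)
  let ?h = "form_det \<alpha> \<beta>"
  \<comment> \<open>The logarithmic derivative of the determinant: the factors of the two forms plus
    the trace of the Christoffel symbol.\<close>
  define \<mu> where "\<mu> r v = \<sigma> r v + \<rho> r v + (C r v e1 $ 1 + C r v e2 $ 2)" for r v
  have dh: "(?h has_derivative (\<lambda>v. \<mu> r v * ?h r)) (at r)" if r: "r \<in> ball p e" for r
  proof -
    have rV: "r \<in> V" and rW: "r \<in> W" using e(2) r by blast+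
    have rU: "r \<in> U" using V(3) rV by blast
    note d\<alpha> = form_has_derivative[OF s(1) rU, unfolded \<sigma>[rule_format, OF rV]]
      and d\<beta> = form_has_derivative[OF s(2) rU, unfolded \<rho>[rule_format, OF rW]]
    have "(\<alpha> r e1 * (\<beta> r (C r v e2) + \<rho> r v * \<beta> r e2) + (\<alpha> r (C r v e1) + \<sigma> r v * \<alpha> r e1) * \<beta> r e2) -
        (\<alpha> r e2 * (\<beta> r (C r v e1) + \<rho> r v * \<beta> r e1) + (\<alpha> r (C r v e2) + \<sigma> r v * \<alpha> r e2) * \<beta> r e1) = \<mu> r v * ?h r" for v
      unfolding blinfun_vec2[of "\<alpha> r" "C r v e1"] blinfun_vec2[of "\<alpha> r" "C r v e2"]
        blinfun_vec2[of "\<beta> r" "C r v e1"] blinfun_vec2[of "\<beta> r" "C r v e2"] form_det_def \<mu>_def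
      by (simp add: algebra_simps)
    with has_derivative_diff[OF has_derivative_mult[OF d\<alpha>[of e1] d\<beta>[of e2]] has_derivative_mult[OF d\<alpha>[of e2] d\<beta>[of e1]]]
    show ?thesis unfolding form_det_def[abs_def] by simp
  qed
  have \<mu>c: "continuous_on (ball p e) (\<lambda>r. \<mu> r v)" for v
  proof -
    have "smooth_on UNIV (\<lambda>r. C r v w $ i)" for w i
      by (intro smooth_on_vec_nth smooth_on_blinfun_apply smooth_on_const open_UNIV C)
    then have "continuous_on (ball p e) (\<lambda>r. C r v w $ i)" for w i
      using continuous_on_subset[OF smooth_on_continuous_on subset_UNIV] by blast
    moreover have "continuous_on (ball p e) (\<lambda>r. \<sigma> r v)" "continuous_on (ball p e) (\<lambda>r. \<rho> r v)"
      using continuous_on_subset[OF \<sigma>c[rule_format, of v]] continuous_on_subset[OF \<rho>c[rule_format, of v]] e(2) by blast+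
    ultimately show ?thesis unfolding \<mu>_def by (intro continuous_on_add)
  qed
  have "T y = T' y" if x: "x \<in> ball p e" and y: "y \<in> ball p e" and eq: "T x = T' x" for x y
  proof -
    have xU: "x \<in> U" and yU: "y \<in> U" using x y e(2) V(3) by blast+
    have seg: "x + t *\<^sub>R (y - x) \<in> ball p e" if "0 \<le> t" "t \<le> 1" for t
      using convexD_alt[OF convex_ball x y that] by (simp add: algebra_simps)
    let ?g = "\<lambda>t. ?h (x + t *\<^sub>R (y - x))" and ?m = "\<lambda>t. \<mu> (x + t *\<^sub>R (y - x)) (y - x)"
    have "continuous_on {0..1} ?m"
      by (rule continuous_on_compose2[OF \<mu>c]) (use seg in \<open>auto intro!: continuous_intros\<close>)
    from continuous_on_compact_norm_bound[OF this compact_Icc order_refl]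
    obtain K where K: "0 \<le> K" "\<forall>t\<in>{0..1}. norm (?m t) \<le> K" by blast
    have "(norm (?g 1))\<^sup>2 \<le> ((norm (?g 0))\<^sup>2 + 0\<^sup>2 * 1) * exp ((2 * K + 1) * 1)"
    proof (rule gronwall[where u' = "\<lambda>t. ?m t * ?g t"])
      show "(?g has_vector_derivative ?m t * ?g t) (at t)" if "0 \<le> t" "t \<le> 1" for t
        by (rule has_derivative_on_line[OF dh[OF seg[OF that]]])
      show "norm (?m t * ?g t) \<le> K * norm (?g t) + 0" if "0 \<le> t" "t \<le> 1" for t
        using K(2) that by (simp add: abs_mult mult_right_mono)
    qed (use K(1) in simp_all)
    moreover have "?g 0 = 0" using form_det_eq_0_iff[OF \<alpha> \<beta> xU] eq by simp
    ultimately have "?h y = 0" by simp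
    then show ?thesis using form_det_eq_0_iff[OF \<alpha> \<beta> yU] by simp
  qed
  with e(1) show ?thesis by blast
qed

text \<open>By the local lemma both the set where the line fields coincide and its complement are
  open, and the plane is connected. The parameters \<open>P\<close> and \<open>P'\<close> may
  differ, which is what a comparison up to reparametrization requires.\<close>

lemma parallel_line_fields_eq:
  assumes C: "smooth_on UNIV C" and F: "F \<in> veronese_webs" "\<And>q. web_parallel_at (C q) F q"
    and F': "F' \<in> veronese_webs" "\<And>q. web_parallel_at (C q) F' q"
    and eq: "F P x = F' P' x"
  shows "F P = F' P'"
proof -
  have ball: "\<exists>e>0. \<forall>x\<in>ball p e. \<forall>y\<in>ball p e. F P x = F' P' x \<longrightarrow> F P y = F' P' y" for p
  proof -
    obtain s t where st: "(s, t) \<noteq> (0, 0)" and P: "P = hpoint s t" using hpoint_cases[of P] by (elim exE conjE)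
    obtain s' t' where st': "(s', t') \<noteq> (0, 0)" and P': "P' = hpoint s' t'" using hpoint_cases[of P'] by (elim exE conjE)
    obtain U \<omega>0 \<omega>1 where U: "p \<in> U" "web_frame U \<omega>0 \<omega>1 F"
      using web_frame_exists[OF F(1), of p] by (elim exE conjE)
    obtain U' \<eta>0 \<eta>1 where U': "p \<in> U'" "web_frame U' \<eta>0 \<eta>1 F'"
      using web_frame_exists[OF F'(1), of p] by (elim exE conjE)
    have o: "open (U \<inter> U')" using U(2) U'(2) by (simp add: web_frame_def open_Int)
    note r = represents_subset[OF web_frame_represents[OF U(2) st] o Int_lower1, folded P]
      and r' = represents_subset[OF web_frame_represents[OF U'(2) st'] o Int_lower2, folded P']
    show ?thesis
    proof (rule parallel_line_fields_locally[OF C r r'])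
      show "p \<in> U \<inter> U'" using U(1) U'(1) by blast
    next
      show "\<forall>q\<in>U \<inter> U'. parallel_at (C q) (\<lambda>q. s *\<^sub>R \<omega>0 q + t *\<^sub>R \<omega>1 q) q"
        using F(2)[unfolded web_parallel_at_def, rule_format, OF _ r] by (rule ballI)
      show "\<forall>q\<in>U \<inter> U'. parallel_at (C q) (\<lambda>q. s' *\<^sub>R \<eta>0 q + t' *\<^sub>R \<eta>1 q) q"
        using F'(2)[unfolded web_parallel_at_def, rule_format, OF _ r'] by (rule ballI)
    qed
  qed
  define S where "S = {q. F P q = F' P' q}"
  have "open S"
  proof (rule openI)
    fix p assume "p \<in> S"
    then show "\<exists>e>0. ball p e \<subseteq> S" using ball[of p] centre_in_ball unfolding S_def by blast
  qed
  moreover have "open (- S)"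
  proof (rule openI)
    fix p assume "p \<in> - S"
    then show "\<exists>e>0. ball p e \<subseteq> - S" using ball[of p] centre_in_ball unfolding S_def by blast
  qed
  ultimately have "S = {} \<or> S = UNIV" using clopen[of S] by (simp add: closed_open)
  moreover have "x \<in> S" using eq by (simp add: S_def)
  ultimately have "S = UNIV" by blast
  then show ?thesis unfolding S_def by blast
qed

text \<open>At one point each web is a linear pencil filling the cotangent plane; expressing one
  basis of that plane through the other gives the matrix.\<close>

lemma web_moebius_at_point:
  assumes F: "F \<in> veronese_webs" and F': "F' \<in> veronese_webs"
  shows "\<exists>A. invertible A \<and> (\<forall>P. F' P p = F (moebius A P) p)"
proof -
  obtain U \<omega>0 \<omega>1 where U: "p \<in> U" and fr: "web_frame U \<omega>0 \<omega>1 F" using web_frame_exists[OF F, of p] by (elim exE conjE)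
  obtain U' \<eta>0 \<eta>1 where U': "p \<in> U'" and fr': "web_frame U' \<eta>0 \<eta>1 F'" using web_frame_exists[OF F', of p] by (elim exE conjE)
  have d: "form_det \<omega>0 \<omega>1 p \<noteq> 0" and d': "form_det \<eta>0 \<eta>1 p \<noteq> 0"
    using fr fr' U U' by (auto simp: web_frame_def form_det_def)
  have ex: "\<exists>a b. \<forall>v. blinfun_apply \<beta> v = a * \<omega>0 p v + b * \<omega>1 p v" for \<beta>
  proof -
    let ?a = "\<beta> e1 * \<omega>1 p e2 - \<beta> e2 * \<omega>1 p e1" and ?b = "\<omega>0 p e1 * \<beta> e2 - \<omega>0 p e2 * \<beta> e1"
    have "form_det \<omega>0 \<omega>1 p * \<beta> v = ?a * \<omega>0 p v + ?b * \<omega>1 p v" for v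
      unfolding blinfun_vec2[of \<beta> v] blinfun_vec2[of "\<omega>0 p" v] blinfun_vec2[of "\<omega>1 p" v] form_det_def real_scaleR_def
      by algebra
    then have "\<beta> v = ?a / form_det \<omega>0 \<omega>1 p * \<omega>0 p v + ?b / form_det \<omega>0 \<omega>1 p * \<omega>1 p v" for v
      using d by (simp add: add_divide_distrib[symmetric] eq_divide_eq mult.commute)
    then show ?thesis by (intro exI allI)
  qed
  obtain a b where ab: "\<forall>v. blinfun_apply (\<eta>0 p) v = a * \<omega>0 p v + b * \<omega>1 p v" using ex[of "\<eta>0 p"] by (elim exE)
  obtain c k where ck: "\<forall>v. blinfun_apply (\<eta>1 p) v = c * \<omega>0 p v + k * \<omega>1 p v" using ex[of "\<eta>1 p"] by (elim exE)
  \<comment> \<open>The columns are the coordinates of the two forms of \<open>F'\<close> in the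
    basis of \<open>F\<close>, so \<open>A\<close> sends (s,t) to the coefficients of s \<eta>0 + t
    \<eta>1.\<close>
  define A :: "real^2^2" where "A = vector [vector [a, c], vector [b, k]]"
  have "form_det \<eta>0 \<eta>1 p = (a * k - b * c) * form_det \<omega>0 \<omega>1 p"
    unfolding form_det_def ab[rule_format] ck[rule_format] by algebra
  then have "a * k - c * b \<noteq> 0" using d' by auto
  then have "det A \<noteq> 0" by (simp add: A_def det_2)
  then have A: "invertible A" by (simp add: invertible_det_nz)
  have "F' P p = F (moebius A P) p" for P
  proof -
    obtain s t where st: "(s, t) \<noteq> (0, 0)" and P: "P = hpoint s t" using hpoint_cases[of P] by (elim exE conjE)
    have Av: "(A *v vector [s, t]) $ 1 = a * s + c * t" "(A *v vector [s, t]) $ 2 = b * s + k * t"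
      by (simp_all add: A_def matrix_vector_mult_def sum_2)
    have st': "(a * s + c * t, b * s + k * t) \<noteq> (0, 0)"
    proof
      assume "(a * s + c * t, b * s + k * t) = (0, 0)"
      then have "a * s + c * t = 0" "b * s + k * t = 0" by simp_all
      then have "(a * k - c * b) * s = 0" "(a * k - c * b) * t = 0" by algebra+
      with \<open>a * k - c * b \<noteq> 0\<close> st show False by simp
    qed
    have "F' P p = {v. s * \<eta>0 p v + t * \<eta>1 p v = 0}"
      unfolding P by (rule fr'[unfolded web_frame_def, THEN conjunct2, THEN conjunct2, THEN conjunct2, THEN conjunct2, rule_format, OF st U'])
    also have "\<dots> = {v. (a * s + c * t) * \<omega>0 p v + (b * s + k * t) * \<omega>1 p v = 0}"
      unfolding ab[rule_format] ck[rule_format] by (simp add: algebra_simps)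
    also have "\<dots> = F (hpoint (a * s + c * t) (b * s + k * t)) p"
      by (rule fr[unfolded web_frame_def, THEN conjunct2, THEN conjunct2, THEN conjunct2, THEN conjunct2, rule_format, OF st' U, symmetric])
    also have "hpoint (a * s + c * t) (b * s + k * t) = moebius A P"
      unfolding P moebius_hpoint[OF st] Av ..
    finally show ?thesis .
  qed
  with A show ?thesis by blast
qed

section \<open>The correspondence between webs and connections\<close>

lemma conn_of_inject:
  assumes "conn_of C = conn_of C'"
  shows "C = C'"
proof -
  have "C p u v = C' p u v" for p u v
    using fun_cong[OF fun_cong[OF fun_cong[OF assms, of "\<lambda>_. u"], of "\<lambda>_. v"], of p]
    by (simp add: conn_of_def smooth_on_const)
  then show ?thesis by (intro ext blinfun_eqI)
qed

text \<open>Evaluates the definite description: from here on a web connection is handled through its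
  symmetric Christoffel symbols for which the web is parallel.\<close>

lemma web_connection_eq:
  assumes "F \<in> veronese_webs" "smooth_on UNIV C" "\<And>q. symmetric_pt (C q)" "\<And>q. web_parallel_at (C q) F q"
  shows "web_connection F = conn_of C"
  unfolding web_connection_def
  by (rule the_equality, rule is_web_connection_conn_of[OF assms(2-4)],
      rule web_connection_unique[OF assms(1) _ is_web_connection_conn_of[OF assms(2-4)]])

text \<open>\<open>web_parallel_at\<close> ranges over all parameters, so reindexing the web leaves
  its Christoffel symbols unchanged.\<close>

lemma web_connection_respects: "web_connection respects web_moebius"
proof (rule congruentI)
  fix F F' assume "(F, F') \<in> web_moebius"
  then obtain A where F: "F \<in> veronese_webs" "F' \<in> veronese_webs" and A: "\<And>P. F' P = F (moebius A P)"
    unfolding web_moebius_def by blast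
  obtain C where C: "smooth_on UNIV C" "\<forall>q. symmetric_pt (C q) \<and> web_parallel_at (C q) F q"
    using web_christoffel_exists[OF F(1)] by blast
  have "web_parallel_at (C q) F' q" for q
    using C(2)[rule_format, of q] unfolding web_parallel_at_def A by blast
  then show "web_connection F = web_connection F'"
    using web_connection_eq[OF F(1) C(1)] web_connection_eq[OF F(2) C(1)] C(2) by simp
qed

text \<open>Equal connections have equal Christoffel symbols, for which both webs are then parallel.
  The parametrizations are matched in the plane at the origin, and the coincidence of line fields
  there spreads to all points.\<close>

lemma web_connection_inject:
  assumes F: "F \<in> veronese_webs" and F': "F' \<in> veronese_webs" and eq: "web_connection F = web_connection F'"
  shows "(F, F') \<in> web_moebius"
proof -
  obtain C where C: "smooth_on UNIV C" "\<forall>q. symmetric_pt (C q) \<and> web_parallel_at (C q) F q"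
    using web_christoffel_exists[OF F] by blast
  obtain C' where C': "smooth_on UNIV C'" "\<forall>q. symmetric_pt (C' q) \<and> web_parallel_at (C' q) F' q"
    using web_christoffel_exists[OF F'] by blast
  have "conn_of C = conn_of C'"
    using web_connection_eq[OF F C(1)] web_connection_eq[OF F' C'(1)] C(2) C'(2) eq by simp
  then have CC: "C' = C" using conn_of_inject by blast
  obtain A where A: "invertible A" "\<forall>P. F' P 0 = F (moebius A P) 0" using web_moebius_at_point[OF F F'] by blast
  have "F' P = F (moebius A P)" for P
    by (rule parallel_line_fields_eq[where x=0, OF C(1) F' _ F]) (use C(2) C'(2) A(2) CC in simp_all)
  then show ?thesis using F F' A(1) unfolding web_moebius_def by blast
qed

lemma web_connection_in:
  assumes F: "F \<in> veronese_webs"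
  shows "web_connection F \<in> {D. linear_connection D \<and> torsion_free D \<and> ricci_skew D}"
proof -
  obtain C where C: "smooth_on UNIV C" "\<forall>q. symmetric_pt (C q) \<and> web_parallel_at (C q) F q"
    using web_christoffel_exists[OF F] by blast
  have "web_connection F = conn_of C" using web_connection_eq[OF F C(1)] C(2) by simp
  moreover have "torsion_free (conn_of C)"
    unfolding torsion_free_conn_of[OF C(1)] using C(2) by (simp add: symmetric_pt_def)
  moreover have "ricci_skew (conn_of C)"
    unfolding ricci_skew_conn_of[OF C(1)] using web_curv_scalar[OF F C(1)] C(2) by simp
  ultimately show ?thesis using linear_connection_conn_of[OF C(1)] by simp
qed

lemma web_connection_surj:
  assumes D: "linear_connection D" "torsion_free D" "ricci_skew D"
  shows "\<exists>F\<in>veronese_webs. web_connection F = D"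
proof -
  obtain C where C: "smooth_on UNIV C" and DC: "D = conn_of C" using linear_connection_imp_conn_of[OF D(1)] by blast
  have sym: "symmetric_pt (C q)" for q
    using D(2) unfolding DC torsion_free_conn_of[OF C] symmetric_pt_def by blast
  have "\<exists>\<kappa>. \<forall>z. curv C p e1 e2 z = \<kappa> *\<^sub>R z" for p
    using D(3) unfolding DC ricci_skew_conn_of[OF C] by (rule spec)
  from web_of_connection[OF C this]
  obtain F where F: "F \<in> veronese_webs" "\<forall>q. web_parallel_at (C q) F q" by blast
  with web_connection_eq[OF F(1) C sym] DC show ?thesis by blast
qed

text \<open>The first two conjuncts give the third its meaning: the description in
  \<open>web_connection\<close> denotes an object, and its value is constant on each Moebius
  class.\<close>

theorem theorem2p3:
  shows "(\<forall>F\<in>veronese_webs. \<exists>!D. is_web_connection F D) \<and>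
    web_connection respects web_moebius \<and>
    bij_betw (\<lambda>C. the_elem (web_connection ` C))
      (veronese_webs // web_moebius)
      {D. linear_connection D \<and> torsion_free D \<and> ricci_skew D}"
proof (intro conjI ballI)
  fix F assume F: "F \<in> veronese_webs"
  obtain C where C: "smooth_on UNIV C" "\<forall>q. symmetric_pt (C q) \<and> web_parallel_at (C q) F q"
    using web_christoffel_exists[OF F] by blast
  have "is_web_connection F (conn_of C)" using C by (intro is_web_connection_conn_of) simp_all
  then show "\<exists>!D. is_web_connection F D" using web_connection_unique[OF F] by blast
next
  show "web_connection respects web_moebius" by (rule web_connection_respects)
next
  \<comment> \<open>The image of a class is a singleton, so \<open>the_elem\<close> returns the
    connection of any of its representatives.\<close>
  have class_value: "the_elem (web_connection ` (web_moebius `` {F})) = web_connection F" if F: "F \<in> veronese_webs" for F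
  proof -
    have "F \<in> web_moebius `` {F}" by (rule equiv_class_self[OF equiv_web_moebius F])
    moreover have "web_connection G = web_connection F" if "G \<in> web_moebius `` {F}" for G
      using congruentD[OF web_connection_respects] that by fastforce
    ultimately have "web_connection ` (web_moebius `` {F}) = {web_connection F}" by blast
    then show ?thesis by simp
  qed
  show "bij_betw (\<lambda>C. the_elem (web_connection ` C)) (veronese_webs // web_moebius)
      {D. linear_connection D \<and> torsion_free D \<and> ricci_skew D}"
    unfolding bij_betw_def
  proof
    show "inj_on (\<lambda>C. the_elem (web_connection ` C)) (veronese_webs // web_moebius)"
    proof (rule inj_onI)
      fix X Y assume X: "X \<in> veronese_webs // web_moebius" and Y: "Y \<in> veronese_webs // web_moebius"
        and eq: "the_elem (web_connection ` X) = the_elem (web_connection ` Y)"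
      obtain F where F: "F \<in> veronese_webs" "X = web_moebius `` {F}" using X by (rule quotientE)
      obtain G where G: "G \<in> veronese_webs" "Y = web_moebius `` {G}" using Y by (rule quotientE)
      have "web_connection F = web_connection G"
        using eq class_value[OF F(1)] class_value[OF G(1)] F(2) G(2) by simp
      from web_connection_inject[OF F(1) G(1) this] show "X = Y"
        unfolding F(2) G(2) by (rule equiv_class_eq[OF equiv_web_moebius])
    qed
    show "(\<lambda>C. the_elem (web_connection ` C)) ` (veronese_webs // web_moebius) =
        {D. linear_connection D \<and> torsion_free D \<and> ricci_skew D}"
    proof (intro subset_antisym subsetI)
      fix D assume "D \<in> (\<lambda>C. the_elem (web_connection ` C)) ` (veronese_webs // web_moebius)"
      then obtain X where D: "D = the_elem (web_connection ` X)" and "X \<in> veronese_webs // web_moebius" by (rule imageE)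
      from this(2) obtain F where "F \<in> veronese_webs" "X = web_moebius `` {F}" by (rule quotientE)
      then show "D \<in> {D. linear_connection D \<and> torsion_free D \<and> ricci_skew D}"
        unfolding D using web_connection_in class_value by simp
    next
      fix D assume "D \<in> {D. linear_connection D \<and> torsion_free D \<and> ricci_skew D}"
      then obtain F where F: "F \<in> veronese_webs" "web_connection F = D" using web_connection_surj by blast
      then show "D \<in> (\<lambda>C. the_elem (web_connection ` C)) ` (veronese_webs // web_moebius)"
        using class_value[OF F(1)] quotientI[OF F(1), of web_moebius] by (intro image_eqI[of _ _ "web_moebius `` {F}"]) simp_all
    qed
  qed
qed

end
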